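(* Suppose a discrete group $\Gamma$ acts on a discrete abelian group $G$ by group automorphisms. Every irreducible unitary representation $\pi:G\rtimes\Gamma\to B(H)$ of the semidirect product group $G\rtimes\Gamma$ on a Hilbert space $H$ satisfies $\dim H_\Gamma\leq 1$. When $\dim H_\Gamma=1$, the representation $\pi$ is uniquely induced by an ergodic $\Gamma$-invariant regular Borel probability measure $\mu$ on the Pontryagin dual $\widehat G$ of $G$; that is, there is a unique such $\mu$ with $\pi$ unitarily equivalent to the representation $\rho_\mu$ of $G\rtimes\Gamma$ on $L^2(\widehat G,\mu)$.
   Context: $H_\Gamma=\{x\in H:\pi(s)x=x\text{ for all }s\in\Gamma\}$. The action of $\Gamma$ on $G$, written $g\mapsto s\cdot g$, induces an action on the compact group $\widehat G$ by the homeomorphisms $\chi\mapsto \chi\circ s^{-1}$, where $(\chi\circ s)(g)=\chi(s\cdot g)$. A regular Borel probability measure $\mu$ on $\widehat G$ is $\Gamma$-invariant if it is invariant under all these homeomorphisms, and ergodic if it is an extreme point of the convex set of $\Gamma$-invariant regular Borel probability measures. For a $\Gamma$-invariant $\mu$, $\rho_\mu$ is the unitary representation of $G\rtimes\Gamma$ on $L^2(\widehat G,\mu)$ in which $g\in G$ acts by multiplication by the function $\hat g(\chi)=\chi(g)$ and $s\in\Gamma$ acts by $(\rho_\mu(s)f)(\chi)=f(\chi\circ s)$. (Equivalently, under $C^*(G\rtimes\Gamma)\cong C(\widehat G)\rtimes\Gamma$, it is the representation arising from the GNS representation of $C(\widehat G)$ for the state $f\mapsto\int f\,d\mu$ together with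 the Koopman representation of $\Gamma$.) *)

theory Defs
  imports
    "HOL-Probability.Probability"
    "HOL-Algebra.Bij"
    "HOL-Library.Extended_Nat"
begin

section \<open>Complex Hilbert spaces\<close>

text \<open>The inner product is linear in its first argument. The last axiom says that the
  Banach-space norm is the one induced by the inner product; it also makes the inner product
  positive definite.\<close>

class complex_hilbert_space = banach +
  fixes scaleC :: "complex \<Rightarrow> 'a \<Rightarrow> 'a"
    and cinner :: "'a \<Rightarrow> 'a \<Rightarrow> complex"
  assumes scaleC_of_real: "scaleC (complex_of_real r) x = scaleR r x"
    and scaleC_add_right: "scaleC a (x + y) = scaleC a x + scaleC a y"
    and scaleC_add_left: "scaleC (a + b) x = scaleC a x + scaleC b x"
    and scaleC_scaleC: "scaleC a (scaleC b x) = scaleC (a * b) x"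
    and cinner_commute: "cinner x y = cnj (cinner y x)"
    and cinner_add_left: "cinner (x + y) z = cinner x z + cinner y z"
    and cinner_scaleC_left: "cinner (scaleC a x) y = a * cinner x y"
    and cinner_self: "cinner x x = complex_of_real ((norm x)\<^sup>2)"

lemma scaleC_one: "scaleC 1 (x :: 'a::complex_hilbert_space) = x"
  using scaleC_of_real[of 1 x] by simp

global_interpretation complex_vector:
  vector_space "scaleC :: complex \<Rightarrow> 'a \<Rightarrow> 'a::complex_hilbert_space"
  by unfold_locales
    (simp_all add: scaleC_add_right scaleC_add_left scaleC_scaleC scaleC_one)

text \<open>The library's \<open>dim\<close> is 0 for infinite-dimensional spaces; \<open>hdim\<close> takes the value
  \<open>\<infinity>\<close> there.\<close>

definition hdim :: "'h::complex_hilbert_space set \<Rightarrow> enat" where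
  "hdim S = (if \<exists>B. finite B \<and> S \<subseteq> complex_vector.span B
             then enat (complex_vector.dim S) else \<infinity>)"

definition unitary :: "('h::complex_hilbert_space \<Rightarrow> 'h) \<Rightarrow> bool" where
  "unitary U \<longleftrightarrow> surj U \<and>
     (\<forall>x y. U (x + y) = U x + U y) \<and> (\<forall>a x. U (scaleC a x) = scaleC a (U x)) \<and>
     (\<forall>x y. cinner (U x) (U y) = cinner x y)"

definition unitary_group :: "('h::complex_hilbert_space \<Rightarrow> 'h) monoid" where
  "unitary_group = \<lparr>carrier = Collect unitary, mult = (\<circ>), one = id\<rparr>"


section \<open>Unitary representations of discrete groups\<close>

definition unitary_rep ::
    "('x, 'm) monoid_scheme \<Rightarrow> ('x \<Rightarrow> 'h::complex_hilbert_space \<Rightarrow> 'h) \<Rightarrow> bool" where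
  "unitary_rep K \<pi> \<longleftrightarrow> \<pi> \<in> hom K unitary_group"

definition irreducible_unitary_rep ::
    "('x, 'm) monoid_scheme \<Rightarrow> ('x \<Rightarrow> 'h::complex_hilbert_space \<Rightarrow> 'h) \<Rightarrow> bool" where
  "irreducible_unitary_rep K \<pi> \<longleftrightarrow> unitary_rep K \<pi> \<and> (\<exists>x::'h. x \<noteq> 0) \<and>
     (\<forall>S. complex_vector.subspace S \<and> closed S \<and> (\<forall>k\<in>carrier K. \<pi> k ` S \<subseteq> S) \<longrightarrow>
        S = {0} \<or> S = UNIV)"

definition acts_by_automorphisms ::
    "('s, 'm) monoid_scheme \<Rightarrow> ('g, 'n) monoid_scheme \<Rightarrow> ('s \<Rightarrow> 'g \<Rightarrow> 'g) \<Rightarrow> bool" where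
  "acts_by_automorphisms \<Gamma> G \<alpha> \<longleftrightarrow> \<alpha> \<in> hom \<Gamma> (AutoGroup G)"

text \<open>The pair \<open>(g, s)\<close> stands for the product \<open>g s\<close>, with \<open>s g s\<^sup>-\<^sup>1 = \<alpha> s g\<close>.\<close>

definition semidirect ::
    "('g, 'n) monoid_scheme \<Rightarrow> ('s, 'm) monoid_scheme \<Rightarrow> ('s \<Rightarrow> 'g \<Rightarrow> 'g) \<Rightarrow> ('g \<times> 's) monoid"
  where
  "semidirect G \<Gamma> \<alpha> =
     \<lparr>carrier = carrier G \<times> carrier \<Gamma>,
      mult = (\<lambda>(g, s) (h, t). (g \<otimes>\<^bsub>G\<^esub> \<alpha> s h, s \<otimes>\<^bsub>\<Gamma>\<^esub> t)),
      one = (\<one>\<^bsub>G\<^esub>, \<one>\<^bsub>\<Gamma>\<^esub>)\<rparr>"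

definition fixed_space ::
    "('g, 'n) monoid_scheme \<Rightarrow> ('s, 'm) monoid_scheme \<Rightarrow>
     ('g \<times> 's \<Rightarrow> 'h::complex_hilbert_space \<Rightarrow> 'h) \<Rightarrow> 'h set" where
  "fixed_space G \<Gamma> \<pi> = {x. \<forall>s\<in>carrier \<Gamma>. \<pi> (\<one>\<^bsub>G\<^esub>, s) x = x}"


section \<open>The Pontryagin dual and invariant measures\<close>

definition circle_group :: "complex monoid" where
  "circle_group = \<lparr>carrier = sphere 0 1, mult = (*), one = 1\<rparr>"

text \<open>Characters are normalised to be \<open>undefined\<close> outside the carrier of \<open>G\<close>. Since \<open>G\<close> is
  discrete, the compact-open topology on the dual is the topology of pointwise convergence.\<close>

definition dual :: "('g, 'n) monoid_scheme \<Rightarrow> ('g \<Rightarrow> complex) set" where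
  "dual G = hom G circle_group \<inter> extensional (carrier G)"

definition dual_topology :: "('g, 'n) monoid_scheme \<Rightarrow> ('g \<Rightarrow> complex) topology" where
  "dual_topology G = subtopology (product_topology (\<lambda>_. euclidean) (carrier G)) (dual G)"

definition borel_algebra :: "'x topology \<Rightarrow> 'x measure" where
  "borel_algebra X = sigma (topspace X) {U. openin X U}"

definition regular_borel_prob :: "'x topology \<Rightarrow> 'x measure \<Rightarrow> bool" where
  "regular_borel_prob X \<mu> \<longleftrightarrow> sets \<mu> = sets (borel_algebra X) \<and> prob_space \<mu> \<and>
     (\<forall>A\<in>sets \<mu>.
        emeasure \<mu> A = (INF U\<in>{U. openin X U \<and> A \<subseteq> U}. emeasure \<mu> U) \<and>
        emeasure \<mu> A = (SUP C\<in>{C. compactin X C \<and> C \<subseteq> A}. emeasure \<mu> C))"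

text \<open>\<open>char_comp G \<alpha> s \<psi>\<close> is the character \<open>\<psi> \<circ> s\<close>, that is \<open>g \<mapsto> \<psi> (s \<cdot> g)\<close>.\<close>

definition char_comp ::
    "('g, 'n) monoid_scheme \<Rightarrow> ('s \<Rightarrow> 'g \<Rightarrow> 'g) \<Rightarrow> 's \<Rightarrow> ('g \<Rightarrow> complex) \<Rightarrow> 'g \<Rightarrow> complex" where
  "char_comp G \<alpha> s \<psi> = (\<lambda>g\<in>carrier G. \<psi> (\<alpha> s g))"

definition invariant_measures ::
    "('g, 'n) monoid_scheme \<Rightarrow> ('s, 'm) monoid_scheme \<Rightarrow> ('s \<Rightarrow> 'g \<Rightarrow> 'g) \<Rightarrow>
     ('g \<Rightarrow> complex) measure set" where
  "invariant_measures G \<Gamma> \<alpha> = {\<mu>. regular_borel_prob (dual_topology G) \<mu> \<and>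
     (\<forall>s\<in>carrier \<Gamma>. distr \<mu> (borel_algebra (dual_topology G)) (char_comp G \<alpha> (inv\<^bsub>\<Gamma>\<^esub> s)) = \<mu>)}"

text \<open>Extreme points of the convex set of invariant measures; the type of measures is not a
  real vector space, so \<open>extreme_point_of\<close> does not apply and convex combinations are written
  out setwise.\<close>

definition ergodic_measures ::
    "('g, 'n) monoid_scheme \<Rightarrow> ('s, 'm) monoid_scheme \<Rightarrow> ('s \<Rightarrow> 'g \<Rightarrow> 'g) \<Rightarrow>
     ('g \<Rightarrow> complex) measure set" where
  "ergodic_measures G \<Gamma> \<alpha> = {\<mu> \<in> invariant_measures G \<Gamma> \<alpha>.
     \<forall>\<nu>\<^sub>1\<in>invariant_measures G \<Gamma> \<alpha>. \<forall>\<nu>\<^sub>2\<in>invariant_measures G \<Gamma> \<alpha>. \<forall>t\<in>{0<..<1::real}.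
       (\<forall>A\<in>sets \<mu>. measure \<mu> A = (1 - t) * measure \<nu>\<^sub>1 A + t * measure \<nu>\<^sub>2 A) \<longrightarrow> \<nu>\<^sub>1 = \<nu>\<^sub>2}"


section \<open>The Hilbert space of square-integrable functions\<close>

definition L2_fun :: "'x measure \<Rightarrow> ('x \<Rightarrow> complex) set" where
  "L2_fun M = {f \<in> borel_measurable M. integrable M (\<lambda>x. (cmod (f x))\<^sup>2)}"

definition L2_rel :: "'x measure \<Rightarrow> (('x \<Rightarrow> complex) \<times> ('x \<Rightarrow> complex)) set" where
  "L2_rel M = {(f, g). f \<in> L2_fun M \<and> g \<in> L2_fun M \<and> (AE x in M. f x = g x)}"

definition L2 :: "'x measure \<Rightarrow> ('x \<Rightarrow> complex) set set" where
  "L2 M = L2_fun M // L2_rel M"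

definition L2_lift ::
    "'x measure \<Rightarrow> (('x \<Rightarrow> complex) \<Rightarrow> 'x \<Rightarrow> complex) \<Rightarrow> ('x \<Rightarrow> complex) set \<Rightarrow> ('x \<Rightarrow> complex) set"
  where
  "L2_lift M T F = (\<Union>f\<in>F. L2_rel M `` {T f})"

definition L2_scale ::
    "'x measure \<Rightarrow> complex \<Rightarrow> ('x \<Rightarrow> complex) set \<Rightarrow> ('x \<Rightarrow> complex) set" where
  "L2_scale M a = L2_lift M (\<lambda>f x. a * f x)"

definition L2_add ::
    "'x measure \<Rightarrow> ('x \<Rightarrow> complex) set \<Rightarrow> ('x \<Rightarrow> complex) set \<Rightarrow> ('x \<Rightarrow> complex) set" where
  "L2_add M F K = (\<Union>f\<in>F. \<Union>k\<in>K. L2_rel M `` {\<lambda>x. f x + k x})"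

definition L2_inner ::
    "'x measure \<Rightarrow> ('x \<Rightarrow> complex) set \<Rightarrow> ('x \<Rightarrow> complex) set \<Rightarrow> complex" where
  "L2_inner M F K = the_elem (\<Union>f\<in>F. \<Union>k\<in>K. {\<integral>x. f x * cnj (k x) \<partial>M})"

definition unitary_onto_L2 ::
    "'x measure \<Rightarrow> ('h::complex_hilbert_space \<Rightarrow> ('x \<Rightarrow> complex) set) \<Rightarrow> bool" where
  "unitary_onto_L2 M U \<longleftrightarrow> bij_betw U UNIV (L2 M) \<and>
     (\<forall>v w. U (v + w) = L2_add M (U v) (U w)) \<and>
     (\<forall>a v. U (scaleC a v) = L2_scale M a (U v)) \<and>
     (\<forall>v w. L2_inner M (U v) (U w) = cinner v w)"

definition unitarily_equivalent_L2 ::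
    "('y, 'm) monoid_scheme \<Rightarrow> ('y \<Rightarrow> 'h::complex_hilbert_space \<Rightarrow> 'h) \<Rightarrow> 'x measure \<Rightarrow>
     ('y \<Rightarrow> ('x \<Rightarrow> complex) set \<Rightarrow> ('x \<Rightarrow> complex) set) \<Rightarrow> bool" where
  "unitarily_equivalent_L2 K \<pi> M \<rho> \<longleftrightarrow>
     (\<exists>U. unitary_onto_L2 M U \<and> (\<forall>k\<in>carrier K. \<forall>v. U (\<pi> k v) = \<rho> k (U v)))"

text \<open>\<open>\<rho>\<^sub>\<mu> (g, s) = \<rho>\<^sub>\<mu> g \<circ> \<rho>\<^sub>\<mu> s\<close>: first \<open>f \<mapsto> (\<psi> \<mapsto> f (\<psi> \<circ> s))\<close>, then multiplication by
  \<open>\<psi> \<mapsto> \<psi> g\<close>.\<close>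

definition rho ::
    "('g, 'n) monoid_scheme \<Rightarrow> ('s \<Rightarrow> 'g \<Rightarrow> 'g) \<Rightarrow> ('g \<Rightarrow> complex) measure \<Rightarrow> 'g \<times> 's \<Rightarrow>
     (('g \<Rightarrow> complex) \<Rightarrow> complex) set \<Rightarrow> (('g \<Rightarrow> complex) \<Rightarrow> complex) set" where
  "rho G \<alpha> \<mu> = (\<lambda>(g, s). L2_lift \<mu> (\<lambda>f \<psi>. \<psi> g * f (char_comp G \<alpha> s \<psi>)))"

end

theory Submission
  imports Defs
begin

text \<open>An invariant unit vector \<open>x\<close> defines the positive definite function
  \<open>g \<mapsto> \<langle>\<pi> g x, x\<rangle>\<close> on \<open>G\<close>, which by Bochner's theorem is the Fourier transform of a regular
  probability measure \<open>\<mu>\<close> on the dual, invariant because \<open>x\<close> is. As \<open>x\<close> is cyclic for \<open>G\<close>,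
  \<open>\<pi>\<close> is unitarily equivalent to \<open>\<rho>\<^sub>\<mu>\<close>. An invariant function that is not constant splits into two
  nonzero invariant functions with disjoint supports, whose cyclic subspaces are orthogonal; so by
  irreducibility all invariant vectors are multiples of \<open>x\<close>. Applied to Radon-Nikodym densities of
  invariant measures, the same fact gives ergodicity. A measure \<open>\<nu>\<close> with \<open>\<rho>\<^sub>\<nu>\<close> equivalent to \<open>\<pi>\<close> has
  the same Fourier coefficients as \<open>\<mu>\<close>, since the constant function \<open>1\<close> corresponds to a multiple
  of \<open>x\<close>.

  For Bochner's theorem, the extreme points of the compact set of states of \<open>G\<close> are the characters,
  so by the Krein-Milman argument a state is bounded by the supremum over the dual; it thus extends
  from trigonometric polynomials to continuous functions, and the Riesz representation theorem
  applies.\<close>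

section \<open>Extreme points of compact sets of functions\<close>

text \<open>Since \<open>G\<close> is arbitrary, its dual need not be metrizable, so regularity of a
  Borel measure there is a genuine condition. It is what makes continuous functions, and with them
  trigonometric polynomials, dense among the square-integrable ones, and what lets Fourier
  coefficients determine a measure. Irreducibility acts through two closed invariant subspaces: the
  vectors orthogonal to the \<open>G\<close>-orbit of a nonzero fixed vector, which must be zero,
  and the vectors represented by some square-integrable function, which must be everything. The
  unitary is therefore obtained from a relation \<open>corr v f\<close> that tests \<open>v\<close>
  and \<open>f\<close> against the orbit of \<open>x\<close>. For extreme states the factor |1 + l
  g|^2 / 2 expands on characters to 1 + Re (l g). The factors for l and -l average to 1, which
  exhibits a state as the midpoint of two positive functionals. In the ergodicity argument,
  densities take extended nonnegative values and need not be square-integrable, while invariant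
  functions are controlled only in L2. Truncation closes this gap.\<close>

lemma hausdorff_fun:
  fixes f g :: "'a \<Rightarrow> 'b::t2_space"
  assumes "f \<noteq> g"
  shows "\<exists>U V. open U \<and> open V \<and> f \<in> U \<and> g \<in> V \<and> U \<inter> V = {}"
proof -
  from assms obtain x where "f x \<noteq> g x" by blast
  then obtain U V where UV: "open U" "open V" "f x \<in> U" "g x \<in> V" "U \<inter> V = {}"
    using hausdorff[of "f x" "g x"] by auto
  have o: "open ((\<lambda>h. h x) -` W)" if "open W" for W :: "'b set"
    using that by (intro open_vimage continuous_on_product_coordinates) auto
  show "\<exists>U V. open U \<and> open V \<and> f \<in> U \<and> g \<in> V \<and> U \<inter> V = {}"
    using UV o[OF UV(1)] o[OF UV(2)] by blast
qed

text \<open>Functions carry the topology of pointwise convergence. The Hausdorff property makes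
  compact sets of states and characters closed, which every compactness argument below relies
  on.\<close>

instance "fun" :: (type, t2_space) t0_space
  by standard (drule hausdorff_fun, blast)

instance "fun" :: (type, t2_space) t1_space
  by standard (drule hausdorff_fun, blast)

instance "fun" :: (type, t2_space) t2_space
  by standard (rule hausdorff_fun)

text \<open>The weights add up to 1 at every argument, so two functions that share the value
  \<open>undefined\<close> off a carrier keep it when mixed: extensional functions stay
  extensional.\<close>

definition mix :: "real \<Rightarrow> ('a \<Rightarrow> complex) \<Rightarrow> ('a \<Rightarrow> complex) \<Rightarrow> 'a \<Rightarrow> complex" where
  "mix t f g = (\<lambda>a. of_real (1 - t) * f a + of_real t * g a)"

text \<open>An extreme set in the sense of Krein-Milman, with the open segments spelled out by
  \<open>mix\<close>.\<close>

definition face :: "('a \<Rightarrow> complex) set \<Rightarrow> ('a \<Rightarrow> complex) set \<Rightarrow> bool" where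
  "face Y F \<longleftrightarrow> F \<subseteq> Y \<and>
     (\<forall>f\<in>Y. \<forall>g\<in>Y. \<forall>t. 0 < t \<longrightarrow> t < 1 \<longrightarrow> mix t f g \<in> F \<longrightarrow> f \<in> F \<and> g \<in> F)"

text \<open>If a mixture attains the maximum of \<open>q\<close>, the shortfalls of its two end
  points, weighted by \<open>1 - t\<close> and \<open>t\<close>, are nonnegative and add up to 0, so
  both ends attain it. This serves for the objective itself and again to show that a minimal face is
  a point.\<close>

lemma face_argmax:
  assumes F: "face Y F" "compact F" "F \<noteq> {}"
    and q: "continuous_on F q"
    and aff: "\<And>f g t. q (mix t f g) = (1 - t) * q f + t * (q g :: real)"
  defines "M \<equiv> {f \<in> F. \<forall>g\<in>F. q g \<le> q f}"
  shows "face Y M" "compact M" "M \<noteq> {}"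
proof -
  obtain f0 where f0: "f0 \<in> F" "\<And>g. g \<in> F \<Longrightarrow> q g \<le> q f0"
    using continuous_attains_sup[OF F(2,3) q] by blast
  have M: "M = {f \<in> F. q f = q f0}"
    unfolding M_def using f0 by (auto intro: antisym)
  show "M \<noteq> {}"
    using f0 M by auto
  have "closed M"
    unfolding M using continuous_closed_preimage_constant[OF q compact_imp_closed[OF F(2)]] .
  with F(2) have "compact (F \<inter> M)" by (rule compact_Int_closed)
  moreover have "F \<inter> M = M" unfolding M by auto
  ultimately show "compact M" by simp
  show "face Y M"
    unfolding face_def
  proof (intro conjI ballI allI impI)
    show "M \<subseteq> Y" using F(1) unfolding M face_def by auto
  next
    fix f g t assume fg: "f \<in> Y" "g \<in> Y" "0 < t" "t < 1" "mix t f g \<in> M"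
    then have fgF: "f \<in> F" "g \<in> F"
      using F(1) unfolding face_def M by blast+
    have e: "(1 - t) * q f + t * q g = q f0"
      using fg(5) aff[of t f g] unfolding M by simp
    have le: "q f \<le> q f0" "q g \<le> q f0" using f0 fgF by auto
    have "(1 - t) * (q f0 - q f) + t * (q f0 - q g) = 0"
      using e by (simp add: algebra_simps)
    moreover have "(1 - t) * (q f0 - q f) \<ge> 0" "t * (q f0 - q g) \<ge> 0"
      using le fg by auto
    ultimately have "(1 - t) * (q f0 - q f) = 0" "t * (q f0 - q g) = 0" by linarith+
    then have "q f = q f0 \<and> q g = q f0" using fg by auto
    then show "f \<in> M" "g \<in> M" unfolding M using fgF by auto
  qed
qed

text \<open>Feeds the finite intersection property: finitely many members of a chain of nonempty
  compact faces meet, because their intersection is one of them.\<close>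

lemma finite_chain_Inter_mem:
  assumes "finite \<D>" "\<D> \<noteq> {}" "\<And>A B. A \<in> \<D> \<Longrightarrow> B \<in> \<D> \<Longrightarrow> A \<subseteq> B \<or> B \<subseteq> A"
  shows "\<Inter>\<D> \<in> \<D>"
  using assms
proof (induction rule: finite_ne_induct)
  case (insert A \<D>)
  then have "\<Inter>\<D> \<in> \<D>" by blast
  then have "A \<subseteq> \<Inter>\<D> \<or> \<Inter>\<D> \<subseteq> A" using insert.prems by blast
  then show ?case
    using \<open>\<Inter>\<D> \<in> \<D>\<close> by (auto simp: Int_absorb1 Int_absorb2)
qed auto

text \<open>Zorn's lemma runs inside the face of maximizers of \<open>p\<close>, so the single point
  of a minimal face is extreme and optimal at once.\<close>

theorem extreme_maximizer:
  fixes Y :: "('a \<Rightarrow> complex) set"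
  assumes Y: "compact Y" "Y \<noteq> {}"
    and p: "continuous_on Y p"
    and aff: "\<And>f g t. p (mix t f g) = (1 - t) * p f + t * (p g :: real)"
  obtains x where "x \<in> Y" "\<And>f. f \<in> Y \<Longrightarrow> p f \<le> p x"
    "\<And>f g t. f \<in> Y \<Longrightarrow> g \<in> Y \<Longrightarrow> 0 < t \<Longrightarrow> t < 1 \<Longrightarrow> mix t f g = x \<Longrightarrow> f = x"
proof -
  have fY: "face Y Y" by (auto simp: face_def)
  define F0 where "F0 = {f \<in> Y. \<forall>g\<in>Y. p g \<le> p f}"
  note F0 = face_argmax[OF fY Y p aff, folded F0_def]
  define \<F> where "\<F> = {F. compact F \<and> F \<noteq> {} \<and> F \<subseteq> F0 \<and> face Y F}"
  have F0\<F>: "F0 \<in> \<F>" using F0 by (auto simp: \<F>_def)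
  have chain: "\<Inter>\<D> \<in> \<F>"
    if D: "\<D> \<noteq> {}" "\<D> \<subseteq> \<F>" "\<And>A B. A \<in> \<D> \<Longrightarrow> B \<in> \<D> \<Longrightarrow> A \<subseteq> B \<or> B \<subseteq> A" for \<D>
  proof -
    obtain D0 where D0: "D0 \<in> \<D>" using D by blast
    have cl: "\<And>A. A \<in> \<D> \<Longrightarrow> closed A"
      using D(2) by (auto simp: \<F>_def intro: compact_imp_closed)
    have cD0: "compact D0" using D0 D by (auto simp: \<F>_def)
    have "compact (D0 \<inter> \<Inter>\<D>)"
      using cD0 cl by (intro compact_Int_closed closed_Inter) auto
    moreover have "D0 \<inter> \<Inter>\<D> = \<Inter>\<D>" using D0 by auto
    ultimately have c: "compact (\<Inter>\<D>)" by simp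
    have "D0 \<inter> \<Inter>\<D> \<noteq> {}"
    proof (rule compact_imp_fip[OF cD0 cl])
      fix F' assume F': "finite F'" "F' \<subseteq> \<D>"
      have "\<Inter>(insert D0 F') \<in> insert D0 F'"
        by (rule finite_chain_Inter_mem) (use F' D0 D(3) in \<open>auto 4 3\<close>)
      then have "\<Inter>(insert D0 F') \<in> \<F>" using F' D0 D by auto
      then show "D0 \<inter> \<Inter>F' \<noteq> {}" by (auto simp: \<F>_def)
    qed
    then have ne: "\<Inter>\<D> \<noteq> {}" by auto
    have "D0 \<subseteq> F0" using D0 D(2) by (auto simp: \<F>_def)
    then have "\<Inter>\<D> \<subseteq> F0" using D0 by blast
    moreover have "face Y (\<Inter>\<D>)"
      unfolding face_def
    proof (intro conjI ballI allI impI)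
      have "D0 \<subseteq> Y" using D0 D(2) by (auto simp: \<F>_def face_def)
      then show "\<Inter>\<D> \<subseteq> Y" using D0 by blast
      fix f g t assume fg: "f \<in> Y" "g \<in> Y" "0 < t" "t < 1" "mix t f g \<in> \<Inter>\<D>"
      have "f \<in> A \<and> g \<in> A" if "A \<in> \<D>" for A
      proof -
        have "face Y A" "mix t f g \<in> A" using D that fg by (auto simp: \<F>_def)
        then show ?thesis using fg unfolding face_def by blast
      qed
      then show "f \<in> \<Inter>\<D>" "g \<in> \<Inter>\<D>" by auto
    qed
    ultimately show ?thesis using c ne by (auto simp: \<F>_def)
  qed
  \<comment> \<open>Complements turn the search for a minimal face into the upward form of Zorn's
    lemma: a union of complements is the complement of an intersection.\<close>
  have "\<exists>M\<in>uminus ` \<F>. \<forall>X\<in>uminus ` \<F>. M \<subseteq> X \<longrightarrow> X = M"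
  proof (rule subset_Zorn_nonempty)
    show "uminus ` \<F> \<noteq> {}" using F0\<F> by auto
    fix \<C> :: "('a \<Rightarrow> complex) set set" assume C: "\<C> \<noteq> {}" "subset.chain (uminus ` \<F>) \<C>"
    have sub: "\<C> \<subseteq> uminus ` \<F>" and tot: "\<And>A B. A \<in> \<C> \<Longrightarrow> B \<in> \<C> \<Longrightarrow> A \<subseteq> B \<or> B \<subseteq> A"
      using C(2) by (auto simp: subset_chain_def)
    have "\<Inter>(uminus ` \<C>) \<in> \<F>"
    proof (rule chain)
      show "uminus ` \<C> \<noteq> {}" using C by auto
      show "uminus ` \<C> \<subseteq> \<F>" using sub by auto
      fix A B assume "A \<in> uminus ` \<C>" "B \<in> uminus ` \<C>"
      then show "A \<subseteq> B \<or> B \<subseteq> A" using tot by auto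
    qed
    moreover have "\<Union>\<C> = - (\<Inter>(uminus ` \<C>))" by auto
    ultimately show "\<Union>\<C> \<in> uminus ` \<F>" by (metis imageI)
  qed
  then obtain M where M: "M \<in> \<F>" and min: "\<And>F. F \<in> \<F> \<Longrightarrow> F \<subseteq> M \<Longrightarrow> F = M"
    by (auto) 
  \<comment> \<open>The maximizers of an affine continuous \<open>q\<close> on \<open>M\<close> are
    again a face, hence all of \<open>M\<close>. Applied below to the real and imaginary part of
    every coordinate, this leaves one point.\<close>
  have const: "q f = q g"
    if q: "continuous_on M q" "\<And>f g t. q (mix t f g) = (1 - t) * q f + t * (q g :: real)"
      and fg: "f \<in> M" "g \<in> M" for q f g
  proof -
    have MM: "face Y M" "compact M" "M \<noteq> {}" "M \<subseteq> F0" using M by (auto simp: \<F>_def)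
    note am = face_argmax[OF MM(1-3) q]
    have "{f \<in> M. \<forall>g\<in>M. q g \<le> q f} \<in> \<F>"
      using am MM(4) by (auto simp: \<F>_def)
    then have "{f \<in> M. \<forall>g\<in>M. q g \<le> q f} = M" by (rule min) auto
    with fg show ?thesis by (metis (mono_tags, lifting) mem_Collect_eq antisym)
  qed
  obtain x where x: "x \<in> M" using M by (auto simp: \<F>_def)
  have sing: "f = x" if "f \<in> M" for f
  proof
    fix a
    have co: "continuous_on M (\<lambda>f::'a\<Rightarrow>complex. f a)"
      by (rule continuous_on_subset[OF continuous_on_product_coordinates]) simp
    have "Re (f a) = Re (x a)"
      by (rule const[of "\<lambda>f. Re (f a)", OF _ _ that x])
        (auto intro!: continuous_intros co simp: mix_def)
    moreover have "Im (f a) = Im (x a)"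
      by (rule const[of "\<lambda>f. Im (f a)", OF _ _ that x])
        (auto intro!: continuous_intros co simp: mix_def)
    ultimately show "f a = x a" by (simp add: complex_eq_iff)
  qed
  show thesis
  proof
    have MF: "M \<subseteq> F0" "face Y M" using M by (auto simp: \<F>_def)
    show "x \<in> Y" using x MF by (auto simp: F0_def)
    show "p f \<le> p x" if "f \<in> Y" for f using x MF that by (auto simp: F0_def)
    show "f = x" if "f \<in> Y" "g \<in> Y" "0 < t" "t < 1" "mix t f g = x" for f g t
      using that MF(2) x sing unfolding face_def by blast
  qed
qed

section \<open>Positive functionals and trigonometric polynomials\<close>

definition twist :: "('g, 'n) monoid_scheme \<Rightarrow> complex \<times> 'g \<Rightarrow> ('g \<Rightarrow> complex) \<Rightarrow> 'g \<Rightarrow> complex" where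
  "twist G = (\<lambda>(l, g) \<phi>. \<lambda>h\<in>carrier G.
     \<phi> h + (l * \<phi> (g \<otimes>\<^bsub>G\<^esub> h) + cnj l * \<phi> (inv\<^bsub>G\<^esub> g \<otimes>\<^bsub>G\<^esub> h)) / 2)"

text \<open>The twist by \<open>(l, g)\<close> multiplies a functional by \<open>\<bar>1 + l g\<bar>\<^sup>2 / 2\<close>. Positivity on all products
  of such factors replaces positive definiteness: it is visibly stable under twists.\<close>

definition pos_functional :: "('g, 'n) monoid_scheme \<Rightarrow> ('g \<Rightarrow> complex) \<Rightarrow> bool" where
  "pos_functional G \<phi> \<longleftrightarrow>
     (\<forall>qs. set qs \<subseteq> sphere 0 1 \<times> carrier G \<longrightarrow> fold (twist G) qs \<phi> \<one>\<^bsub>G\<^esub> \<in> \<real>\<^sub>\<ge>\<^sub>0)"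

definition states :: "('g, 'n) monoid_scheme \<Rightarrow> ('g \<Rightarrow> complex) set" where
  "states G = {\<phi> \<in> extensional (carrier G). \<phi> \<one>\<^bsub>G\<^esub> = 1 \<and> pos_functional G \<phi>}"

text \<open>The argument ranges over all functions on the group, so one object is both a
  trigonometric polynomial (at characters) and the value of a linear functional (at states).
  Identities that use multiplicativity hold only at characters.\<close>

inductive_set trig_polys :: "('g, 'n) monoid_scheme \<Rightarrow> (('g \<Rightarrow> complex) \<Rightarrow> real) set"
  for G where
  monomial: "g \<in> carrier G \<Longrightarrow> (\<lambda>\<phi>. Re (c * \<phi> g)) \<in> trig_polys G"
| add: "p \<in> trig_polys G \<Longrightarrow> q \<in> trig_polys G \<Longrightarrow> (\<lambda>\<phi>. p \<phi> + q \<phi>) \<in> trig_polys G"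

lemma continuous_trig_poly: "p \<in> trig_polys G \<Longrightarrow> continuous_on S p"
proof (induction rule: trig_polys.induct)
  case (monomial g c)
  have "continuous_on S (\<lambda>\<phi>::'a\<Rightarrow>complex. \<phi> g)"
    by (rule continuous_on_subset[OF continuous_on_product_coordinates]) simp
  then show ?case by (intro continuous_intros)
qed (intro continuous_intros)

lemma trig_poly_mix:
  "p \<in> trig_polys G \<Longrightarrow> p (mix t f g) = (1 - t) * p f + t * p g"
  by (induction rule: trig_polys.induct) (simp_all add: mix_def algebra_simps)

lemma trig_poly_scale:
  "p \<in> trig_polys G \<Longrightarrow> (\<lambda>\<phi>. r * p \<phi>) \<in> trig_polys G"
proof (induction rule: trig_polys.induct)
  case (monomial g c)
  have "(\<lambda>\<phi>. r * Re (c * \<phi> g)) = (\<lambda>\<phi>. Re ((of_real r * c) * \<phi> g))"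
    by (simp add: algebra_simps)
  then show ?case using trig_polys.monomial[OF monomial] by metis
next
  case (add p q)
  then show ?case by (simp add: distrib_left trig_polys.add)
qed

text \<open>Tychonoff. The one-point factors off \<open>A\<close> pin the default value, so that
  sets of extensional functions can be compact in the product over the whole type.\<close>

lemma compact_prod_cball: "compact (PiE UNIV (\<lambda>g. if g \<in> A then cball 0 1 else {undefined}) :: ('g \<Rightarrow> complex) set)"
proof -
  have "compactin (product_topology (\<lambda>_. euclidean) UNIV)
      (PiE UNIV (\<lambda>g. if g \<in> A then cball 0 1 else {undefined}) :: ('g \<Rightarrow> complex) set)"
    unfolding compactin_PiE by auto
  then show ?thesis unfolding euclidean_product_topology by simp
qed

section \<open>Characters: the compact dual and its trigonometric polynomials\<close>

context comm_group
begin

lemma dual_in_sphere: "\<psi> \<in> dual G \<Longrightarrow> g \<in> carrier G \<Longrightarrow> cmod (\<psi> g) = 1"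
  by (auto simp: dual_def hom_def circle_group_def)

lemma dual_mult: "\<psi> \<in> dual G \<Longrightarrow> g \<in> carrier G \<Longrightarrow> h \<in> carrier G \<Longrightarrow> \<psi> (g \<otimes> h) = \<psi> g * \<psi> h"
  by (auto simp: dual_def hom_def circle_group_def)

lemma dual_extensional: "\<psi> \<in> dual G \<Longrightarrow> \<psi> \<in> extensional (carrier G)"
  by (simp add: dual_def)

lemma dualI:
  assumes "\<psi> \<in> extensional (carrier G)" "\<And>g. g \<in> carrier G \<Longrightarrow> cmod (\<psi> g) = 1"
    "\<And>g h. g \<in> carrier G \<Longrightarrow> h \<in> carrier G \<Longrightarrow> \<psi> (g \<otimes> h) = \<psi> g * \<psi> h"
  shows "\<psi> \<in> dual G"
  using assms by (auto simp: dual_def hom_def circle_group_def)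

lemma dual_one: assumes "\<psi> \<in> dual G" shows "\<psi> \<one> = 1"
proof -
  have "\<psi> \<one> = \<psi> \<one> * \<psi> \<one>" using dual_mult[OF assms one_closed one_closed] by simp
  moreover have "\<psi> \<one> \<noteq> 0" using dual_in_sphere[OF assms one_closed] by auto
  ultimately show ?thesis by simp
qed

lemma dual_inv: assumes "\<psi> \<in> dual G" "g \<in> carrier G" shows "\<psi> (inv g) = cnj (\<psi> g)"
proof -
  have "\<psi> g * \<psi> (inv g) = 1"
    using dual_mult[OF assms(1,2) inv_closed[OF assms(2)]] dual_one[OF assms(1)] assms by simp
  moreover have "\<psi> g * cnj (\<psi> g) = 1"
    using dual_in_sphere[OF assms] by (simp add: complex_norm_square[symmetric])
  ultimately have "\<psi> g * \<psi> (inv g) = \<psi> g * cnj (\<psi> g)" by simp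
  moreover have "\<psi> g \<noteq> 0" using dual_in_sphere[OF assms] by auto
  ultimately show ?thesis by simp
qed

lemma dual_subset_prod: "dual G \<subseteq> PiE UNIV (\<lambda>g. if g \<in> carrier G then cball 0 1 else {undefined})"
proof
  fix \<psi> assume p: "\<psi> \<in> dual G"
  then have "cmod (\<psi> g) \<le> 1" if "g \<in> carrier G" for g using dual_in_sphere[OF p that] by simp
  then show "\<psi> \<in> PiE UNIV (\<lambda>g. if g \<in> carrier G then cball 0 1 else {undefined})"
    using dual_extensional[OF p] by (auto simp: extensional_def)
qed

lemma compact_dual: "compact (dual G)"
proof -
  let ?P = "PiE UNIV (\<lambda>g. if g \<in> carrier G then cball 0 1 else {undefined}) :: ('a \<Rightarrow> complex) set"
  let ?N = "\<lambda>g. {\<psi> :: 'a \<Rightarrow> complex. cmod (\<psi> g) = 1}"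
  let ?M = "\<lambda>g h. {\<psi> :: 'a \<Rightarrow> complex. \<psi> (g \<otimes> h) = \<psi> g * \<psi> h}"
  have co: "continuous_on UNIV (\<lambda>\<psi>::'a\<Rightarrow>complex. \<psi> g)" for g
    by (rule continuous_on_product_coordinates)
  have "dual G = ?P \<inter> ((\<Inter>g\<in>carrier G. ?N g) \<inter> (\<Inter>g\<in>carrier G. \<Inter>h\<in>carrier G. ?M g h))"
    (is "_ = ?P \<inter> ?C")
  proof (intro equalityI subsetI)
    fix \<psi> assume p: "\<psi> \<in> dual G"
    have "\<psi> \<in> ?P" using dual_subset_prod p by blast
    moreover have "\<psi> \<in> ?C" using p by (simp add: dual_in_sphere dual_mult)
    ultimately show "\<psi> \<in> ?P \<inter> ?C" by (rule IntI)
  next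
    fix \<psi> assume p: "\<psi> \<in> ?P \<inter> ?C"
    show "\<psi> \<in> dual G"
    proof (rule dualI)
      show "\<psi> \<in> extensional (carrier G)"
        unfolding extensional_def
      proof (intro CollectI allI impI)
        fix g assume "g \<notin> carrier G"
        have "\<psi> g \<in> (if g \<in> carrier G then cball 0 1 else {undefined})"
          using p by (auto simp: PiE_def Pi_def)
        with \<open>g \<notin> carrier G\<close> show "\<psi> g = undefined" by simp
      qed
    qed (use p in auto)
  qed
  moreover have "closed ?C"
    by (intro closed_Int closed_INT ballI closed_Collect_eq continuous_on_mult
        continuous_on_norm continuous_on_const co)
  ultimately show ?thesis using compact_Int_closed[OF compact_prod_cball] by simp
qed

text \<open>The coordinates off the carrier are constant on characters, so the product over the
  carrier and the product over the whole type induce the same topology. This gives access to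
  \<open>continuous_on\<close>, \<open>compact\<close> and \<open>closed\<close> for the
  dual.\<close>

lemma dual_topology_eq: "dual_topology G = top_of_set (dual G)"
proof -
  let ?A = "dual_topology G" and ?B = "top_of_set (dual G)"
  have tA: "topspace ?A = dual G"
    using dual_extensional by (auto simp: dual_topology_def PiE_def)
  have "continuous_map ?A ?B id"
    unfolding continuous_map_in_subtopology
  proof (intro conjI)
    show "continuous_map ?A euclidean id"
      unfolding euclidean_product_topology[symmetric] continuous_map_componentwise_UNIV
    proof
      fix k
      show "continuous_map ?A euclidean (\<lambda>x. id x k)"
      proof (cases "k \<in> carrier G")
        case True
        then show ?thesis unfolding dual_topology_def
          by (auto intro!: continuous_map_from_subtopology continuous_map_product_projection)
      next
        case False
        have "continuous_map ?A euclidean (\<lambda>x. undefined :: complex)" by simp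
        then show ?thesis
        proof (rule continuous_map_eq)
          fix x assume "x \<in> topspace ?A"
          then show "undefined = id x k"
            using tA extensional_arb[OF dual_extensional False, of x] by simp
        qed
      qed
    qed
  qed (use tA in auto)
  moreover have "continuous_map ?B ?A id"
    unfolding dual_topology_def continuous_map_in_subtopology continuous_map_componentwise
    using dual_extensional by (auto intro!: continuous_on_subset[OF continuous_on_product_coordinates])
  ultimately show ?thesis
    using topology_finer_continuous_id[of ?A ?B] topology_finer_continuous_id[of ?B ?A] tA
    by (auto simp: topology_eq)
qed

text \<open>Constants are represented by multiples of evaluation at the identity, hence only at
  functionals normalised there; characters and states both are.\<close>

lemma trig_poly_const: "\<exists>p\<in>trig_polys G. \<forall>\<phi>. \<phi> \<one> = 1 \<longrightarrow> p \<phi> = r"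
  using trig_polys.monomial[OF one_closed, of "of_real r"] by (intro bexI) auto

text \<open>Re a Re b = (Re (a b) + Re (a cnj b)) / 2, and at a character the products of values are
  values at products, with conjugation becoming inversion.\<close>

lemma trig_poly_mult:
  assumes "p \<in> trig_polys G" "q \<in> trig_polys G"
  shows "\<exists>r\<in>trig_polys G. \<forall>\<psi>\<in>dual G. r \<psi> = p \<psi> * q \<psi>"
  using assms
proof (induction arbitrary: q rule: trig_polys.induct)
  case (monomial g c)
  show ?case using monomial.prems
  proof (induction rule: trig_polys.induct)
    case (monomial h d)
    let ?r = "\<lambda>\<phi>. Re ((c * d / 2) * \<phi> (g \<otimes> h)) + Re ((c * cnj d / 2) * \<phi> (g \<otimes> inv h))"
    have "?r \<in> trig_polys G"
      using \<open>g \<in> carrier G\<close> \<open>h \<in> carrier G\<close> by (intro trig_polys.intros) auto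
    moreover have "?r \<psi> = Re (c * \<psi> g) * Re (d * \<psi> h)" if "\<psi> \<in> dual G" for \<psi>
      using that \<open>g \<in> carrier G\<close> \<open>h \<in> carrier G\<close>
      by (simp add: dual_mult dual_inv) (simp add: field_simps)
    ultimately show ?case by (intro bexI[of _ ?r]) auto
  next
    case (add q1 q2)
    then obtain r1 r2 where r: "r1 \<in> trig_polys G" "r2 \<in> trig_polys G"
      "\<forall>\<psi>\<in>dual G. r1 \<psi> = Re (c * \<psi> g) * q1 \<psi>" "\<forall>\<psi>\<in>dual G. r2 \<psi> = Re (c * \<psi> g) * q2 \<psi>"
      by blast
    then show ?case
      by (intro bexI[of _ "\<lambda>\<phi>. r1 \<phi> + r2 \<phi>"]) (auto intro: trig_polys.add simp: distrib_left)
  qed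
next
  case (add p1 p2)
  then obtain r1 r2 where r: "r1 \<in> trig_polys G" "r2 \<in> trig_polys G"
    "\<forall>\<psi>\<in>dual G. r1 \<psi> = p1 \<psi> * q \<psi>" "\<forall>\<psi>\<in>dual G. r2 \<psi> = p2 \<psi> * q \<psi>"
    by blast
  then show ?case
    by (intro bexI[of _ "\<lambda>\<phi>. r1 \<phi> + r2 \<phi>"]) (auto intro: trig_polys.add simp: distrib_right)
qed

text \<open>Stone-Weierstrass, applied to the functions that agree on the dual with some polynomial;
  agreement there is exactly what makes this set a ring containing the constants.\<close>

lemma trig_polys_dense:
  assumes f: "continuous_on (dual G) f" and "0 < e"
  obtains p where "p \<in> trig_polys G" "\<And>\<psi>. \<psi> \<in> dual G \<Longrightarrow> \<bar>f \<psi> - p \<psi>\<bar> < e"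
proof -
  define R where "R = {f. \<exists>p\<in>trig_polys G. \<forall>\<psi>\<in>dual G. f \<psi> = p \<psi>}"
  interpret function_ring_on R "dual G"
  proof
    show "compact (dual G)" by (rule compact_dual)
    show "continuous_on (dual G) f" if inR: "f \<in> R" for f
    proof -
      obtain p where p: "p \<in> trig_polys G" "\<forall>\<psi>\<in>dual G. f \<psi> = p \<psi>"
        using inR unfolding R_def by blast
      then show ?thesis
        using continuous_on_cong[of "dual G" "dual G" f p] continuous_trig_poly[OF p(1)] by simp
    qed
    show "(\<lambda>x. f x + g x) \<in> R" if "f \<in> R" "g \<in> R" for f g
    proof -
      obtain p q where "p \<in> trig_polys G" "\<forall>\<psi>\<in>dual G. f \<psi> = p \<psi>"
         "q \<in> trig_polys G" "\<forall>\<psi>\<in>dual G. g \<psi> = q \<psi>"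
        using \<open>f \<in> R\<close> \<open>g \<in> R\<close> unfolding R_def by blast
      then show ?thesis unfolding R_def
        by (auto intro!: bexI[of _ "\<lambda>\<phi>. p \<phi> + q \<phi>"] trig_polys.add)
    qed
    show "(\<lambda>x. f x * g x) \<in> R" if "f \<in> R" "g \<in> R" for f g
    proof -
      obtain p q where pq: "p \<in> trig_polys G" "\<forall>\<psi>\<in>dual G. f \<psi> = p \<psi>"
         "q \<in> trig_polys G" "\<forall>\<psi>\<in>dual G. g \<psi> = q \<psi>"
        using \<open>f \<in> R\<close> \<open>g \<in> R\<close> unfolding R_def by blast
      then have "\<exists>r\<in>trig_polys G. \<forall>\<psi>\<in>dual G. r \<psi> = f \<psi> * g \<psi>"
        using trig_poly_mult[OF pq(1,3)] by simp
      then obtain r where "r \<in> trig_polys G" "\<forall>\<psi>\<in>dual G. r \<psi> = f \<psi> * g \<psi>" by blast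
      then show ?thesis unfolding R_def by (intro CollectI bexI[of _ r]) auto
    qed
    show "(\<lambda>_. c) \<in> R" for c
    proof -
      obtain p where "p \<in> trig_polys G" "\<forall>\<phi>. \<phi> \<one> = 1 \<longrightarrow> p \<phi> = c"
        using trig_poly_const[of c] by blast
      then show ?thesis unfolding R_def
        by (intro CollectI bexI[of _ p]) (auto simp: dual_one)
    qed
    fix \<psi> \<psi>' assume p: "\<psi> \<in> dual G" "\<psi>' \<in> dual G" "\<psi> \<noteq> \<psi>'"
    then obtain g where g: "g \<in> carrier G" "\<psi> g \<noteq> \<psi>' g"
      using extensionalityI[OF dual_extensional[OF p(1)] dual_extensional[OF p(2)]] by blast
    have "Re (\<psi> g) \<noteq> Re (\<psi>' g) \<or> Im (\<psi> g) \<noteq> Im (\<psi>' g)"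
      using g(2) by (simp add: complex_eq_iff)
    moreover have "(\<lambda>\<phi>. Re (c * \<phi> g)) \<in> R" for c
      unfolding R_def using trig_polys.monomial[OF g(1), of c] by auto
    \<comment> \<open>The coefficient \<open>-\<i>\<close> extracts the imaginary part, since Re
      (-\<i> z) = Im z.\<close>
    from this[of 1] this[of "-\<i>"] have "(\<lambda>\<phi>. Re (\<phi> g)) \<in> R" "(\<lambda>\<phi>. Im (\<phi> g)) \<in> R" by simp_all
    ultimately show "\<exists>f\<in>R. f \<psi> \<noteq> f \<psi>'"
      by (elim disjE) (erule bexI[rotated], assumption)+
  qed
  obtain h where "h \<in> R" "\<forall>\<psi>\<in>dual G. \<bar>f \<psi> - h \<psi>\<bar> < e"
    using Stone_Weierstrass_basic[OF f \<open>0 < e\<close>] by blast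
  then show thesis using that unfolding R_def by auto
qed

section \<open>States of the group, and why the extreme ones are characters\<close>

lemma pos_functional_one: "pos_functional G \<phi> \<Longrightarrow> \<phi> \<one> \<in> \<real>\<^sub>\<ge>\<^sub>0"
  unfolding pos_functional_def by (drule spec[of _ "[]"]) simp

lemma pos_functional_twist:
  assumes "pos_functional G \<phi>" "cmod l = 1" "g \<in> carrier G"
  shows "pos_functional G (twist G (l, g) \<phi>)"
  unfolding pos_functional_def
proof (intro allI impI)
  fix qs :: "(complex \<times> 'a) list" assume "set qs \<subseteq> sphere 0 1 \<times> carrier G"
  then have "set ((l, g) # qs) \<subseteq> sphere 0 1 \<times> carrier G" using assms by simp
  then have "fold (twist G) ((l, g) # qs) \<phi> \<one> \<in> \<real>\<^sub>\<ge>\<^sub>0"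
    using assms(1) unfolding pos_functional_def by blast
  then show "fold (twist G) qs (twist G (l, g) \<phi>) \<one> \<in> \<real>\<^sub>\<ge>\<^sub>0" by simp
qed

lemma twist_one:
  "g \<in> carrier G \<Longrightarrow> twist G (l, g) \<phi> \<one> = \<phi> \<one> + (l * \<phi> g + cnj l * \<phi> (inv g)) / 2"
  by (simp add: twist_def)

text \<open>Every twist has a real value at the identity. The multiplier 1 compares the imaginary
  parts at \<open>g\<close> and its inverse, the multiplier \<open>\<i>\<close> the real
  parts.\<close>

lemma pos_functional_inv:
  assumes p: "pos_functional G \<phi>" and g: "g \<in> carrier G"
  shows "\<phi> (inv g) = cnj (\<phi> g)"
proof -
  have "Im (\<phi> \<one> + (l * \<phi> g + cnj l * \<phi> (inv g)) / 2) = 0" if "cmod l = 1" for l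
    using pos_functional_one[OF pos_functional_twist[OF p that g]]
    by (simp only: twist_one[OF g] complex_nonneg_Reals_iff)
  from this[of 1] this[of \<i>] pos_functional_one[OF p] show ?thesis
    by (simp add: complex_nonneg_Reals_iff complex_eq_iff)
qed

lemma twist_one_Re:
  assumes p: "pos_functional G \<phi>" and g: "g \<in> carrier G"
  shows "twist G (l, g) \<phi> \<one> = of_real (Re (\<phi> \<one>) + Re (l * \<phi> g))"
  using pos_functional_inv[OF assms] pos_functional_one[OF p]
  by (simp add: twist_one[OF g] complex_nonneg_Reals_iff complex_eq_iff)

text \<open>Rotating by the \<open>l\<close> that sends \<open>\<phi> g\<close> to the negative real
  axis makes the nonnegative value of the twist at the identity equal to the difference of the two
  sides. The bound confines states to a product of discs, and shows that a positive functional of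
  mass 0 vanishes on the carrier.\<close>

lemma pos_functional_bound:
  assumes p: "pos_functional G \<phi>" and g: "g \<in> carrier G"
  shows "cmod (\<phi> g) \<le> Re (\<phi> \<one>)"
proof (cases "\<phi> g = 0")
  case True
  then show ?thesis using pos_functional_one[OF p] by (simp add: complex_nonneg_Reals_iff)
next
  case False
  define l where "l = - cnj (\<phi> g) / cmod (\<phi> g)"
  have l: "cmod l = 1" using False by (simp add: l_def norm_divide)
  have "l * \<phi> g = - (of_real (cmod (\<phi> g)))"
    using False by (simp add: l_def complex_norm_square[symmetric] power2_eq_square field_simps)
  moreover have "Re (\<phi> \<one>) + Re (l * \<phi> g) \<ge> 0"
    using pos_functional_one[OF pos_functional_twist[OF p l g]] twist_one_Re[OF p g, of l]
    by (simp add: complex_nonneg_Reals_iff)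
  ultimately show ?thesis by simp
qed

lemma fold_twist_scale:
  assumes "set qs \<subseteq> UNIV \<times> carrier G"
  shows "fold (twist G) qs (\<lambda>h\<in>carrier G. c * \<phi> h) \<one> = c * fold (twist G) qs \<phi> \<one>"
  using assms
proof (induction qs arbitrary: \<phi>)
  case (Cons q qs)
  obtain l g where q: "q = (l, g)" "g \<in> carrier G" using Cons.prems by auto
  have "twist G q (\<lambda>h\<in>carrier G. c * \<phi> h) = (\<lambda>h\<in>carrier G. c * twist G q \<phi> h)"
    unfolding twist_def q prod.case by (intro restrict_ext) (simp add: q field_simps)
  then show ?case using Cons by (simp del: restrict_apply)
qed simp

lemma pos_functional_scale:
  assumes p: "pos_functional G \<phi>" and "0 \<le> r"
  shows "pos_functional G (\<lambda>h\<in>carrier G. of_real r * \<phi> h)"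
  unfolding pos_functional_def
proof (intro allI impI)
  fix qs :: "(complex \<times> 'a) list" assume qs: "set qs \<subseteq> sphere 0 1 \<times> carrier G"
  then have "set qs \<subseteq> UNIV \<times> carrier G" by auto
  moreover have "fold (twist G) qs \<phi> \<one> \<in> \<real>\<^sub>\<ge>\<^sub>0" using p qs by (simp add: pos_functional_def)
  ultimately show "fold (twist G) qs (\<lambda>h\<in>carrier G. of_real r * \<phi> h) \<one> \<in> \<real>\<^sub>\<ge>\<^sub>0"
    using \<open>0 \<le> r\<close> by (simp only: fold_twist_scale) simp
qed

lemma continuous_fold_twist: "continuous_on UNIV (fold (twist G) qs)"
proof (induction qs)
  case Nil
  then show ?case by (simp add: fold_Nil[abs_def] id_def)
next
  case (Cons q qs)
  obtain l g where q: "q = (l, g)" by (cases q)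
  have "continuous_on UNIV (twist G q)"
  proof (rule continuous_on_coordinatewise_then_product)
    fix h
    show "continuous_on UNIV (\<lambda>\<phi>. twist G q \<phi> h)"
      unfolding q twist_def
      by (cases "h \<in> carrier G") (auto intro!: continuous_intros continuous_on_product_coordinates)
  qed
  then have "continuous_on UNIV (fold (twist G) qs \<circ> twist G q)"
    by (rule continuous_on_compose) (rule continuous_on_subset[OF Cons.IH subset_UNIV])
  then show ?case by (simp add: comp_def)
qed

text \<open>Iterated twists depend continuously on the functional, so each positivity condition cuts
  out a closed subset of the compact product of discs.\<close>

lemma compact_states: "compact (states G)"
proof -
  let ?P = "PiE UNIV (\<lambda>g. if g \<in> carrier G then cball 0 1 else {undefined}) :: ('a \<Rightarrow> complex) set"
  let ?C = "{\<phi> :: 'a \<Rightarrow> complex. \<phi> \<one> = 1} \<inter>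
    (\<Inter>qs\<in>{qs. set qs \<subseteq> sphere 0 1 \<times> carrier G}. {\<phi>. fold (twist G) qs \<phi> \<one> \<in> \<real>\<^sub>\<ge>\<^sub>0})"
  have co: "continuous_on UNIV (\<lambda>\<phi>::'a\<Rightarrow>complex. \<phi> g)" for g
    by (rule continuous_on_product_coordinates)
  have "states G = ?P \<inter> ?C"
  proof (intro equalityI subsetI)
    fix \<phi> assume p: "\<phi> \<in> states G"
    then have "\<phi> g \<in> cball 0 1" if "g \<in> carrier G" for g
      using pos_functional_bound[OF _ that] by (fastforce simp: states_def)
    then have "\<phi> \<in> ?P" using p by (auto simp: states_def extensional_def)
    moreover have "\<phi> \<in> ?C" using p by (auto simp: states_def pos_functional_def)
    ultimately show "\<phi> \<in> ?P \<inter> ?C" by (rule IntI)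
  next
    fix \<phi> assume p: "\<phi> \<in> ?P \<inter> ?C"
    have "\<phi> \<in> extensional (carrier G)"
      unfolding extensional_def
    proof (intro CollectI allI impI)
      fix g assume "g \<notin> carrier G"
      have "\<phi> g \<in> (if g \<in> carrier G then cball 0 1 else {undefined})"
        using p by (auto simp: PiE_def Pi_def)
      with \<open>g \<notin> carrier G\<close> show "\<phi> g = undefined" by simp
    qed
    then show "\<phi> \<in> states G" using p by (auto simp: states_def pos_functional_def)
  qed
  moreover have "closed {\<phi>. fold (twist G) qs \<phi> \<one> \<in> \<real>\<^sub>\<ge>\<^sub>0}" for qs
  proof -
    have "continuous_on UNIV (\<lambda>\<phi>. fold (twist G) qs \<phi> \<one>)"
      using continuous_on_product_then_coordinatewise[OF continuous_fold_twist] .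
    then have "closed ((\<lambda>\<phi>. fold (twist G) qs \<phi> \<one>) -` \<real>\<^sub>\<ge>\<^sub>0)"
      by (intro closed_vimage closed_nonneg_Reals_complex)
    then show ?thesis by (simp add: vimage_def)
  qed
  then have "closed ?C"
    by (intro closed_Int closed_INT ballI closed_Collect_eq continuous_on_const co)
  ultimately show ?thesis using compact_Int_closed[OF compact_prod_cball] by simp
qed

text \<open>An extreme state \<open>x\<close> is the average of its twists by \<open>l\<close> and \<open>-l\<close>, hence proportional to
  each of them; comparing \<open>l = 1\<close> with \<open>l = \<i>\<close> shows that \<open>x\<close> is multiplicative.\<close>

lemma extreme_state_in_dual:
  assumes x: "x \<in> states G"
    and ext: "\<And>f g t. f \<in> states G \<Longrightarrow> g \<in> states G \<Longrightarrow> 0 < t \<Longrightarrow> t < 1 \<Longrightarrow> mix t f g = x \<Longrightarrow> f = x"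
  shows "x \<in> dual G"
proof -
  have p: "pos_functional G x" and x1: "x \<one> = 1" and xe: "x \<in> extensional (carrier G)"
    using x by (auto simp: states_def)
  have key: "twist G (l, g) x h = (1 + Re (l * x g)) * x h"
    if l: "cmod l = 1" and g: "g \<in> carrier G" and h: "h \<in> carrier G" for l g h
  proof -
    define A where "A = twist G (l, g) x"
    define B where "B = twist G (- l, g) x"
    define a where "a = 1 + Re (l * x g)"
    define b where "b = 1 - Re (l * x g)"
    have pA: "pos_functional G A" and pB: "pos_functional G B"
      unfolding A_def B_def using l g by (intro pos_functional_twist[OF p]; simp)+
    have A1: "A \<one> = of_real a" and B1: "B \<one> = of_real b"
      unfolding A_def B_def a_def b_def using twist_one_Re[OF p g] x1 by simp_all
    have "a + b = 2" by (simp add: a_def b_def)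
    moreover have "a \<ge> 0" "b \<ge> 0"
      using pos_functional_one[OF pA] pos_functional_one[OF pB] unfolding A1 B1 by simp_all
    ultimately have ab: "a \<ge> 0" "b \<ge> 0" "a + b = 2" by simp_all
    have sum: "A k + B k = 2 * x k" if "k \<in> carrier G" for k
      using that by (simp add: A_def B_def twist_def field_simps)
    \<comment> \<open>Both twists can be normalised to states unless one has mass 0. In that case it
      vanishes by \<open>pos_functional_bound\<close>; if it is \<open>B\<close>, then
      \<open>a = 2\<close> and \<open>A\<close> is twice \<open>x\<close>.\<close>
    have "A h = of_real a * x h"
    proof (cases "a = 0 \<or> b = 0")
      case True
      then show ?thesis
      proof
        assume "a = 0"
        then show ?thesis using pos_functional_bound[OF pA h] A1 by simp
      next
        assume "b = 0"
        then have "B h = 0" using pos_functional_bound[OF pB h] B1 by simp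
        then show ?thesis using sum[OF h] ab \<open>b = 0\<close> by simp
      qed
    next
      case False
      define A' where "A' = (\<lambda>h\<in>carrier G. of_real (1/a) * A h)"
      define B' where "B' = (\<lambda>h\<in>carrier G. of_real (1/b) * B h)"
      have "A' \<in> states G"
        using pos_functional_scale[OF pA, of "1/a"] ab False A1
        by (auto simp: states_def A'_def)
      moreover have "B' \<in> states G"
        using pos_functional_scale[OF pB, of "1/b"] ab False B1
        by (auto simp: states_def B'_def)
      moreover have "0 < b/2" "b/2 < 1" using ab False by auto
      \<comment> \<open>The weights \<open>a/2\<close> and \<open>b/2\<close> cancel the normalising
        factors and leave the average of \<open>A\<close> and \<open>B\<close>.\<close>
      moreover have "mix (b/2) A' B' = x"
      proof
        fix k
        show "mix (b/2) A' B' k = x k"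
        proof (cases "k \<in> carrier G")
          case True
          have "1 - b/2 = a/2" using ab by simp
          then have "mix (b/2) A' B' k = (A k + B k) / 2"
            unfolding mix_def \<open>1 - b/2 = a/2\<close>
            using True False by (simp add: A'_def B'_def add_divide_distrib)
          then show ?thesis using sum[OF True] by simp
        next
          \<comment> \<open>Off the carrier all three functions are \<open>undefined\<close>, and
            the weights of the mixture add up to 1.\<close>
          case k: False
          then show ?thesis
            using extensional_arb[OF xe k] by (simp add: mix_def A'_def B'_def algebra_simps)
        qed
      qed
      ultimately have "A' = x" by (rule ext)
      then have "A' h = x h" by simp
      then show ?thesis using h False by (simp add: A'_def field_simps)
    qed
    then show ?thesis by (simp add: A_def a_def)
  qed
  have mult: "x (g \<otimes> h) = x g * x h" if g: "g \<in> carrier G" and h: "h \<in> carrier G" for g h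
  proof -
    define u v where "u = x (g \<otimes> h)" and "v = x (inv g \<otimes> h)"
    have "l * u + cnj l * v = 2 * Re (l * x g) * x h" if "cmod l = 1" for l
      using key[OF that g h] h by (simp add: twist_def u_def v_def field_simps)
    from this[of 1] this[of \<i>]
    have 1: "u + v = 2 * Re (x g) * x h" and 2: "\<i> * u - \<i> * v = - 2 * Im (x g) * x h" by simp_all
    have "\<i> * (u - v) = \<i> * (2 * \<i> * Im (x g) * x h)"
      using 2 by (simp add: algebra_simps)
    then have 3: "u - v = 2 * \<i> * Im (x g) * x h" by simp
    have "2 * u = (u + v) + (u - v)" by simp
    also have "\<dots> = 2 * (Re (x g) + \<i> * Im (x g)) * x h" unfolding 1 3 by (simp add: algebra_simps)
    also have "\<dots> = 2 * (x g * x h)" by (simp add: complex_eq[symmetric])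
    finally show ?thesis by (simp add: u_def)
  qed
  show ?thesis
  proof (rule dualI[OF xe _ mult])
    fix g assume g: "g \<in> carrier G"
    \<comment> \<open>Multiplicativity at \<open>g\<close> and its inverse, where the value at the
      inverse is the conjugate.\<close>
    have "x g * cnj (x g) = 1"
      using mult[OF g inv_closed[OF g]] x1 g pos_functional_inv[OF p g] by simp
    then have "(cmod (x g))\<^sup>2 = 1"
      by (metis complex_norm_square of_real_eq_1_iff)
    then show "cmod (x g) = 1" by (simp add: power2_eq_1_iff) (smt (verit) norm_ge_zero)
  qed
qed

lemma state_le_sup_dual:
  assumes \<phi>: "\<phi> \<in> states G" and p: "p \<in> trig_polys G"
    and le: "\<And>\<psi>. \<psi> \<in> dual G \<Longrightarrow> p \<psi> \<le> m"
  shows "p \<phi> \<le> m"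
proof -
  have "states G \<noteq> {}" using \<phi> by auto
  then obtain x where x: "x \<in> states G" "\<And>f. f \<in> states G \<Longrightarrow> p f \<le> p x"
    "\<And>f g t. f \<in> states G \<Longrightarrow> g \<in> states G \<Longrightarrow> 0 < t \<Longrightarrow> t < 1 \<Longrightarrow> mix t f g = x \<Longrightarrow> f = x"
    using extreme_maximizer[OF compact_states _ continuous_trig_poly[OF p] trig_poly_mix[OF p]]
    by blast
  have "x \<in> dual G" using extreme_state_in_dual[OF x(1,3)] .
  then show ?thesis using le x(2)[OF \<phi>] by force
qed

end

section \<open>Regular measures on compact Hausdorff spaces\<close>

lemma space_borel_algebra: "space (borel_algebra X) = topspace X"
  unfolding borel_algebra_def by (rule space_measure_of) (auto dest: openin_subset)

lemma sets_borel_algebra: "sets (borel_algebra X) = sigma_sets (topspace X) {U. openin X U}"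
  unfolding borel_algebra_def by (rule sets_measure_of) (auto dest: openin_subset)

lemma openin_in_borel_algebra: "openin X U \<Longrightarrow> U \<in> sets (borel_algebra X)"
  unfolding sets_borel_algebra by auto

lemma closedin_in_borel_algebra: "closedin X C \<Longrightarrow> C \<in> sets (borel_algebra X)"
  using sets.compl_sets[OF openin_in_borel_algebra[of X "topspace X - C"]]
  by (simp add: closedin_def space_borel_algebra Diff_Diff_Int inf.absorb2)

lemma continuous_map_borel_measurable:
  fixes f :: "'a \<Rightarrow> 'b::topological_space"
  assumes "continuous_map X euclidean f" "sets M = sets (borel_algebra X)"
  shows "f \<in> borel_measurable M"
proof (rule borel_measurableI)
  fix S :: "'b set" assume "open S"
  then have "openin X {x \<in> topspace X. f x \<in> S}"
    using openin_continuous_map_preimage[OF assms(1)] by simp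
  moreover have "f -` S \<inter> space M = {x \<in> topspace X. f x \<in> S}"
    using sets_eq_imp_space_eq[OF assms(2)] by (auto simp: space_borel_algebra)
  ultimately show "f -` S \<inter> space M \<in> sets M"
    using openin_in_borel_algebra assms(2) by metis
qed

lemma continuous_map_measurable:
  assumes "continuous_map X Y f"
  shows "f \<in> measurable (borel_algebra X) (borel_algebra Y)"
  unfolding borel_algebra_def[of Y]
proof (rule measurable_measure_of)
  show "{U. openin Y U} \<subseteq> Pow (topspace Y)" by (auto dest: openin_subset)
  show "f \<in> space (borel_algebra X) \<rightarrow> topspace Y"
    using assms by (auto simp: space_borel_algebra continuous_map_def)
  fix U assume "U \<in> {U. openin Y U}"
  then have "openin X {x \<in> topspace X. f x \<in> U}"
    using openin_continuous_map_preimage[OF assms] by simp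
  moreover have "f -` U \<inter> space (borel_algebra X) = {x \<in> topspace X. f x \<in> U}"
    by (auto simp: space_borel_algebra)
  ultimately show "f -` U \<inter> space (borel_algebra X) \<in> sets (borel_algebra X)"
    using openin_in_borel_algebra by metis
qed

lemma continuous_map_bounded:
  fixes f :: "'a \<Rightarrow> 'b::real_normed_vector"
  assumes "compact_space X" "continuous_map X euclidean f"
  obtains B where "0 < B" "\<And>x. x \<in> topspace X \<Longrightarrow> norm (f x) \<le> B"
proof -
  have "compactin euclidean (f ` topspace X)"
    using image_compactin assms unfolding compact_space_def by blast
  then have "bounded (f ` topspace X)" by (simp add: compact_imp_bounded)
  then show thesis using that unfolding bounded_pos by blast
qed

lemma continuous_map_integrable:
  fixes f :: "'a \<Rightarrow> 'b::{banach, second_countable_topology}"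
  assumes "compact_space X" "continuous_map X euclidean f"
    and M: "sets M = sets (borel_algebra X)" "finite_measure M"
  shows "integrable M f"
proof -
  obtain B where "\<And>x. x \<in> topspace X \<Longrightarrow> norm (f x) \<le> B"
    using continuous_map_bounded[OF assms(1,2)] by blast
  then have "AE x in M. norm (f x) \<le> B"
    using sets_eq_imp_space_eq[OF M(1)] by (auto intro!: AE_I2 simp: space_borel_algebra)
  then show ?thesis
    by (rule finite_measure.integrable_const_bound[OF M(2) _ continuous_map_borel_measurable[OF assms(2) M(1)]])
qed

lemma regular_borel_prob_space:
  "regular_borel_prob X M \<Longrightarrow> space M = topspace X"
  using sets_eq_imp_space_eq[of M "borel_algebra X"]
  by (simp add: regular_borel_prob_def space_borel_algebra)

lemma regular_borel_prob_approx:
  assumes M: "regular_borel_prob X M" and A: "A \<in> sets M" and "0 < e"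
  obtains U C where "openin X U" "A \<subseteq> U" "compactin X C" "C \<subseteq> A"
    "measure M U < measure M A + e" "measure M A - e < measure M C"
proof -
  interpret prob_space M using M by (simp add: regular_borel_prob_def)
  have s: "space M = topspace X" by (rule regular_borel_prob_space[OF M])
  have inf: "emeasure M A = (INF U\<in>{U. openin X U \<and> A \<subseteq> U}. emeasure M U)"
    and sup: "emeasure M A = (SUP C\<in>{C. compactin X C \<and> C \<subseteq> A}. emeasure M C)"
    using M A unfolding regular_borel_prob_def by blast+
  have "(INF U\<in>{U. openin X U \<and> A \<subseteq> U}. emeasure M U) < ennreal (measure M A + e)"
    unfolding inf[symmetric] using \<open>0 < e\<close> by (simp add: emeasure_eq_measure ennreal_less_iff)
  then obtain U where U: "openin X U" "A \<subseteq> U" "emeasure M U < ennreal (measure M A + e)"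
    unfolding INF_less_iff by auto
  obtain C where C: "compactin X C" "C \<subseteq> A" "measure M A - e < measure M C"
  \<comment> \<open>\<open>ennreal\<close> sends a negative number to 0, where the strict inequality
    below fails for null sets; the empty set handles this case.\<close>
  proof (cases "measure M A - e < 0")
    case True
    then have "measure M A - e < measure M {}" by simp
    then show thesis using that[of "{}"] by simp
  next
    case False
    then have "ennreal (measure M A - e) < (SUP C\<in>{C. compactin X C \<and> C \<subseteq> A}. emeasure M C)"
      unfolding sup[symmetric] using \<open>0 < e\<close> by (simp add: emeasure_eq_measure ennreal_less_iff)
    then show thesis using that False
      unfolding less_SUP_iff by (auto simp: emeasure_eq_measure ennreal_less_iff)
  qed
  show thesis
    using that[OF U(1,2) C(1,2) _ C(3)] U(3) by (simp add: emeasure_eq_measure ennreal_less_iff)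
qed

locale compact_Hausdorff =
  fixes X :: "'a topology"
  assumes compact: "compact_space X" and Hausdorff: "Hausdorff_space X"
begin

lemma normal: "normal_space X"
  using compact Hausdorff compact_Hausdorff_or_regular_imp_normal_space by blast

lemma Urysohn:
  assumes "closedin X C" "openin X U" "C \<subseteq> U"
  obtains h where "continuous_map X euclideanreal h" "\<And>x. x \<in> topspace X \<Longrightarrow> 0 \<le> h x \<and> h x \<le> (1::real)"
    "\<And>x. x \<in> C \<Longrightarrow> h x = 1" "\<And>x. x \<in> topspace X - U \<Longrightarrow> h x = 0"
proof -
  obtain h where h: "continuous_map X (top_of_set {0..1::real}) h" "h ` (topspace X - U) \<subseteq> {0}" "h ` C \<subseteq> {1}"
    by (rule Urysohn_lemma[of X "topspace X - U" C 0 1]) (use normal assms in \<open>auto simp: disjnt_iff\<close>)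
  show thesis
    by (rule that[of h]) (use h in \<open>auto simp: continuous_map_in_subtopology image_subset_iff\<close>)
qed

lemma compact_subset_closed: "compactin X C \<Longrightarrow> closedin X C"
  using compactin_imp_closedin[OF Hausdorff] .

text \<open>Inner regularity comes from complements: if an open \<open>U\<close> covers the
  complement of \<open>A\<close> tightly, then the complement of \<open>U\<close> is a compact
  subset of \<open>A\<close> of nearly full measure.\<close>

lemma outer_regular_imp_regular:
  assumes M: "sets M = sets (borel_algebra X)" "prob_space M"
    and outer: "\<And>A e. A \<in> sets M \<Longrightarrow> 0 < e \<Longrightarrow>
      \<exists>U. openin X U \<and> A \<subseteq> U \<and> measure M U \<le> measure M A + e"
  shows "regular_borel_prob X M"
  unfolding regular_borel_prob_def
proof (intro conjI ballI)
  interpret prob_space M by fact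
  have s: "space M = topspace X"
    using sets_eq_imp_space_eq[OF M(1)] by (simp add: space_borel_algebra)
  fix A assume A: "A \<in> sets M"
  show "emeasure M A = (INF U\<in>{U. openin X U \<and> A \<subseteq> U}. emeasure M U)"
  proof (rule antisym)
    show "emeasure M A \<le> (INF U\<in>{U. openin X U \<and> A \<subseteq> U}. emeasure M U)"
      using openin_in_borel_algebra M by (intro INF_greatest emeasure_mono) auto
    show "(INF U\<in>{U. openin X U \<and> A \<subseteq> U}. emeasure M U) \<le> emeasure M A"
    proof (rule ennreal_le_epsilon)
      fix e :: real assume "0 < e"
      then obtain U where U: "openin X U" "A \<subseteq> U" "measure M U \<le> measure M A + e"
        using outer[OF A] by blast
      then have "emeasure M U \<le> emeasure M A + ennreal e"
        using \<open>0 < e\<close> by (simp add: emeasure_eq_measure ennreal_plus[symmetric] del: ennreal_plus)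
      then show "(INF U\<in>{U. openin X U \<and> A \<subseteq> U}. emeasure M U) \<le> emeasure M A + ennreal e"
        using U by (intro INF_lower2[of U]) auto
    qed
  qed
  show "emeasure M A = (SUP C\<in>{C. compactin X C \<and> C \<subseteq> A}. emeasure M C)"
  proof (rule antisym)
    show "(SUP C\<in>{C. compactin X C \<and> C \<subseteq> A}. emeasure M C) \<le> emeasure M A"
      using A by (intro SUP_least emeasure_mono) auto
    show "emeasure M A \<le> (SUP C\<in>{C. compactin X C \<and> C \<subseteq> A}. emeasure M C)"
    proof (rule ennreal_le_epsilon)
      fix e :: real assume "0 < e"
      obtain U where U: "openin X U" "space M - A \<subseteq> U" "measure M U \<le> measure M (space M - A) + e"
        using outer[OF sets.compl_sets[OF A] \<open>0 < e\<close>] by blast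
      have Us: "U \<in> sets M" using U(1) M openin_in_borel_algebra by metis
      let ?C = "space M - U"
      have C: "compactin X ?C" "?C \<subseteq> A"
        using U compact s sets.sets_into_space[OF A] by (auto intro!: closedin_compact_space)
      have "measure M A \<le> measure M ?C + e"
        using U(3) prob_compl[OF A] prob_compl[OF Us] by simp
      then have "emeasure M A \<le> emeasure M ?C + ennreal e"
        using \<open>0 < e\<close> by (simp add: emeasure_eq_measure ennreal_plus[symmetric] del: ennreal_plus)
      also have "\<dots> \<le> (SUP C\<in>{C. compactin X C \<and> C \<subseteq> A}. emeasure M C) + ennreal e"
        using C by (intro add_right_mono SUP_upper) auto
      finally show "emeasure M A \<le> (SUP C\<in>{C. compactin X C \<and> C \<subseteq> A}. emeasure M C) + ennreal e" .
    qed
  qed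
qed (use M in auto)

text \<open>A Urysohn function between a compact subset of \<open>U\<close> and \<open>U\<close> has
  the same integral under both measures. Used in both directions it gives equality on open sets, and
  outer regularity carries that to all Borel sets.\<close>

lemma measure_open_le:
  assumes M: "regular_borel_prob X M" and N: "regular_borel_prob X N"
    and eq: "\<And>f. continuous_map X euclideanreal f \<Longrightarrow> (\<integral>x. f x \<partial>M) = (\<integral>x. f x \<partial>N)"
    and U: "openin X U"
  shows "measure M U \<le> measure N U"
proof (rule field_le_epsilon)
  fix e :: real assume "0 < e"
  interpret M: prob_space M using M by (simp add: regular_borel_prob_def)
  interpret N: prob_space N using N by (simp add: regular_borel_prob_def)
  have sM: "sets M = sets (borel_algebra X)" and sN: "sets N = sets (borel_algebra X)"
    using M N by (auto simp: regular_borel_prob_def)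
  have Us: "U \<in> sets M" "U \<in> sets N" using sM sN openin_in_borel_algebra[OF U] by auto
  obtain C where C: "compactin X C" "C \<subseteq> U" "measure M U - e < measure M C"
    using regular_borel_prob_approx[OF M Us(1) \<open>0 < e\<close>] by metis
  obtain h where h: "continuous_map X euclideanreal h" "\<And>x. x \<in> topspace X \<Longrightarrow> 0 \<le> h x \<and> h x \<le> (1::real)"
    "\<And>x. x \<in> C \<Longrightarrow> h x = 1" "\<And>x. x \<in> topspace X - U \<Longrightarrow> h x = 0"
    using Urysohn[OF compact_subset_closed[OF C(1)] U C(2)] by blast
  have Cs: "C \<in> sets M" using closedin_in_borel_algebra[OF compact_subset_closed[OF C(1)]] sM by simp
  have hM: "integrable M h" and hN: "integrable N h"
    using continuous_map_integrable[OF compact h(1)] sM sN M.finite_measure_axioms N.finite_measure_axioms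
    by auto
  have "measure M C = (\<integral>x. indicator C x \<partial>M)" using Cs by simp
  also have "\<dots> \<le> (\<integral>x. h x \<partial>M)"
    using hM Cs h(2,3) regular_borel_prob_space[OF M]
    by (intro integral_mono integrable_real_indicator)
      (auto simp: indicator_def M.emeasure_eq_measure)
  also have "\<dots> = (\<integral>x. h x \<partial>N)" by (rule eq[OF h(1)])
  also have "\<dots> \<le> (\<integral>x. indicator U x \<partial>N)"
    using hN Us h(2,4) regular_borel_prob_space[OF N]
    by (intro integral_mono integrable_real_indicator)
      (auto simp: indicator_def N.emeasure_eq_measure)
  also have "\<dots> = measure N U" using Us by simp
  finally show "measure M U \<le> measure N U + e" using C(3) by simp
qed

lemma regular_measure_unique:
  assumes M: "regular_borel_prob X M" and N: "regular_borel_prob X N"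
    and eq: "\<And>f. continuous_map X euclideanreal f \<Longrightarrow> (\<integral>x. f x \<partial>M) = (\<integral>x. f x \<partial>N)"
  shows "M = N"
proof (rule measure_eqI)
  show s: "sets M = sets N" using M N by (simp add: regular_borel_prob_def)
  interpret M: prob_space M using M by (simp add: regular_borel_prob_def)
  interpret N: prob_space N using N by (simp add: regular_borel_prob_def)
  have "emeasure M U = emeasure N U" if "openin X U" for U
    using measure_open_le[OF M N eq that] measure_open_le[OF N M eq[symmetric] that]
    by (simp add: M.emeasure_eq_measure N.emeasure_eq_measure)
  moreover fix A assume "A \<in> sets M"
  ultimately show "emeasure M A = emeasure N A"
    using M N s unfolding regular_borel_prob_def by (metis (no_types, lifting) INF_cong mem_Collect_eq)
qed

text \<open>With \<open>A\<close> squeezed between a compact \<open>C\<close> and an open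
  \<open>U\<close>, the Urysohn function differs from the indicator by at most 1, and only on
  \<open>U - C\<close>, whose measure is less than \<open>e\<close>.\<close>

lemma indicator_approx:
  assumes M: "regular_borel_prob X M" and A: "A \<in> sets M" and "0 < e"
  obtains f where "continuous_map X euclideanreal f" "(\<integral>x. (indicator A x - f x)\<^sup>2 \<partial>M) < e"
proof -
  interpret prob_space M using M by (simp add: regular_borel_prob_def)
  have sM: "sets M = sets (borel_algebra X)" using M by (simp add: regular_borel_prob_def)
  obtain U C where UC: "openin X U" "A \<subseteq> U" "compactin X C" "C \<subseteq> A"
    "measure M U < measure M A + e/2" "measure M A - e/2 < measure M C"
    using regular_borel_prob_approx[OF M A, of "e/2"] \<open>0 < e\<close> by auto
  have s: "U \<in> sets M" "C \<in> sets M"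
    using openin_in_borel_algebra[OF UC(1)] closedin_in_borel_algebra[OF compact_subset_closed[OF UC(3)]] sM
    by auto
  obtain h where h: "continuous_map X euclideanreal h" "\<And>x. x \<in> topspace X \<Longrightarrow> 0 \<le> h x \<and> h x \<le> (1::real)"
    "\<And>x. x \<in> C \<Longrightarrow> h x = 1" "\<And>x. x \<in> topspace X - U \<Longrightarrow> h x = 0"
    using Urysohn[OF compact_subset_closed[OF UC(3)] UC(1)] UC(2,4) by blast
  have hb: "h \<in> borel_measurable M" by (rule continuous_map_borel_measurable[OF h(1) sM])
  have le: "(indicator A x - h x)\<^sup>2 \<le> indicator (U - C) x" if "x \<in> space M" for x
  proof -
    have x: "x \<in> topspace X" using that regular_borel_prob_space[OF M] by simp
    have "\<bar>indicator A x - h x\<bar> \<le> 1" using h(2)[OF x] by (auto simp: indicator_def)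
    then have "(indicator A x - h x)\<^sup>2 \<le> 1" by (metis abs_square_le_1)
    moreover have "indicator A x - h x = 0" if "x \<notin> U - C"
      using that x h(3,4)[of x] UC(2,4) by (auto simp: indicator_def)
    ultimately show ?thesis by (auto simp: indicator_def)
  qed
  have "(\<integral>x. (indicator A x - h x)\<^sup>2 \<partial>M) \<le> (\<integral>x. indicator (U - C) x \<partial>M)"
  proof (rule integral_mono)
    show "integrable M (\<lambda>x. (indicator A x - h x)\<^sup>2)"
    proof (rule integrable_const_bound[of _ 1])
      show "AE x in M. norm ((indicator A x - h x)\<^sup>2) \<le> 1"
      proof (rule AE_I2)
        fix x assume "x \<in> space M"
        then have "(indicator A x - h x)\<^sup>2 \<le> (1::real)"
          by (rule order_trans[OF le]) (simp add: indicator_def)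
        then show "norm ((indicator A x - h x)\<^sup>2) \<le> 1" by simp
      qed
    qed (use hb A in measurable)
  qed (use s le in \<open>auto simp: emeasure_eq_measure intro!: integrable_real_indicator\<close>)
  also have "\<dots> = measure M U - measure M C"
    using s UC(2,4) by (simp add: finite_measure_Diff)
  also have "\<dots> < e" using UC(5,6) by simp
  finally show thesis using that h(1) by blast
qed

end

section \<open>The Riesz representation theorem for normalised positive functionals\<close>

locale riesz_functional = compact_Hausdorff X for X :: "'a topology" +
  fixes L :: "('a \<Rightarrow> real) \<Rightarrow> real"
  assumes L_add: "continuous_map X euclideanreal f \<Longrightarrow> continuous_map X euclideanreal g \<Longrightarrow>
      L (\<lambda>x. f x + g x) = L f + L g"
    and L_scale: "continuous_map X euclideanreal f \<Longrightarrow> L (\<lambda>x. c * f x) = c * L f"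
    and L_mono: "continuous_map X euclideanreal f \<Longrightarrow> continuous_map X euclideanreal g \<Longrightarrow>
      (\<And>x. x \<in> topspace X \<Longrightarrow> f x \<le> g x) \<Longrightarrow> L f \<le> L g"
    and L_one: "L (\<lambda>_. 1) = 1"
begin

lemma L_const: "L (\<lambda>_. c) = c"
  using L_scale[of "\<lambda>_. 1" c] L_one by simp

lemma L_nonneg: "continuous_map X euclideanreal f \<Longrightarrow> (\<And>x. x \<in> topspace X \<Longrightarrow> 0 \<le> f x) \<Longrightarrow> 0 \<le> L f"
  using L_mono[of "\<lambda>_. 0" f] L_const[of 0] by simp

text \<open>Asks for vanishing outside \<open>U\<close> rather than compact support inside it;
  \<open>truncate\<close> supplies the compact support at the cost of \<open>e\<close>.\<close>

definition below :: "'a set \<Rightarrow> ('a \<Rightarrow> real) set" where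
  "below U = {f. continuous_map X euclideanreal f \<and> (\<forall>x\<in>topspace X. 0 \<le> f x \<and> f x \<le> 1) \<and>
     (\<forall>x\<in>topspace X - U. f x = 0)}"

definition inner_content :: "'a set \<Rightarrow> ennreal" where
  "inner_content U = (SUP f\<in>below U. ennreal (L f))"

definition outer :: "'a set \<Rightarrow> ennreal" where
  "outer A = (INF U\<in>{U. openin X U \<and> A \<subseteq> U}. inner_content U)"

definition riesz_measure :: "'a measure" where
  "riesz_measure = measure_of (topspace X) (sets (borel_algebra X)) outer"

lemma zero_below: "(\<lambda>_. 0) \<in> below U"
  by (simp add: below_def)

lemma below_ne: "below U \<noteq> {}"
  using zero_below by blast

lemma belowD:
  assumes "f \<in> below U"
  shows "continuous_map X euclideanreal f" "\<And>x. x \<in> topspace X \<Longrightarrow> 0 \<le> f x"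
    "\<And>x. x \<in> topspace X \<Longrightarrow> f x \<le> 1" "\<And>x. x \<in> topspace X \<Longrightarrow> x \<notin> U \<Longrightarrow> f x = 0"
  using assms by (auto simp: below_def)

lemma L_below_nonneg: "f \<in> below U \<Longrightarrow> 0 \<le> L f"
  using belowD by (intro L_nonneg) auto

lemma inner_content_upper: "f \<in> below U \<Longrightarrow> ennreal (L f) \<le> inner_content U"
  unfolding inner_content_def by (rule SUP_upper)

lemma inner_content_mono: "U \<subseteq> V \<Longrightarrow> inner_content U \<le> inner_content V"
  unfolding inner_content_def by (rule SUP_subset_mono) (auto simp: below_def)

lemma inner_content_empty: "inner_content {} = 0"
proof -
  have "L f = 0" if "f \<in> below {}" for f
  proof (rule antisym)
    show "L f \<le> 0" using L_mono[of f "\<lambda>_. 0"] belowD[OF that] L_const[of 0] by simp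
  qed (rule L_below_nonneg[OF that])
  then show ?thesis unfolding inner_content_def using below_ne by (simp cong: SUP_cong)
qed

lemma inner_content_top: "inner_content (topspace X) = 1"
proof (rule antisym)
  have "L f \<le> 1" if "f \<in> below (topspace X)" for f
    using L_mono[of f "\<lambda>_. 1"] belowD[OF that] L_one by simp
  then show "inner_content (topspace X) \<le> 1"
    unfolding inner_content_def by (intro SUP_least) (simp add: ennreal_le_1)
  have "(\<lambda>_. 1) \<in> below (topspace X)" by (simp add: below_def)
  from inner_content_upper[OF this] show "1 \<le> inner_content (topspace X)" using L_one by simp
qed

text \<open>Subtracting \<open>e\<close> moves the support of a function into a compact subset of \<open>U\<close>.\<close>

lemma truncate:
  assumes f: "f \<in> below U" and "0 < e"
  obtains f' K where "f' \<in> below U" "closedin X K" "K \<subseteq> U"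
    "\<And>x. x \<in> topspace X \<Longrightarrow> x \<notin> K \<Longrightarrow> f' x = 0" "L f \<le> L f' + e"
proof -
  let ?f = "\<lambda>x. max (f x - e) 0"
  let ?K = "{x \<in> topspace X. f x \<in> {e..}}"
  have c: "continuous_map X euclideanreal ?f"
    by (intro continuous_intros belowD(1)[OF f])
  have "f x \<le> ?f x + e" for x by simp
  then have "L f \<le> L (\<lambda>x. ?f x + e)"
    by (intro L_mono continuous_intros c belowD(1)[OF f])
  also have "\<dots> = L ?f + e" using L_add[OF c, of "\<lambda>_. e"] L_const by simp
  finally have le: "L f \<le> L ?f + e" .
  have "closedin X ?K" by (intro closedin_continuous_map_preimage[OF belowD(1)[OF f]]) simp
  moreover have "?K \<subseteq> U" using belowD(4)[OF f] \<open>0 < e\<close> by force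
  moreover have "?f \<in> below U"
    using c belowD[OF f] \<open>0 < e\<close> by (force simp: below_def)
  ultimately show thesis using that[of ?f ?K] le by auto
qed

text \<open>A function supported in a compact \<open>K\<close> splits along a Urysohn function
  \<open>h\<close> that is 1 on \<open>K - U\<close> and 0 off \<open>V\<close>. The part
  \<open>f' * (1 - h)\<close> vanishes off \<open>U\<close>: there a point is either outside
  \<open>K\<close>, where \<open>f'\<close> is 0, or in \<open>K - U\<close>, where \<open>h\<close>
  is 1.\<close>

lemma inner_content_Un:
  assumes "openin X U" "openin X V"
  shows "inner_content (U \<union> V) \<le> inner_content U + inner_content V"
  unfolding inner_content_def[of "U \<union> V"]
proof (rule SUP_least)
  fix f assume f: "f \<in> below (U \<union> V)"
  show "ennreal (L f) \<le> inner_content U + inner_content V"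
  proof (rule ennreal_le_epsilon)
    fix e :: real assume "0 < e"
    obtain f' K where f': "f' \<in> below (U \<union> V)" and K: "closedin X K" "K \<subseteq> U \<union> V"
        "\<And>x. x \<in> topspace X \<Longrightarrow> x \<notin> K \<Longrightarrow> f' x = 0" and le: "L f \<le> L f' + e"
      using truncate[OF f \<open>0 < e\<close>] by blast
    have "closedin X (K - U)" "K - U \<subseteq> V" using K assms by (auto intro: closedin_diff)
    then obtain h where h: "continuous_map X euclideanreal h"
      "\<And>x. x \<in> topspace X \<Longrightarrow> 0 \<le> h x \<and> h x \<le> (1::real)"
      "\<And>x. x \<in> K - U \<Longrightarrow> h x = 1" "\<And>x. x \<in> topspace X - V \<Longrightarrow> h x = 0"
      using Urysohn[of "K - U" V] assms by metis
    have bd: "0 \<le> a * b \<and> a * b \<le> 1" if "0 \<le> a" "a \<le> 1" "0 \<le> b" "b \<le> 1" for a b :: real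
      using that mult_le_one[of a b] by simp
    have c: "continuous_map X euclideanreal (\<lambda>x. f' x * h x)"
      "continuous_map X euclideanreal (\<lambda>x. f' x * (1 - h x))"
      by (intro continuous_intros belowD(1)[OF f'] h(1))+
    have V: "(\<lambda>x. f' x * h x) \<in> below V"
      using c(1) belowD(2,3)[OF f'] h(2,4) bd by (auto simp: below_def)
    have "f' x * (1 - h x) = 0" if "x \<in> topspace X" "x \<notin> U" for x
      using that h(3) K(3) by (cases "x \<in> K") auto
    then have U: "(\<lambda>x. f' x * (1 - h x)) \<in> below U"
      using c(2) belowD(2,3)[OF f'] h(2) bd by (auto simp: below_def)
    have "f' = (\<lambda>x. f' x * (1 - h x) + f' x * h x)" by (simp add: algebra_simps)
    then have "L f' = L (\<lambda>x. f' x * (1 - h x)) + L (\<lambda>x. f' x * h x)"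
      using L_add[OF c(2,1)] by simp
    then have "ennreal (L f) \<le> ennreal (L (\<lambda>x. f' x * (1 - h x)) + L (\<lambda>x. f' x * h x) + e)"
      using le by (intro ennreal_leI) simp
    also have "\<dots> = ennreal (L (\<lambda>x. f' x * (1 - h x))) + ennreal (L (\<lambda>x. f' x * h x)) + ennreal e"
      using L_below_nonneg[OF U] L_below_nonneg[OF V] \<open>0 < e\<close> by simp
    also have "\<dots> \<le> inner_content U + inner_content V + ennreal e"
      by (intro add_mono inner_content_upper U V order_refl)
    finally show "ennreal (L f) \<le> inner_content U + inner_content V + ennreal e" .
  qed
qed

text \<open>After truncation the support is compact, so finitely many of the open sets cover it and
  the finite case applies.\<close>

lemma inner_content_UN:
  fixes U :: "nat \<Rightarrow> 'a set"
  assumes U: "\<And>i. openin X (U i)"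
  shows "inner_content (\<Union>i. U i) \<le> (\<Sum>i. inner_content (U i))"
  unfolding inner_content_def[of "\<Union>i. U i"]
proof (rule SUP_least)
  have fin: "inner_content (\<Union>i<n. U i) \<le> (\<Sum>i<n. inner_content (U i))" for n
  proof (induction n)
    case (Suc n)
    have "inner_content (\<Union>i<Suc n. U i) \<le> inner_content (\<Union>i<n. U i) + inner_content (U n)"
      using inner_content_Un[of "\<Union>i<n. U i" "U n"] U by (auto simp: lessThan_Suc Un_commute)
    also have "\<dots> \<le> (\<Sum>i<Suc n. inner_content (U i))" using Suc by (simp add: add_right_mono)
    finally show ?case .
  qed (simp add: inner_content_empty)
  fix f assume f: "f \<in> below (\<Union>i. U i)"
  show "ennreal (L f) \<le> (\<Sum>i. inner_content (U i))"
  proof (rule ennreal_le_epsilon)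
    fix e :: real assume "0 < e"
    obtain f' K where f': "f' \<in> below (\<Union>i. U i)" and K: "closedin X K" "K \<subseteq> (\<Union>i. U i)"
        "\<And>x. x \<in> topspace X \<Longrightarrow> x \<notin> K \<Longrightarrow> f' x = 0" and le: "L f \<le> L f' + e"
      using truncate[OF f \<open>0 < e\<close>] by blast
    obtain F where F: "finite F" "F \<subseteq> range U" "K \<subseteq> \<Union>F"
      using compactinD[OF closedin_compact_space[OF compact K(1)], of "range U"] U K(2) by auto
    obtain I where I: "finite I" "F = U ` I" using finite_subset_image[OF F(1,2)] by blast
    obtain n where n: "\<And>i. i \<in> I \<Longrightarrow> i < n"
      using I(1)[unfolded finite_nat_set_iff_bounded] by blast
    have "\<Union>(U ` I) \<subseteq> (\<Union>i<n. U i)" using n by auto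
    then have "K \<subseteq> (\<Union>i<n. U i)" using F(3) I(2) by simp
    then have b: "f' \<in> below (\<Union>i<n. U i)"
      using K(3) belowD[OF f'] by (auto simp: below_def)
    have "ennreal (L f) \<le> ennreal (L f') + ennreal e"
      using ennreal_leI[OF le] L_below_nonneg[OF f'] \<open>0 < e\<close> by simp
    moreover have "ennreal (L f') \<le> (\<Sum>i<n. inner_content (U i))"
      by (rule order_trans[OF inner_content_upper[OF b] fin])
    moreover have "(\<Sum>i<n. inner_content (U i)) \<le> (\<Sum>i. inner_content (U i))"
      by (rule sum_le_suminf) auto
    ultimately show "ennreal (L f) \<le> (\<Sum>i. inner_content (U i)) + ennreal e"
      by (meson add_right_mono order_trans)
  qed
qed

lemma outer_open: "openin X U \<Longrightarrow> outer U = inner_content U"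
  unfolding outer_def by (rule antisym) (auto intro: INF_lower INF_greatest inner_content_mono)

lemma outer_mono: "A \<subseteq> B \<Longrightarrow> outer A \<le> outer B"
  unfolding outer_def by (rule INF_superset_mono) auto

lemma outer_close:
  assumes "A \<subseteq> topspace X" "0 < e"
  obtains U where "openin X U" "A \<subseteq> U" "inner_content U \<le> outer A + ennreal e"
proof -
  have "outer A \<le> 1"
    using outer_mono[OF assms(1)] outer_open[OF openin_topspace] inner_content_top by simp
  \<comment> \<open>Finiteness of \<open>outer A\<close> matters here: in \<open>ennreal\<close>,
    adding \<open>e\<close> to infinity gives no strict increase.\<close>
  then have "outer A < outer A + ennreal e"
    using assms(2) by (simp add: ennreal_between(1) less_top[symmetric]) (auto simp: top_unique)
  then obtain U where "openin X U" "A \<subseteq> U" "inner_content U < outer A + ennreal e"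
    unfolding outer_def INF_less_iff by blast
  then show thesis using that by (metis less_imp_le)
qed

lemma outer_measure_space_outer: "outer_measure_space (Pow (topspace X)) outer"
  unfolding outer_measure_space_def
proof (intro conjI)
  show "positive (Pow (topspace X)) outer"
    using outer_open[of "{}"] inner_content_empty by (simp add: positive_def)
  show "increasing (Pow (topspace X)) outer"
    by (simp add: increasing_def outer_mono)
  show "countably_subadditive (Pow (topspace X)) outer"
    unfolding countably_subadditive_def
  proof (intro allI impI)
    fix A :: "nat \<Rightarrow> 'a set" assume A: "range A \<subseteq> Pow (topspace X)"
    show "outer (\<Union>i. A i) \<le> (\<Sum>i. outer (A i))"
    proof (rule ennreal_le_epsilon)
      fix e :: real assume "0 < e"
      have "\<exists>U. openin X U \<and> A n \<subseteq> U \<and> inner_content U \<le> outer (A n) + ennreal (e * (1/2) ^ Suc n)" for n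
        using outer_close[of "A n" "e * (1/2) ^ Suc n"] A \<open>0 < e\<close> by (metis PowD divide_pos_pos
            mult_pos_pos range_subsetD zero_less_numeral zero_less_one zero_less_power)
      then obtain U where U: "\<And>n. openin X (U n)" "\<And>n. A n \<subseteq> U n"
        "\<And>n. inner_content (U n) \<le> outer (A n) + ennreal (e * (1/2) ^ Suc n)" by metis
      have "outer (\<Union>i. A i) \<le> outer (\<Union>i. U i)" using U(2) by (intro outer_mono) auto
      also have "\<dots> = inner_content (\<Union>i. U i)" using U(1) by (intro outer_open) auto
      also have "\<dots> \<le> (\<Sum>i. inner_content (U i))" by (rule inner_content_UN[OF U(1)])
      also have "\<dots> \<le> (\<Sum>i. outer (A i) + ennreal (e * (1/2) ^ Suc i))"
        by (intro suminf_le U(3)) auto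
      also have "\<dots> = (\<Sum>i. outer (A i)) + (\<Sum>i. ennreal e * ennreal ((1/2) ^ Suc i))"
        using \<open>0 < e\<close> by (subst suminf_add[symmetric])
          (auto simp del: ennreal_suminf_cmult simp add: ennreal_mult[symmetric])
      also have "\<dots> = (\<Sum>i. outer (A i)) + ennreal e"
        unfolding ennreal_suminf_cmult
        by (subst suminf_ennreal_eq[OF zero_le_power power_half_series]) auto
      finally show "outer (\<Union>i. A i) \<le> (\<Sum>i. outer (A i)) + ennreal e" .
    qed
  qed
qed

lemma outer_Un: "A \<subseteq> topspace X \<Longrightarrow> B \<subseteq> topspace X \<Longrightarrow> A \<inter> B = {} \<Longrightarrow> outer (A \<union> B) \<le> outer A + outer B"
proof -
  assume AB: "A \<subseteq> topspace X" "B \<subseteq> topspace X" "A \<inter> B = {}"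
  interpret P: algebra "topspace X" "Pow (topspace X)" by (rule algebra_Pow)
  have "subadditive (Pow (topspace X)) outer"
    using outer_measure_space_outer P.countably_subadditive_subadditive
    unfolding outer_measure_space_def by blast
  then show ?thesis using subadditiveD AB by (metis PowI)
qed

text \<open>A function supported in a compact \<open>K\<close> inside both open sets and a function
  below \<open>V - K\<close> are never nonzero at the same point, so their sum still stays below 1
  and below \<open>V\<close>. Moreover \<open>V - K\<close> is an open set containing
  \<open>V - U\<close>.\<close>

lemma inner_content_split:
  assumes U: "openin X U" and V: "openin X V"
  shows "inner_content (U \<inter> V) + outer (V - U) \<le> inner_content V"
proof -
  have "ennreal (L f) + outer (V - U) \<le> inner_content V" if f: "f \<in> below (U \<inter> V)" for f
  proof (rule ennreal_le_epsilon)
    fix e :: real assume "0 < e"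
    obtain f' K where f': "f' \<in> below (U \<inter> V)" and K: "closedin X K" "K \<subseteq> U \<inter> V"
        "\<And>x. x \<in> topspace X \<Longrightarrow> x \<notin> K \<Longrightarrow> f' x = 0" and le: "L f \<le> L f' + e"
      using truncate[OF f \<open>0 < e\<close>] by blast
    have VK: "openin X (V - K)" using V K(1) by (rule openin_diff)
    have "outer (V - U) \<le> inner_content (V - K)"
      using K(2) outer_mono[of "V - U" "V - K"] outer_open[OF VK] by auto
    moreover have "ennreal (L f') + inner_content (V - K) \<le> inner_content V"
      unfolding inner_content_def[of "V - K"] ennreal_SUP_add_right[OF below_ne]
    proof (rule SUP_least)
      fix g assume g: "g \<in> below (V - K)"
      have "f' x + g x \<le> 1" if "x \<in> topspace X" for x
        using that belowD(3)[OF f' that] belowD(3)[OF g that] K(3)[OF that] belowD(4)[OF g that]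
        by (cases "x \<in> K") auto
      then have "(\<lambda>x. f' x + g x) \<in> below V"
        using belowD(1)[OF f'] belowD(1)[OF g] belowD(2,4)[OF f'] belowD(2,4)[OF g]
        by (auto simp: below_def intro!: continuous_intros)
      from inner_content_upper[OF this] show "ennreal (L f') + ennreal (L g) \<le> inner_content V"
        using L_add[OF belowD(1)[OF f'] belowD(1)[OF g]] L_below_nonneg[OF f'] L_below_nonneg[OF g]
        by simp
    qed
    moreover have "ennreal (L f) \<le> ennreal (L f') + ennreal e"
      using ennreal_leI[OF le] L_below_nonneg[OF f'] \<open>0 < e\<close> by simp
    ultimately show "ennreal (L f) + outer (V - U) \<le> inner_content V + ennreal e"
      by (smt (verit) add.assoc add.commute add_mono order_refl order_trans)
  qed
  then show ?thesis
    unfolding inner_content_def[of "U \<inter> V"] ennreal_SUP_add_left[OF below_ne, symmetric]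
    by (rule SUP_least)
qed

text \<open>The Caratheodory condition has only one nontrivial inequality. Through the infimum in
  \<open>outer\<close>, a test set \<open>A\<close> may be replaced by an open \<open>V\<close>
  containing it, where \<open>inner_content_split\<close> applies.\<close>

lemma open_in_lambda_system:
  assumes U: "openin X U"
  shows "U \<in> lambda_system (topspace X) (Pow (topspace X)) outer"
  unfolding lambda_system_def
proof (intro CollectI conjI ballI)
  show "U \<in> Pow (topspace X)" using openin_subset[OF U] by simp
  fix A assume "A \<in> Pow (topspace X)"
  then have A: "A \<subseteq> topspace X" by simp
  show "outer (U \<inter> A) + outer ((topspace X - U) \<inter> A) = outer A"
  proof (rule antisym)
    have "(U \<inter> A) \<union> ((topspace X - U) \<inter> A) = A" using A by auto
    then show "outer A \<le> outer (U \<inter> A) + outer ((topspace X - U) \<inter> A)"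
      using outer_Un[of "U \<inter> A" "(topspace X - U) \<inter> A"] A by auto
    show "outer (U \<inter> A) + outer ((topspace X - U) \<inter> A) \<le> outer A"
      unfolding outer_def[of A]
    proof (rule INF_greatest)
      fix V assume "V \<in> {V. openin X V \<and> A \<subseteq> V}"
      then have V: "openin X V" "A \<subseteq> V" by auto
      have "outer (U \<inter> A) \<le> inner_content (U \<inter> V)"
        using outer_mono[OF Int_mono[OF subset_refl V(2), of U]] outer_open[OF openin_Int[OF U V(1)]]
        by simp
      moreover have "outer ((topspace X - U) \<inter> A) \<le> outer (V - U)"
        using V by (intro outer_mono) auto
      ultimately show "outer (U \<inter> A) + outer ((topspace X - U) \<inter> A) \<le> inner_content V"
        by (rule order_trans[OF add_mono inner_content_split[OF U V(1)]])
    qed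
  qed
qed

lemma measure_space_outer: "measure_space (topspace X) (sets (borel_algebra X)) outer"
proof (rule measure_down)
  interpret P: sigma_algebra "topspace X" "Pow (topspace X)" by (rule sigma_algebra_Pow)
  show ms: "measure_space (topspace X) (lambda_system (topspace X) (Pow (topspace X)) outer) outer"
    by (rule P.caratheodory_lemma[OF outer_measure_space_outer])
  show "sigma_algebra (topspace X) (sets (borel_algebra X))"
    using sets.sigma_algebra_axioms[of "borel_algebra X"] by (simp add: space_borel_algebra)
  interpret S: sigma_algebra "topspace X" "lambda_system (topspace X) (Pow (topspace X)) outer"
    using ms by (simp add: measure_space_def)
  show "sets (borel_algebra X) \<subseteq> lambda_system (topspace X) (Pow (topspace X)) outer"
    unfolding sets_borel_algebra by (rule S.sigma_sets_subset) (auto intro: open_in_lambda_system)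
qed

lemma sets_riesz_measure: "sets riesz_measure = sets (borel_algebra X)"
  unfolding riesz_measure_def using sets.space_closed[of "borel_algebra X"]
  by (simp add: space_borel_algebra sets.sigma_sets_eq[of "borel_algebra X", unfolded space_borel_algebra])

lemma space_riesz_measure: "space riesz_measure = topspace X"
  using sets_eq_imp_space_eq[OF sets_riesz_measure] by (simp add: space_borel_algebra)

lemma emeasure_riesz_measure: "A \<in> sets (borel_algebra X) \<Longrightarrow> emeasure riesz_measure A = outer A"
  unfolding riesz_measure_def
  using measure_space_outer by (intro emeasure_measure_of_sigma) (auto simp: measure_space_def)

lemma prob_space_riesz_measure: "prob_space riesz_measure"
  by (rule prob_spaceI)
    (simp add: space_riesz_measure emeasure_riesz_measure openin_in_borel_algebra outer_open inner_content_top)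

lemma regular_riesz_measure: "regular_borel_prob X riesz_measure"
proof (rule outer_regular_imp_regular[OF sets_riesz_measure prob_space_riesz_measure])
  interpret prob_space riesz_measure by (rule prob_space_riesz_measure)
  fix A and e :: real assume A: "A \<in> sets riesz_measure" and "0 < e"
  have "A \<subseteq> topspace X" using sets.sets_into_space[OF A] by (simp add: space_riesz_measure)
  then obtain U where U: "openin X U" "A \<subseteq> U" "inner_content U \<le> outer A + ennreal e"
    using outer_close[OF _ \<open>0 < e\<close>] by blast
  have "emeasure riesz_measure U \<le> emeasure riesz_measure A + ennreal e"
    using U A sets_riesz_measure
    by (simp add: emeasure_riesz_measure openin_in_borel_algebra outer_open)
  then have "measure riesz_measure U \<le> measure riesz_measure A + e"
    using \<open>0 < e\<close> by (simp add: emeasure_eq_measure ennreal_plus[symmetric] del: ennreal_plus)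
  with U show "\<exists>U. openin X U \<and> A \<subseteq> U \<and> measure riesz_measure U \<le> measure riesz_measure A + e"
    by blast
qed

lemma L_le_measure:
  assumes "f \<in> below U" "openin X U"
  shows "L f \<le> measure riesz_measure U"
proof -
  interpret prob_space riesz_measure by (rule prob_space_riesz_measure)
  have "ennreal (L f) \<le> emeasure riesz_measure U"
    using inner_content_upper[OF assms(1)] assms(2)
    by (simp add: emeasure_riesz_measure openin_in_borel_algebra outer_open)
  then show ?thesis by (simp add: emeasure_eq_measure)
qed

text \<open>Layer cake: \<open>f\<close> is the mean of the slices \<open>min 1 (max 0 (n f - k))\<close>, and the slice
  for \<open>k\<close> is dominated by the indicator of \<open>{f > k/n}\<close>.\<close>

lemma L_le_integral:
  assumes f: "continuous_map X euclideanreal f" and f01: "\<And>x. x \<in> topspace X \<Longrightarrow> 0 \<le> f x \<and> f x \<le> 1"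
  shows "L f \<le> (\<integral>x. f x \<partial>riesz_measure)"
proof (rule field_le_epsilon)
  interpret prob_space riesz_measure by (rule prob_space_riesz_measure)
  fix e :: real assume "0 < e"
  \<comment> \<open>The slices are too coarse by a total of 1 after scaling by \<open>n\<close>;
    this choice makes that less than \<open>n * e\<close>.\<close>
  obtain n :: nat where n: "1 < real n * e" using reals_Archimedean3[OF \<open>0 < e\<close>] by metis
  then have n0: "0 < n" using \<open>0 < e\<close> by (cases n) auto
  define s where "s k x = min 1 (max 0 (real n * f x - real k))" for k :: nat and x
  define U where "U k = {x \<in> topspace X. f x \<in> {real k / real n <..}}" for k :: nat
  have cs: "continuous_map X euclideanreal (s k)" for k
    unfolding s_def by (intro continuous_intros f)
  have oU: "openin X (U k)" for k
    unfolding U_def by (intro openin_continuous_map_preimage[OF f]) simp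
  have sU: "s k \<in> below (U k)" for k
  proof -
    have "s k x = 0" if "x \<in> topspace X" "x \<notin> U k" for x
    proof -
      have "f x \<le> real k / real n" using that by (simp add: U_def)
      then have "real n * f x \<le> real k" using n0 by (simp add: field_simps)
      then show ?thesis by (simp add: s_def)
    qed
    then show ?thesis using cs[of k] by (simp add: below_def) (simp add: s_def)
  qed
  have slices: "(\<Sum>k<m. s k x) = min (real m) (real n * f x)" if "x \<in> topspace X" for m x
  proof (induction m)
    case 0
    then show ?case using f01[OF that] by simp
  next
    case (Suc m)
    have "min (real m) y + min 1 (max 0 (y - real m)) = min (real (Suc m)) y" for y
      by (simp add: min_def max_def)
    then show ?case using Suc by (simp add: s_def)
  qed
  have Lsum: "L (\<lambda>x. \<Sum>k<m. s k x) = (\<Sum>k<m. L (s k))" for m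
  proof (induction m)
    case (Suc m)
    have "continuous_map X euclideanreal (\<lambda>x. \<Sum>k<m. s k x)"
      by (intro continuous_map_sum cs) simp
    from L_add[OF this cs[of m]] show ?case using Suc by simp
  qed (simp add: L_const)
  have "n * L f = L (\<lambda>x. n * f x)" using L_scale[OF f] by simp
  also have "\<dots> \<le> L (\<lambda>x. \<Sum>k<n. s k x)"
  proof (rule L_mono)
    show "continuous_map X euclideanreal (\<lambda>x. \<Sum>k<n. s k x)"
      by (intro continuous_map_sum cs) simp
    fix x assume x: "x \<in> topspace X"
    then show "n * f x \<le> (\<Sum>k<n. s k x)"
      using slices[OF x, of n] f01[OF x] by (simp add: mult_left_le)
  qed (intro continuous_intros f)
  also have "\<dots> \<le> (\<Sum>k<n. measure riesz_measure (U k))"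
    unfolding Lsum by (intro sum_mono L_le_measure sU oU)
  also have "\<dots> \<le> (\<integral>x. n * f x + 1 \<partial>riesz_measure)"
  proof -
    have Us: "U k \<in> sets riesz_measure" for k
      using openin_in_borel_algebra[OF oU] sets_riesz_measure by simp
    have "(\<Sum>k<n. measure riesz_measure (U k)) = (\<integral>x. (\<Sum>k<n. indicator (U k) x) \<partial>riesz_measure)"
      using Us by (subst Bochner_Integration.integral_sum) (auto intro!: integrable_real_indicator simp: emeasure_eq_measure)
    also have "\<dots> \<le> (\<integral>x. n * f x + 1 \<partial>riesz_measure)"
    proof (rule integral_mono)
      show "integrable riesz_measure (\<lambda>x. \<Sum>k<n. indicator (U k) x :: real)"
        using Us by (auto intro!: integrable_real_indicator simp: emeasure_eq_measure)
      show "integrable riesz_measure (\<lambda>x. n * f x + 1)"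
        by (intro continuous_map_integrable[OF compact _ sets_riesz_measure] continuous_intros f finite_measure_axioms)
      fix x assume "x \<in> space riesz_measure"
      then have x: "x \<in> topspace X" by (simp add: space_riesz_measure)
      \<comment> \<open>Counts the \<open>k\<close> below \<open>m\<close> with
        \<open>k < n f x\<close>; rounding up costs at most 1.\<close>
      have "(\<Sum>k<m. indicator (U k) x :: real) \<le> min (real m) (real n * f x + 1)" for m
      proof (induction m)
        case 0
        then show ?case using f01[OF x] by simp
      next
        case (Suc m)
        have "x \<in> U m \<longleftrightarrow> real m < real n * f x"
          using x n0 by (simp add: U_def field_simps)
        then have "indicator (U m) x = (if real m < real n * f x then 1 else (0::real))"
          by simp
        then show ?case using Suc by auto
      qed
      from this[of n] show "(\<Sum>k<n. indicator (U k) x) \<le> n * f x + 1" by simp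
    qed
    finally show ?thesis .
  qed
  also have "\<dots> = n * (\<integral>x. f x \<partial>riesz_measure) + 1"
    using continuous_map_integrable[OF compact f sets_riesz_measure finite_measure_axioms]
    by (simp add: prob_space)
  finally have "n * L f \<le> n * (\<integral>x. f x \<partial>riesz_measure) + n * e" using n by simp
  then have "n * L f \<le> n * ((\<integral>x. f x \<partial>riesz_measure) + e)" by (simp add: distrib_left)
  then show "L f \<le> (\<integral>x. f x \<partial>riesz_measure) + e" using n0 by simp
qed

text \<open>The inequality for \<open>-f\<close> is the reverse inequality for \<open>f\<close>. An
  affine change moves \<open>f\<close> and \<open>-f\<close> into values between 0 and 1, where
  \<open>L_le_integral\<close> holds, and both sides respect constants and scaling.\<close>

theorem integral_riesz_measure:
  assumes f: "continuous_map X euclideanreal f"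
  shows "(\<integral>x. f x \<partial>riesz_measure) = L f"
proof -
  interpret prob_space riesz_measure by (rule prob_space_riesz_measure)
  obtain B where B: "0 < B" "\<And>x. x \<in> topspace X \<Longrightarrow> \<bar>f x\<bar> \<le> B"
    using continuous_map_bounded[OF compact f] by auto
  have int: "integrable riesz_measure f"
    by (rule continuous_map_integrable[OF compact f sets_riesz_measure finite_measure_axioms])
  have le: "L (\<lambda>x. c * f x) \<le> c * (\<integral>x. f x \<partial>riesz_measure)" if c: "\<bar>c\<bar> = 1" for c
  proof -
    let ?g = "\<lambda>x. 1/2 + (c / (2 * B)) * f x"
    have g: "continuous_map X euclideanreal ?g" by (intro continuous_intros f)
    have "0 \<le> ?g x \<and> ?g x \<le> 1" if "x \<in> topspace X" for x
    proof -
      have "\<bar>c * f x\<bar> \<le> B" using B(2)[OF that] c by (simp add: abs_mult)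
      then show ?thesis using B(1) by (auto simp: field_simps abs_le_iff)
    qed
    from L_le_integral[OF g this]
    have "1/2 + (c / (2 * B)) * L f \<le> 1/2 + (c / (2 * B)) * (\<integral>x. f x \<partial>riesz_measure)"
      using L_add[OF continuous_map_canonical_const continuous_map_real_mult_left[OF f], of "1/2" "c / (2 * B)"]
        L_scale[OF f, of "c / (2 * B)"] L_const int
      by (simp add: prob_space)
    then show ?thesis using B(1) L_scale[OF f, of c] by (simp add: field_simps)
  qed
  show ?thesis using le[of 1] le[of "-1"] L_scale[OF f, of "-1"] by simp
qed

end

section \<open>Bochner's theorem\<close>

lemma real_eqI_epsilon:
  fixes a b :: real
  assumes "\<And>e. 0 < e \<Longrightarrow> \<bar>a - b\<bar> \<le> c * e"
  shows "a = b"
proof (rule ccontr)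
  assume "a \<noteq> b"
  have "0 < \<bar>c\<bar> + 1" by simp
  have "\<bar>a - b\<bar> \<le> c * (\<bar>a - b\<bar> / (2 * (\<bar>c\<bar> + 1)))"
    using \<open>a \<noteq> b\<close> by (intro assms) simp
  also have "\<dots> \<le> (\<bar>c\<bar> + 1) * (\<bar>a - b\<bar> / (2 * (\<bar>c\<bar> + 1)))"
    by (intro mult_right_mono) auto
  also have "\<dots> = \<bar>a - b\<bar> / 2" using \<open>0 < \<bar>c\<bar> + 1\<close> by (simp add: field_simps)
  finally show False using \<open>a \<noteq> b\<close> by simp
qed

context comm_group
begin

sublocale dual_space: compact_Hausdorff "dual_topology G"
proof
  show "compact_space (dual_topology G)"
    unfolding dual_topology_eq using compact_dual by (simp add: compact_space_subtopology)
  have "Hausdorff_space (euclidean :: ('a \<Rightarrow> complex) topology)"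
    unfolding Hausdorff_space_def
  proof (intro allI impI)
    fix x y :: "'a \<Rightarrow> complex" assume "x \<in> topspace euclidean \<and> y \<in> topspace euclidean \<and> x \<noteq> y"
    then obtain U V where "open U" "open V" "x \<in> U" "y \<in> V" "U \<inter> V = {}"
      using hausdorff[of x y] by auto
    then show "\<exists>U V. openin euclidean U \<and> openin euclidean V \<and> x \<in> U \<and> y \<in> V \<and> disjnt U V"
      by (intro exI[of _ U] exI[of _ V]) (simp add: disjnt_def)
  qed
  then show "Hausdorff_space (dual_topology G)"
    unfolding dual_topology_eq by (rule Hausdorff_space_subtopology)
qed

lemma topspace_dual: "topspace (dual_topology G) = dual G"
  by (simp add: dual_topology_eq)

lemma continuous_map_dual_iff:
  "continuous_map (dual_topology G) euclidean f \<longleftrightarrow> continuous_on (dual G) f"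
  by (simp add: dual_topology_eq)

lemma continuous_eval: "continuous_map (dual_topology G) euclidean (\<lambda>\<psi>. \<psi> g)"
  unfolding continuous_map_dual_iff
  by (rule continuous_on_subset[OF continuous_on_product_coordinates]) simp

text \<open>An upper envelope: the extension is single-valued by construction, without choosing
  approximating sequences. For continuous \<open>f\<close> it is the limit of the values at
  \<open>\<phi>\<close> of polynomials that approximate \<open>f\<close> uniformly on the
  dual.\<close>

definition extend_state :: "('a \<Rightarrow> complex) \<Rightarrow> (('a \<Rightarrow> complex) \<Rightarrow> real) \<Rightarrow> real" where
  "extend_state \<phi> f = Inf {p \<phi> |p. p \<in> trig_polys G \<and> (\<forall>\<psi>\<in>dual G. f \<psi> \<le> p \<psi>)}"

lemma trig_poly_add_const:
  assumes "p \<in> trig_polys G"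
  obtains q where "q \<in> trig_polys G" "\<And>\<phi>. \<phi> \<one> = 1 \<Longrightarrow> q \<phi> = p \<phi> + r"
proof -
  obtain c where "c \<in> trig_polys G" "\<forall>\<phi>. \<phi> \<one> = 1 \<longrightarrow> c \<phi> = r"
    using trig_poly_const[of r] by blast
  then show thesis using that[of "\<lambda>\<phi>. p \<phi> + c \<phi>"] trig_polys.add[OF assms] by auto
qed

lemma trig_poly_diff:
  assumes "p \<in> trig_polys G" "q \<in> trig_polys G"
  shows "(\<lambda>\<phi>. p \<phi> - q \<phi>) \<in> trig_polys G"
  using trig_polys.add[OF assms(1) trig_poly_scale[OF assms(2), of "-1"]] by simp

text \<open>A polynomial \<open>q\<close> dominating \<open>f\<close> satisfies
  \<open>p - q \<le> e\<close> on the dual, hence at \<open>\<phi>\<close> by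
  \<open>state_le_sup_dual\<close>; and \<open>p + e\<close> itself dominates \<open>f\<close>. All
  properties of the extension come from this estimate.\<close>

lemma extend_state_approx:
  assumes \<phi>: "\<phi> \<in> states G" and p: "p \<in> trig_polys G"
    and e: "\<And>\<psi>. \<psi> \<in> dual G \<Longrightarrow> \<bar>f \<psi> - p \<psi>\<bar> \<le> e"
  shows "\<bar>extend_state \<phi> f - p \<phi>\<bar> \<le> e"
proof -
  let ?S = "{p \<phi> |p. p \<in> trig_polys G \<and> (\<forall>\<psi>\<in>dual G. f \<psi> \<le> p \<psi>)}"
  have lower: "p \<phi> - e \<le> y" if "y \<in> ?S" for y
  proof -
    obtain q where q: "y = q \<phi>" "q \<in> trig_polys G" "\<forall>\<psi>\<in>dual G. f \<psi> \<le> q \<psi>"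
      using \<open>y \<in> ?S\<close> by blast
    have "p \<psi> - q \<psi> \<le> e" if "\<psi> \<in> dual G" for \<psi>
      using e[OF that] q(3) that by (fastforce simp: abs_le_iff)
    from state_le_sup_dual[OF \<phi> trig_poly_diff[OF p q(2)] this] show ?thesis
      using q(1) by simp
  qed
  obtain q where q: "q \<in> trig_polys G" "\<And>\<phi>. \<phi> \<one> = 1 \<Longrightarrow> q \<phi> = p \<phi> + e"
    using trig_poly_add_const[OF p] by metis
  have "f \<psi> \<le> q \<psi>" if "\<psi> \<in> dual G" for \<psi>
    using e[OF that] q(2)[of \<psi>] dual_one[OF that] by (simp add: abs_le_iff)
  then have mem: "q \<phi> \<in> ?S" using q(1) by blast
  have "bdd_below ?S" using lower by (rule bdd_belowI)
  then have "Inf ?S \<le> q \<phi>" using mem by (intro cInf_lower)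
  moreover have "p \<phi> - e \<le> Inf ?S" using mem lower by (intro cInf_greatest) auto
  moreover have "q \<phi> = p \<phi> + e" using \<phi> by (intro q(2)) (simp add: states_def)
  ultimately show ?thesis unfolding extend_state_def by (simp add: abs_le_iff)
qed

lemma extend_state_trig_poly:
  "\<phi> \<in> states G \<Longrightarrow> p \<in> trig_polys G \<Longrightarrow> extend_state \<phi> p = p \<phi>"
  using extend_state_approx[of \<phi> p p 0] by simp

text \<open>Linearity is exact on polynomials, and order between polynomials passes from the dual to
  \<open>\<phi>\<close>; both reach continuous functions with an error that is a fixed multiple of
  \<open>e\<close>.\<close>

lemma riesz_functional_extend_state:
  assumes \<phi>: "\<phi> \<in> states G"
  shows "riesz_functional (dual_topology G) (extend_state \<phi>)"
proof (unfold_locales, unfold continuous_map_dual_iff topspace_dual)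
  fix f g :: "('a \<Rightarrow> complex) \<Rightarrow> real" and c :: real
  assume f: "continuous_on (dual G) f"
  show "extend_state \<phi> (\<lambda>x. c * f x) = c * extend_state \<phi> f"
  proof (rule real_eqI_epsilon)
    fix e :: real assume "0 < e"
    obtain p where p: "p \<in> trig_polys G" "\<And>\<psi>. \<psi> \<in> dual G \<Longrightarrow> \<bar>f \<psi> - p \<psi>\<bar> < e"
      using trig_polys_dense[OF f \<open>0 < e\<close>] by blast
    have "\<bar>c * f \<psi> - c * p \<psi>\<bar> \<le> \<bar>c\<bar> * e" if "\<psi> \<in> dual G" for \<psi>
      using p(2)[OF that] by (simp add: abs_mult mult_left_mono flip: right_diff_distrib)
    then have "\<bar>extend_state \<phi> (\<lambda>x. c * f x) - c * p \<phi>\<bar> \<le> \<bar>c\<bar> * e"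
      by (rule extend_state_approx[OF \<phi> trig_poly_scale[OF p(1)]])
    moreover have "\<bar>extend_state \<phi> f - p \<phi>\<bar> \<le> e"
      using p(2) by (intro extend_state_approx[OF \<phi> p(1)] less_imp_le)
    then have "\<bar>c * extend_state \<phi> f - c * p \<phi>\<bar> \<le> \<bar>c\<bar> * e"
      by (simp add: abs_mult mult_left_mono flip: right_diff_distrib)
    ultimately show "\<bar>extend_state \<phi> (\<lambda>x. c * f x) - c * extend_state \<phi> f\<bar> \<le> (2 * \<bar>c\<bar>) * e"
      by linarith
  qed
  assume g: "continuous_on (dual G) g"
  have approx: "\<exists>p q. p \<in> trig_polys G \<and> q \<in> trig_polys G \<and>
    (\<forall>\<psi>\<in>dual G. \<bar>f \<psi> - p \<psi>\<bar> \<le> e \<and> \<bar>g \<psi> - q \<psi>\<bar> \<le> e) \<and>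
    \<bar>extend_state \<phi> f - p \<phi>\<bar> \<le> e \<and> \<bar>extend_state \<phi> g - q \<phi>\<bar> \<le> e" if "0 < e" for e
  proof -
    obtain p where p: "p \<in> trig_polys G" "\<And>\<psi>. \<psi> \<in> dual G \<Longrightarrow> \<bar>f \<psi> - p \<psi>\<bar> < e"
      using trig_polys_dense[OF f \<open>0 < e\<close>] by blast
    obtain q where q: "q \<in> trig_polys G" "\<And>\<psi>. \<psi> \<in> dual G \<Longrightarrow> \<bar>g \<psi> - q \<psi>\<bar> < e"
      using trig_polys_dense[OF g \<open>0 < e\<close>] by blast
    show ?thesis
      using p q extend_state_approx[OF \<phi> p(1), of f e] extend_state_approx[OF \<phi> q(1), of g e]
      by (intro exI[of _ p] exI[of _ q]) (simp add: less_imp_le)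
  qed
  show "extend_state \<phi> (\<lambda>x. f x + g x) = extend_state \<phi> f + extend_state \<phi> g"
  proof (rule real_eqI_epsilon)
    fix e :: real assume "0 < e"
    then obtain p q where pq: "p \<in> trig_polys G" "q \<in> trig_polys G"
      "\<And>\<psi>. \<psi> \<in> dual G \<Longrightarrow> \<bar>f \<psi> - p \<psi>\<bar> \<le> e \<and> \<bar>g \<psi> - q \<psi>\<bar> \<le> e"
      "\<bar>extend_state \<phi> f - p \<phi>\<bar> \<le> e" "\<bar>extend_state \<phi> g - q \<phi>\<bar> \<le> e"
      using approx[OF \<open>0 < e\<close>] by auto
    have "\<bar>(f \<psi> + g \<psi>) - (p \<psi> + q \<psi>)\<bar> \<le> 2 * e" if "\<psi> \<in> dual G" for \<psi>
      using pq(3)[OF that] by linarith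
    then have "\<bar>extend_state \<phi> (\<lambda>x. f x + g x) - (p \<phi> + q \<phi>)\<bar> \<le> 2 * e"
      by (rule extend_state_approx[OF \<phi> trig_polys.add[OF pq(1,2)]])
    then show "\<bar>extend_state \<phi> (\<lambda>x. f x + g x) - (extend_state \<phi> f + extend_state \<phi> g)\<bar> \<le> 4 * e"
      using pq(4,5) by linarith
  qed
  assume le: "\<And>x. x \<in> dual G \<Longrightarrow> f x \<le> g x"
  show "extend_state \<phi> f \<le> extend_state \<phi> g"
  proof (rule field_le_epsilon)
    fix d :: real assume "0 < d"
    \<comment> \<open>Four errors: two from \<open>p - q\<close> on the dual, one each from passing
      between \<open>f\<close>, \<open>g\<close> and their polynomials at
      \<open>\<phi>\<close>.\<close>
    define e where "e = d / 4"
    have "0 < e" "d = 4 * e" using \<open>0 < d\<close> by (simp_all add: e_def)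
    then obtain p q where pq: "p \<in> trig_polys G" "q \<in> trig_polys G"
      "\<And>\<psi>. \<psi> \<in> dual G \<Longrightarrow> \<bar>f \<psi> - p \<psi>\<bar> \<le> e \<and> \<bar>g \<psi> - q \<psi>\<bar> \<le> e"
      "\<bar>extend_state \<phi> f - p \<phi>\<bar> \<le> e" "\<bar>extend_state \<phi> g - q \<phi>\<bar> \<le> e"
      using approx[OF \<open>0 < e\<close>] by auto
    have "p \<psi> - q \<psi> \<le> 2 * e" if "\<psi> \<in> dual G" for \<psi>
      using pq(3)[OF that] le[OF that] by linarith
    then have "p \<phi> - q \<phi> \<le> 2 * e"
      by (rule state_le_sup_dual[OF \<phi> trig_poly_diff[OF pq(1,2)]])
    then show "extend_state \<phi> f \<le> extend_state \<phi> g + d"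
      using pq(4,5) \<open>d = 4 * e\<close> by linarith
  qed
next
  obtain c where c: "c \<in> trig_polys G" "\<And>\<phi>. \<phi> \<one> = 1 \<Longrightarrow> c \<phi> = 1"
    using trig_poly_const[of 1] by blast
  have "\<bar>extend_state \<phi> (\<lambda>_. 1) - c \<phi>\<bar> \<le> 0"
    by (rule extend_state_approx[OF \<phi> c(1)]) (simp add: c(2) dual_one)
  moreover have "c \<phi> = 1" using \<phi> by (intro c(2)) (simp add: states_def)
  ultimately show "extend_state \<phi> (\<lambda>_. 1) = 1" by simp
qed

lemma integrable_eval:
  "regular_borel_prob (dual_topology G) M \<Longrightarrow> integrable M (\<lambda>\<psi>. \<psi> g)"
  by (rule continuous_map_integrable[OF dual_space.compact continuous_eval])
    (auto simp: regular_borel_prob_def prob_space.finite_measure)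

theorem Bochner:
  assumes \<phi>: "\<phi> \<in> states G"
  obtains M where "regular_borel_prob (dual_topology G) M"
    "\<And>g. g \<in> carrier G \<Longrightarrow> (\<integral>\<psi>. \<psi> g \<partial>M) = \<phi> g"
proof -
  interpret riesz_functional "dual_topology G" "extend_state \<phi>"
    by (rule riesz_functional_extend_state[OF \<phi>])
  note reg = regular_riesz_measure
  have int: "(\<integral>\<psi>. Re (c * \<psi> g) \<partial>riesz_measure) = Re (c * \<phi> g)" if g: "g \<in> carrier G" for c g
    using integral_riesz_measure[of "\<lambda>\<psi>. Re (c * \<psi> g)"]
      continuous_trig_poly[OF trig_polys.monomial[OF g]]
      extend_state_trig_poly[OF \<phi> trig_polys.monomial[OF g]]
    by (simp only: continuous_map_dual_iff)
  show thesis
  proof (rule that[OF reg])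
    fix g assume g: "g \<in> carrier G"
    have "Re (\<integral>\<psi>. \<psi> g \<partial>riesz_measure) = Re (\<phi> g)" "Im (\<integral>\<psi>. \<psi> g \<partial>riesz_measure) = Im (\<phi> g)"
      using int[OF g, of 1] int[OF g, of "-\<i>"] integrable_eval[OF reg, of g]
      by (simp_all add: integral_Re integral_Im)
    then show "(\<integral>\<psi>. \<psi> g \<partial>riesz_measure) = \<phi> g" by (simp add: complex_eq_iff)
  qed
qed

text \<open>Equal Fourier coefficients give equal integrals of polynomials, and by uniform density
  equal integrals of all continuous functions; regularity does the rest.\<close>

theorem Fourier_unique:
  assumes M: "regular_borel_prob (dual_topology G) M" and N: "regular_borel_prob (dual_topology G) N"
    and eq: "\<And>g. g \<in> carrier G \<Longrightarrow> (\<integral>\<psi>. \<psi> g \<partial>M) = (\<integral>\<psi>. \<psi> g \<partial>N)"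
  shows "M = N"
proof (rule dual_space.regular_measure_unique[OF M N])
  fix f assume f: "continuous_map (dual_topology G) euclideanreal f"
  interpret M: prob_space M using M by (simp add: regular_borel_prob_def)
  interpret N: prob_space N using N by (simp add: regular_borel_prob_def)
  have int: "integrable M h" "integrable N h" if "continuous_on (dual G) h" for h :: "_ \<Rightarrow> real"
    using that M N unfolding continuous_map_dual_iff[symmetric]
    by (auto intro!: continuous_map_integrable[OF dual_space.compact] M.finite_measure_axioms
        N.finite_measure_axioms simp: regular_borel_prob_def)
  have sM: "space M = dual G" and sN: "space N = dual G"
    using regular_borel_prob_space[OF M] regular_borel_prob_space[OF N] topspace_dual by auto
  have poly: "(\<integral>\<psi>. p \<psi> \<partial>M) = (\<integral>\<psi>. p \<psi> \<partial>N)" if "p \<in> trig_polys G" for p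
    using that
  proof (induction rule: trig_polys.induct)
    case (monomial g c)
    show ?case using eq[OF monomial] integrable_eval[OF M, of g] integrable_eval[OF N, of g]
      by (simp del: times_complex.sel add: integral_Re)
  next
    case (add p q)
    show ?case
      using add int[OF continuous_trig_poly[OF add(1)]] int[OF continuous_trig_poly[OF add(2)]]
      by simp
  qed
  have f': "continuous_on (dual G) f" using f by (simp only: continuous_map_dual_iff)
  show "(\<integral>x. f x \<partial>M) = (\<integral>x. f x \<partial>N)"
  proof (rule real_eqI_epsilon)
    fix e :: real assume "0 < e"
    obtain p where p: "p \<in> trig_polys G" "\<And>\<psi>. \<psi> \<in> dual G \<Longrightarrow> \<bar>f \<psi> - p \<psi>\<bar> < e"
      using trig_polys_dense[OF f' \<open>0 < e\<close>] by blast
    note ip = int[OF continuous_trig_poly[OF p(1)]] and jf = int[OF f']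
    have le: "\<bar>(\<integral>x. f x \<partial>M) - (\<integral>x. p x \<partial>M)\<bar> \<le> e" "\<bar>(\<integral>x. f x \<partial>N) - (\<integral>x. p x \<partial>N)\<bar> \<le> e"
    proof -
      have "\<bar>\<integral>x. f x - p x \<partial>M\<bar> \<le> (\<integral>x. e \<partial>M)"
        using p(2) ip jf sM
        by (intro order_trans[OF integral_abs_bound] integral_mono) (auto intro: less_imp_le)
      then show "\<bar>(\<integral>x. f x \<partial>M) - (\<integral>x. p x \<partial>M)\<bar> \<le> e" using ip jf by (simp add: M.prob_space)
      have "\<bar>\<integral>x. f x - p x \<partial>N\<bar> \<le> (\<integral>x. e \<partial>N)"
        using p(2) ip jf sN
        by (intro order_trans[OF integral_abs_bound] integral_mono) (auto intro: less_imp_le)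
      then show "\<bar>(\<integral>x. f x \<partial>N) - (\<integral>x. p x \<partial>N)\<bar> \<le> e" using ip jf by (simp add: N.prob_space)
    qed
    then show "\<bar>(\<integral>x. f x \<partial>M) - (\<integral>x. f x \<partial>N)\<bar> \<le> 2 * e"
      using poly[OF p(1)] by linarith
  qed
qed

end

section \<open>Hilbert space basics\<close>

lemma scaleC_minus_one: "scaleC (-1) (v::'h::complex_hilbert_space) = - v"
  using scaleC_of_real[of "-1" v] by simp

lemma cinner_zero_left [simp]: "cinner 0 (y::'h::complex_hilbert_space) = 0"
  using cinner_add_left[of 0 0 y] by simp

lemma cinner_add_right: "cinner (x::'h::complex_hilbert_space) (y + z) = cinner x y + cinner x z"
  by (subst (1 2 3) cinner_commute) (simp add: cinner_add_left)

lemma cinner_scaleC_right: "cinner (x::'h::complex_hilbert_space) (scaleC a y) = cnj a * cinner x y"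
  by (subst (1 2) cinner_commute) (simp add: cinner_scaleC_left)

lemma cinner_diff_left: "cinner (x - y) (z::'h::complex_hilbert_space) = cinner x z - cinner y z"
  using cinner_add_left[of "x - y" y z] by simp

lemma cinner_self_eq_zero: "cinner x x = 0 \<longleftrightarrow> (x::'h::complex_hilbert_space) = 0"
  by (simp add: cinner_self)

text \<open>Polarisation: continuity of the inner product, and its preservation by an isometric
  correspondence, reduce to statements about norms.\<close>

lemma Re_cinner:
  "Re (cinner x (y::'h::complex_hilbert_space)) = ((norm (x + y))\<^sup>2 - (norm x)\<^sup>2 - (norm y)\<^sup>2) / 2"
proof -
  have "cinner (x + y) (x + y) = cinner x x + cinner y y + (cinner x y + cnj (cinner x y))"
    using cinner_commute[of y x] by (simp add: cinner_add_left cinner_add_right)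
  then have "complex_of_real ((norm (x + y))\<^sup>2) =
      of_real ((norm x)\<^sup>2 + (norm y)\<^sup>2 + 2 * Re (cinner x y))"
    unfolding cinner_self by (simp add: complex_eq_iff)
  then show ?thesis by (simp only: of_real_eq_iff) simp
qed

lemma Im_cinner: "Im (cinner x (y::'h::complex_hilbert_space)) = Re (cinner x (scaleC \<i> y))"
  by (simp add: cinner_scaleC_right)

lemma tendsto_cinner_left:
  fixes v :: "'h::complex_hilbert_space"
  assumes "(f \<longlongrightarrow> v) F"
  shows "((\<lambda>n. cinner (f n) w) \<longlongrightarrow> cinner v w) F"
proof -
  have "((\<lambda>n. Re (cinner (f n) u)) \<longlongrightarrow> Re (cinner v u)) F" for u
    unfolding Re_cinner by (intro tendsto_intros assms) simp
  then show ?thesis by (simp add: tendsto_complex_iff Im_cinner)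
qed

lemma closed_cinner_eq_zero: "closed {v::'h::complex_hilbert_space. cinner v w = 0}"
proof (unfold closed_sequential_limits, intro allI impI)
  fix x v assume "(\<forall>n. x n \<in> {v. cinner v w = 0}) \<and> x \<longlonglongrightarrow> v"
  then show "v \<in> {v::'h. cinner v w = 0}"
    using tendsto_cinner_left[of x v sequentially w] by (simp add: LIMSEQ_const_iff)
qed

lemma unitaryD:
  assumes "unitary U"
  shows "U (x + y) = U x + U y" "U (scaleC a x) = scaleC a (U x)" "cinner (U x) (U y) = cinner x y"
  using assms by (auto simp: unitary_def)

section \<open>Square-integrable functions\<close>

abbreviation L2_norm2 :: "'x measure \<Rightarrow> ('x \<Rightarrow> complex) \<Rightarrow> real" where
  "L2_norm2 M f \<equiv> \<integral>x. (cmod (f x))\<^sup>2 \<partial>M"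

abbreviation L2_dist2 :: "'x measure \<Rightarrow> ('x \<Rightarrow> complex) \<Rightarrow> ('x \<Rightarrow> complex) \<Rightarrow> real" where
  "L2_dist2 M f g \<equiv> \<integral>x. (cmod (f x - g x))\<^sup>2 \<partial>M"

lemma borel_measurable_cnj [measurable]: "cnj \<in> borel_measurable borel"
  by (intro borel_measurable_continuous_onI continuous_intros)

lemma L2_funD:
  assumes "f \<in> L2_fun M"
  shows "f \<in> borel_measurable M" "integrable M (\<lambda>x. (cmod (f x))\<^sup>2)"
  using assms by (auto simp: L2_fun_def)

lemma L2_fun_bound:
  assumes f: "f \<in> L2_fun M" and g: "g \<in> borel_measurable M"
    and le: "AE x in M. cmod (g x) \<le> c * cmod (f x)"
  shows "g \<in> L2_fun M"
proof -
  have "integrable M (\<lambda>x. (cmod (g x))\<^sup>2)"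
  proof (rule Bochner_Integration.integrable_bound)
    show "integrable M (\<lambda>x. c\<^sup>2 * (cmod (f x))\<^sup>2)" using L2_funD(2)[OF f] by simp
    show "AE x in M. norm ((cmod (g x))\<^sup>2) \<le> norm (c\<^sup>2 * (cmod (f x))\<^sup>2)"
      using le
    proof eventually_elim
      case (elim x)
      then have "(cmod (g x))\<^sup>2 \<le> (c * cmod (f x))\<^sup>2" by (rule power_mono) simp
      then show ?case by (simp add: power_mult_distrib)
    qed
  qed (use g in measurable)
  then show ?thesis using g by (simp add: L2_fun_def)
qed

lemma L2_fun_scale: "f \<in> L2_fun M \<Longrightarrow> (\<lambda>x. a * f x) \<in> L2_fun M"
  by (rule L2_fun_bound[of f _ _ "cmod a"]) (auto simp: norm_mult dest: L2_funD(1))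

lemma norm_add_squared_le: "(norm (a + b))\<^sup>2 \<le> 2 * (norm a)\<^sup>2 + 2 * (norm (b::'b::real_normed_vector))\<^sup>2"
proof -
  have "(norm (a + b))\<^sup>2 \<le> (norm a + norm b)\<^sup>2" by (intro power_mono norm_triangle_ineq) simp
  also have "\<dots> \<le> 2 * (norm a)\<^sup>2 + 2 * (norm b)\<^sup>2"
    using sum_squares_bound[of "norm a" "norm b"] by (simp add: power2_sum)
  finally show ?thesis .
qed

lemma L2_fun_add:
  assumes "f \<in> L2_fun M" "g \<in> L2_fun M"
  shows "(\<lambda>x. f x + g x) \<in> L2_fun M"
proof -
  note [measurable] = L2_funD(1)[OF assms(1)] L2_funD(1)[OF assms(2)]
  have "integrable M (\<lambda>x. (cmod (f x + g x))\<^sup>2)"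
    by (rule Bochner_Integration.integrable_bound[where f="\<lambda>x. 2 * (cmod (f x))\<^sup>2 + 2 * (cmod (g x))\<^sup>2"])
      (use L2_funD(2)[OF assms(1)] L2_funD(2)[OF assms(2)] norm_add_squared_le in auto)
  then show ?thesis by (simp add: L2_fun_def)
qed

lemma L2_fun_diff: "f \<in> L2_fun M \<Longrightarrow> g \<in> L2_fun M \<Longrightarrow> (\<lambda>x. f x - g x) \<in> L2_fun M"
  using L2_fun_add[OF _ L2_fun_scale[of g M "-1"]] by simp

lemma L2_mult_integrable:
  assumes "f \<in> L2_fun M" "g \<in> L2_fun M"
  shows "integrable M (\<lambda>x. f x * cnj (g x))"
proof -
  note [measurable] = L2_funD(1)[OF assms(1)] L2_funD(1)[OF assms(2)]
  have le: "cmod (f x * cnj (g x)) \<le> (cmod (f x))\<^sup>2 + (cmod (g x))\<^sup>2" for x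
    using sum_squares_bound[of "cmod (f x)" "cmod (g x)"]
      mult_nonneg_nonneg[OF norm_ge_zero[of "f x"] norm_ge_zero[of "g x"]]
    unfolding norm_mult complex_mod_cnj by linarith
  show ?thesis
  proof (rule Bochner_Integration.integrable_bound)
    show "integrable M (\<lambda>x. (cmod (f x))\<^sup>2 + (cmod (g x))\<^sup>2)"
      by (intro Bochner_Integration.integrable_add L2_funD(2) assms)
    show "AE x in M. norm (f x * cnj (g x)) \<le> norm ((cmod (f x))\<^sup>2 + (cmod (g x))\<^sup>2)"
      using le by simp
  qed measurable
qed

text \<open>The discriminant argument is run for the moduli, so that the parameter \<open>t\<close>
  and the cross term \<open>C\<close> are real; the modulus of the integral is at most
  \<open>C\<close>.\<close>

lemma L2_Cauchy_Schwarz: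
  assumes f: "f \<in> L2_fun M" and g: "g \<in> L2_fun M"
  shows "(cmod (\<integral>x. f x * cnj (g x) \<partial>M))\<^sup>2 \<le> L2_norm2 M f * L2_norm2 M g"
proof -
  define A B C where "A = L2_norm2 M f" and "B = L2_norm2 M g"
    and "C = (\<integral>x. cmod (f x * cnj (g x)) \<partial>M)"
  have int: "integrable M (\<lambda>x. cmod (f x * cnj (g x)))"
    by (rule integrable_norm[OF L2_mult_integrable[OF f g]])
  have q: "0 \<le> t\<^sup>2 * A - 2 * t * C + B" for t
  proof -
    have "0 \<le> (\<integral>x. (t * cmod (f x) - cmod (g x))\<^sup>2 \<partial>M)" by (rule integral_nonneg_AE) simp
    also have "\<dots> = (\<integral>x. t\<^sup>2 * (cmod (f x))\<^sup>2 - 2 * t * cmod (f x * cnj (g x)) + (cmod (g x))\<^sup>2 \<partial>M)"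
      by (intro Bochner_Integration.integral_cong) (simp_all add: power2_diff norm_mult power_mult_distrib)
    also have "\<dots> = t\<^sup>2 * A - 2 * t * C + B"
      unfolding A_def B_def C_def using int L2_funD(2)[OF f] L2_funD(2)[OF g] by simp
    finally show ?thesis .
  qed
  have AB: "0 \<le> A" "0 \<le> B" "0 \<le> C"
    unfolding A_def B_def C_def by (auto intro: integral_nonneg_AE)
  have "C\<^sup>2 \<le> A * B"
  proof (cases "A = 0")
    case True
    have "C = 0"
    proof (rule ccontr)
      assume "C \<noteq> 0"
      \<comment> \<open>With \<open>A = 0\<close> the quadratic is linear in \<open>t\<close>, and
        at this \<open>t\<close> its value is -1.\<close>
      with q[of "(B + 1) / (2 * C)"] True show False by (simp add: field_simps)
    qed
    then show ?thesis using AB by simp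
  next
    case False
    then have "0 < A" using AB by simp
    with q[of "C / A"] show ?thesis by (simp add: field_simps power2_eq_square)
  qed
  moreover have "cmod (\<integral>x. f x * cnj (g x) \<partial>M) \<le> C" unfolding C_def by (rule integral_norm_bound)
  then have "(cmod (\<integral>x. f x * cnj (g x) \<partial>M))\<^sup>2 \<le> C\<^sup>2" by (rule power_mono) simp
  ultimately show ?thesis unfolding A_def B_def by linarith
qed

lemma L2_tendsto_inner:
  assumes F: "\<And>n. F n \<in> L2_fun M" and f: "f \<in> L2_fun M" and g: "g \<in> L2_fun M"
    and lim: "(\<lambda>n. L2_dist2 M (F n) f) \<longlonglongrightarrow> 0"
  shows "(\<lambda>n. \<integral>x. F n x * cnj (g x) \<partial>M) \<longlonglongrightarrow> (\<integral>x. f x * cnj (g x) \<partial>M)"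
proof -
  let ?d = "\<lambda>n. (\<integral>x. F n x * cnj (g x) \<partial>M) - (\<integral>x. f x * cnj (g x) \<partial>M)"
  have le: "(cmod (?d n))\<^sup>2 \<le> L2_dist2 M (F n) f * L2_norm2 M g" for n
  proof -
    have "?d n = (\<integral>x. (F n x - f x) * cnj (g x) \<partial>M)"
      using L2_mult_integrable[OF F g, of n] L2_mult_integrable[OF f g]
      by (simp add: left_diff_distrib)
    then show ?thesis using L2_Cauchy_Schwarz[OF L2_fun_diff[OF F f] g, of n] by simp
  qed
  have "(\<lambda>n. (cmod (?d n))\<^sup>2) \<longlonglongrightarrow> 0"
  proof (rule tendsto_sandwich[OF _ _ tendsto_const])
    show "(\<lambda>n. L2_dist2 M (F n) f * L2_norm2 M g) \<longlonglongrightarrow> 0"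
      using tendsto_mult_right[OF lim] by simp
  qed (use le in auto)
  then have "(\<lambda>n. sqrt ((cmod (?d n))\<^sup>2)) \<longlonglongrightarrow> sqrt 0" by (rule tendsto_real_sqrt)
  then have "?d \<longlonglongrightarrow> 0" by (simp add: tendsto_norm_zero_iff)
  then show ?thesis by (simp add: LIM_zero_iff)
qed

text \<open>Expanding the squared norm around \<open>f\<close> leaves the distance, which tends to
  0, and a cross term controlled by \<open>L2_tendsto_inner\<close>.\<close>

lemma L2_tendsto_norm:
  assumes F: "\<And>n. F n \<in> L2_fun M" and f: "f \<in> L2_fun M"
    and lim: "(\<lambda>n. L2_dist2 M (F n) f) \<longlonglongrightarrow> 0"
  shows "(\<lambda>n. L2_norm2 M (F n)) \<longlonglongrightarrow> L2_norm2 M f"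
proof -
  have eq: "L2_norm2 M (F n) = L2_dist2 M (F n) f
      + 2 * Re ((\<integral>x. F n x * cnj (f x) \<partial>M) - (\<integral>x. f x * cnj (f x) \<partial>M)) + L2_norm2 M f" for n
  proof -
    have pw: "(cmod a)\<^sup>2 = (cmod (a - b))\<^sup>2 + 2 * Re ((a - b) * cnj b) + (cmod b)\<^sup>2" for a b :: complex
      by (simp only: cmod_power2) (simp add: power2_eq_square algebra_simps)
    have i: "integrable M (\<lambda>x. (F n x - f x) * cnj (f x))"
      by (rule L2_mult_integrable[OF L2_fun_diff[OF F f] f])
    have "L2_norm2 M (F n) =
        (\<integral>x. (cmod (F n x - f x))\<^sup>2 + 2 * Re ((F n x - f x) * cnj (f x)) + (cmod (f x))\<^sup>2 \<partial>M)"
      by (intro Bochner_Integration.integral_cong refl pw)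
    also have "\<dots> = L2_dist2 M (F n) f
        + 2 * (\<integral>x. Re ((F n x - f x) * cnj (f x)) \<partial>M) + L2_norm2 M f"
      using L2_funD(2)[OF L2_fun_diff[OF F f], of n] L2_funD(2)[OF f] integrable_Re[OF i]
      by (simp del: times_complex.sel)
    also have "(\<integral>x. Re ((F n x - f x) * cnj (f x)) \<partial>M) = Re (\<integral>x. (F n x - f x) * cnj (f x) \<partial>M)"
      by (rule integral_Re[OF i])
    also have "(\<integral>x. (F n x - f x) * cnj (f x) \<partial>M) =
        (\<integral>x. F n x * cnj (f x) \<partial>M) - (\<integral>x. f x * cnj (f x) \<partial>M)"
      using L2_mult_integrable[OF F f, of n] L2_mult_integrable[OF f f]
      by (simp add: left_diff_distrib)
    finally show ?thesis .
  qed
  have "(\<lambda>n. (\<integral>x. F n x * cnj (f x) \<partial>M) - (\<integral>x. f x * cnj (f x) \<partial>M)) \<longlonglongrightarrow> 0"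
    using L2_tendsto_inner[OF F f f lim] by (simp add: LIM_zero_iff)
  from tendsto_add[OF tendsto_add[OF lim tendsto_mult[OF tendsto_const[of 2] tendsto_Re[OF this]]] tendsto_const]
  show ?thesis unfolding eq by simp
qed

lemma L2_zero_iff:
  assumes "f \<in> L2_fun M"
  shows "L2_norm2 M f = 0 \<longleftrightarrow> (AE x in M. f x = 0)"
  by (subst integral_nonneg_eq_0_iff_AE[OF L2_funD(2)[OF assms]]) auto

text \<open>Riesz-Fischer at a geometric rate. On a probability space the mean of \<open>D n\<close>
  is at most the square root of the mean of its square, so the increments are summable almost
  everywhere and the sequence telescopes to a limit. Fatou's lemma returns the distance
  bound.\<close>

theorem L2_complete:
  assumes M: "prob_space M" and F: "\<And>n. F n \<in> L2_fun M"
    and C: "\<And>m n. n \<le> m \<Longrightarrow> L2_dist2 M (F n) (F m) \<le> (1/4) ^ n"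
  obtains f where "f \<in> L2_fun M" "\<And>n. L2_dist2 M (F n) f \<le> (1/4) ^ n"
proof -
  interpret prob_space M by fact
  note [measurable] = L2_funD(1)[OF F]
  define D where "D n x = cmod (F n x - F (Suc n) x)" for n x
  have D2: "integrable M (\<lambda>x. (D n x)\<^sup>2)" for n
    unfolding D_def using L2_funD(2)[OF L2_fun_diff[OF F F]] .
  have one: "(\<lambda>_. 1) \<in> L2_fun M" by (simp add: L2_fun_def)
  have D: "(\<lambda>x. complex_of_real (D n x)) \<in> L2_fun M" for n
    using D2 unfolding L2_fun_def D_def by simp
  have D1: "integrable M (D n)" for n
    using integrable_Re[OF L2_mult_integrable[OF D one]] by simp
  have Dle: "(\<integral>x. D n x \<partial>M) \<le> (1/2) ^ n" for n
  proof -
    have "(\<integral>x. D n x \<partial>M)\<^sup>2 \<le> (\<integral>x. (D n x)\<^sup>2 \<partial>M)"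
      using L2_Cauchy_Schwarz[OF D one, of n] by (simp add: prob_space)
    also have "\<dots> \<le> (1/4) ^ n" unfolding D_def by (rule C) simp
    also have "\<dots> = ((1/2) ^ n)\<^sup>2" by (simp add: power_mult[symmetric] power2_eq_square flip: power_mult_distrib)
    finally show ?thesis by (rule power2_le_imp_le) simp
  qed
  have "(\<integral>\<^sup>+x. (\<Sum>n. ennreal (D n x)) \<partial>M) = (\<Sum>n. \<integral>\<^sup>+x. ennreal (D n x) \<partial>M)"
    by (rule nn_integral_suminf) (simp add: D_def)
  also have "\<dots> \<le> (\<Sum>n. ennreal ((1/2) ^ n))"
  proof (intro suminf_le)
    fix n
    have "(\<integral>\<^sup>+x. ennreal (D n x) \<partial>M) = ennreal (\<integral>x. D n x \<partial>M)"
      by (rule nn_integral_eq_integral[OF D1]) (simp add: D_def)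
    then show "(\<integral>\<^sup>+x. ennreal (D n x) \<partial>M) \<le> ennreal ((1/2) ^ n)" using Dle[of n] by (simp add: ennreal_leI)
  qed auto
  also have "\<dots> = ennreal (\<Sum>n. (1/2) ^ n)" by (rule suminf_ennreal2) (auto simp: summable_geometric)
  also have "\<dots> < \<infinity>" by simp
  finally have fin: "(\<integral>\<^sup>+x. (\<Sum>n. ennreal (D n x)) \<partial>M) \<noteq> \<infinity>" by simp
  have AEfin: "AE x in M. (\<Sum>n. ennreal (D n x)) \<noteq> \<infinity>"
    by (rule nn_integral_PInf_AE[OF _ fin]) (simp add: D_def)
  define f where "f x = lim (\<lambda>n. F n x)" for x
  have [measurable]: "f \<in> borel_measurable M" unfolding f_def by measurable
  have AEf: "AE x in M. (\<lambda>n. F n x) \<longlonglongrightarrow> f x"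
    using AEfin
  proof eventually_elim
    case (elim x)
    then have "summable (\<lambda>n. D n x)" by (intro summable_suminf_not_top) (auto simp: D_def)
    then have "summable (\<lambda>n. F n x - F (Suc n) x)" unfolding D_def by (rule summable_norm_cancel)
    then have "(\<lambda>n. \<Sum>i<n. F i x - F (Suc i) x) \<longlonglongrightarrow> (\<Sum>i. F i x - F (Suc i) x)"
      by (rule summable_LIMSEQ)
    moreover have "(\<Sum>i<n. F i x - F (Suc i) x) = F 0 x - F n x" for n
      using sum_lessThan_telescope'[of "\<lambda>i. F i x" n] by simp
    ultimately have "(\<lambda>n. F 0 x - F n x) \<longlonglongrightarrow> (\<Sum>i. F i x - F (Suc i) x)"
      by simp
    from tendsto_diff[OF tendsto_const this, of "F 0 x"] have "convergent (\<lambda>n. F n x)"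
      by (auto simp: convergent_def)
    then show ?case unfolding f_def by (simp add: convergent_LIMSEQ_iff)
  qed
  have bound: "(\<integral>\<^sup>+x. ennreal ((cmod (F n x - f x))\<^sup>2) \<partial>M) \<le> ennreal ((1/4) ^ n)" for n
  proof -
    have "(\<integral>\<^sup>+x. ennreal ((cmod (F n x - f x))\<^sup>2) \<partial>M) =
        (\<integral>\<^sup>+x. liminf (\<lambda>m. ennreal ((cmod (F n x - F m x))\<^sup>2)) \<partial>M)"
    proof (rule nn_integral_cong_AE, use AEf in eventually_elim)
      case (elim x)
      have "(\<lambda>m. ennreal ((cmod (F n x - F m x))\<^sup>2)) \<longlonglongrightarrow> ennreal ((cmod (F n x - f x))\<^sup>2)"
        by (intro tendsto_intros tendsto_ennrealI elim)
      from lim_imp_Liminf[OF _ this] show ?case by simp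
    qed
    also have "\<dots> \<le> liminf (\<lambda>m. \<integral>\<^sup>+x. ennreal ((cmod (F n x - F m x))\<^sup>2) \<partial>M)"
      by (rule nn_integral_liminf) simp
    also have "\<dots> \<le> limsup (\<lambda>m. \<integral>\<^sup>+x. ennreal ((cmod (F n x - F m x))\<^sup>2) \<partial>M)"
      by (rule Liminf_le_Limsup) simp
    also have "\<dots> \<le> ennreal ((1/4) ^ n)"
    proof (rule Limsup_bounded, rule eventually_mono[OF eventually_ge_at_top[of n]])
      fix m assume "n \<le> m"
      have "(\<integral>\<^sup>+x. ennreal ((cmod (F n x - F m x))\<^sup>2) \<partial>M) = ennreal (L2_dist2 M (F n) (F m))"
        by (rule nn_integral_eq_integral[OF L2_funD(2)[OF L2_fun_diff[OF F F]]]) simp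
      then show "(\<integral>\<^sup>+x. ennreal ((cmod (F n x - F m x))\<^sup>2) \<partial>M) \<le> ennreal ((1/4) ^ n)"
        using C[OF \<open>n \<le> m\<close>] by (simp add: ennreal_leI)
    qed
    finally show ?thesis .
  qed
  have int: "integrable M (\<lambda>x. (cmod (F n x - f x))\<^sup>2)" for n
    by (rule integrableI_bounded) (use bound[of n] in \<open>auto simp: less_top[symmetric] top_unique\<close>)
  then have L2: "(\<lambda>x. F n x - f x) \<in> L2_fun M" for n by (simp add: L2_fun_def)
  have "f \<in> L2_fun M" using L2_fun_diff[OF F L2, of 0 0] by simp
  moreover have "L2_dist2 M (F n) f \<le> (1/4) ^ n" for n
    using bound[of n] nn_integral_eq_integral[OF int, of n] by simp
  ultimately show thesis using that by blast
qed

lemma L2_simple_approx: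
  assumes f: "f \<in> L2_fun M"
  obtains s where "\<And>n. simple_function M (s n)" "\<And>n. s n \<in> L2_fun M"
    "(\<lambda>n. L2_dist2 M (s n) f) \<longlonglongrightarrow> 0"
proof -
  note [measurable] = L2_funD(1)[OF f]
  obtain s where s: "\<And>i. simple_function M (s i)" "\<And>x. x \<in> space M \<Longrightarrow> (\<lambda>i. s i x) \<longlonglongrightarrow> f x"
    "\<And>i x. x \<in> space M \<Longrightarrow> dist (s i x) 0 \<le> 2 * dist (f x) 0"
    using borel_measurable_implies_sequence_metric[OF L2_funD(1)[OF f], of 0] by blast
  have sm [measurable]: "s i \<in> borel_measurable M" for i
    using borel_measurable_simple_function[OF s(1)] .
  have sL: "s i \<in> L2_fun M" for i
    by (rule L2_fun_bound[OF f sm, of _ 2]) (use s(3) in \<open>auto intro!: AE_I2\<close>)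
  have "(\<lambda>n. L2_dist2 M (s n) f) \<longlonglongrightarrow> (\<integral>x. 0 \<partial>M)"
  proof (rule integral_dominated_convergence)
    \<comment> \<open>The bound is 10 = 2 * 4 + 2: the approximant is at most twice \<open>f\<close>
      in modulus, and \<open>norm_add_squared_le\<close> doubles each square.\<close>
    show "integrable M (\<lambda>x. 10 * (cmod (f x))\<^sup>2)" using L2_funD(2)[OF f] by simp
    show "AE x in M. (\<lambda>n. (cmod (s n x - f x))\<^sup>2) \<longlonglongrightarrow> 0"
      using s(2) by (intro AE_I2) (auto intro!: tendsto_eq_intros simp: LIM_zero_iff)
    fix n
    show "AE x in M. norm ((cmod (s n x - f x))\<^sup>2) \<le> 10 * (cmod (f x))\<^sup>2"
    proof (rule AE_I2)
      fix x assume "x \<in> space M"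
      then have "(cmod (s n x))\<^sup>2 \<le> (2 * cmod (f x))\<^sup>2" using s(3)[of x n] by (intro power_mono) auto
      then show "norm ((cmod (s n x - f x))\<^sup>2) \<le> 10 * (cmod (f x))\<^sup>2"
        using norm_add_squared_le[of "s n x" "- f x"] by (simp add: power_mult_distrib)
    qed
  qed auto
  then show thesis by (intro that[OF s(1) sL]) simp
qed

section \<open>The state of an invariant vector\<close>

locale auto_action = comm_group G + Gam: group \<Gamma>
  for G :: "('g, 'n) monoid_scheme" (structure) and \<Gamma> :: "('s, 'm) monoid_scheme" +
  fixes \<alpha> :: "'s \<Rightarrow> 'g \<Rightarrow> 'g"
  assumes acts: "acts_by_automorphisms \<Gamma> G \<alpha>"
begin

lemma act_auto: "s \<in> carrier \<Gamma> \<Longrightarrow> \<alpha> s \<in> hom G G \<inter> Bij (carrier G)"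
  using acts by (auto simp: acts_by_automorphisms_def hom_def AutoGroup_def BijGroup_def auto_def)

lemma act_closed [simp]: "s \<in> carrier \<Gamma> \<Longrightarrow> g \<in> carrier G \<Longrightarrow> \<alpha> s g \<in> carrier G"
  using act_auto by (auto simp: hom_def)

lemma act_mult: "s \<in> carrier \<Gamma> \<Longrightarrow> g \<in> carrier G \<Longrightarrow> h \<in> carrier G \<Longrightarrow> \<alpha> s (g \<otimes> h) = \<alpha> s g \<otimes> \<alpha> s h"
  using act_auto by (auto simp: hom_def)

lemma act_inj: "s \<in> carrier \<Gamma> \<Longrightarrow> inj_on (\<alpha> s) (carrier G)"
  using act_auto by (auto simp: Bij_def bij_betw_def)

lemma act_comp:
  assumes "s \<in> carrier \<Gamma>" "t \<in> carrier \<Gamma>" "g \<in> carrier G"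
  shows "\<alpha> (s \<otimes>\<^bsub>\<Gamma>\<^esub> t) g = \<alpha> s (\<alpha> t g)"
proof -
  have "\<alpha> (s \<otimes>\<^bsub>\<Gamma>\<^esub> t) = \<alpha> s \<otimes>\<^bsub>AutoGroup G\<^esub> \<alpha> t"
    using acts assms by (auto simp: acts_by_automorphisms_def hom_def)
  also have "\<dots> = compose (carrier G) (\<alpha> s) (\<alpha> t)"
    using act_auto[OF assms(1)] act_auto[OF assms(2)] by (simp add: AutoGroup_def BijGroup_def)
  finally show ?thesis using assms(3) by (simp add: compose_eq)
qed

text \<open>The automorphism of the identity is idempotent and injective.\<close>

lemma act_one: "g \<in> carrier G \<Longrightarrow> \<alpha> \<one>\<^bsub>\<Gamma>\<^esub> g = g"
  using act_comp[of "\<one>\<^bsub>\<Gamma>\<^esub>" "\<one>\<^bsub>\<Gamma>\<^esub>" g] inj_onD[OF act_inj[of "\<one>\<^bsub>\<Gamma>\<^esub>"], of "\<alpha> \<one>\<^bsub>\<Gamma>\<^esub> g" g] by simp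

lemma act_one_G: assumes "s \<in> carrier \<Gamma>" shows "\<alpha> s \<one> = \<one>"
  using act_mult[OF assms one_closed one_closed] assms by (simp add: l_cancel_one')

lemma act_act_inv:
  assumes "s \<in> carrier \<Gamma>" "g \<in> carrier G"
  shows "\<alpha> s (\<alpha> (inv\<^bsub>\<Gamma>\<^esub> s) g) = g" "\<alpha> (inv\<^bsub>\<Gamma>\<^esub> s) (\<alpha> s g) = g"
  using assms act_one by (simp_all add: act_comp[symmetric])

lemma char_comp_apply: "g \<in> carrier G \<Longrightarrow> char_comp G \<alpha> s \<psi> g = \<psi> (\<alpha> s g)"
  by (simp add: char_comp_def)

lemma char_comp_dual: "s \<in> carrier \<Gamma> \<Longrightarrow> \<psi> \<in> dual G \<Longrightarrow> char_comp G \<alpha> s \<psi> \<in> dual G"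
  by (rule dualI) (auto simp: char_comp_def act_mult dual_mult dual_in_sphere)

lemma char_comp_inverse:
  assumes "s \<in> carrier \<Gamma>" "\<psi> \<in> dual G"
  shows "char_comp G \<alpha> s (char_comp G \<alpha> (inv\<^bsub>\<Gamma>\<^esub> s) \<psi>) = \<psi>"
    "char_comp G \<alpha> (inv\<^bsub>\<Gamma>\<^esub> s) (char_comp G \<alpha> s \<psi>) = \<psi>"
  using assms
  by (intro extensionalityI[OF dual_extensional dual_extensional] char_comp_dual;
      simp add: char_comp_apply act_act_inv)+

lemma continuous_char_comp:
  assumes s: "s \<in> carrier \<Gamma>"
  shows "continuous_map (dual_topology G) (dual_topology G) (char_comp G \<alpha> s)"
proof -
  have "continuous_map (dual_topology G) euclidean (char_comp G \<alpha> s)"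
    unfolding continuous_map_dual_iff
  proof (rule continuous_on_coordinatewise_then_product)
    fix g
    show "continuous_on (dual G) (\<lambda>\<psi>. char_comp G \<alpha> s \<psi> g)"
      unfolding char_comp_def
      by (cases "g \<in> carrier G")
        (auto intro!: continuous_on_subset[OF continuous_on_product_coordinates])
  qed
  then show ?thesis
    using char_comp_dual[OF s] topspace_dual
    by (auto simp: dual_topology_eq continuous_map_in_subtopology)
qed

lemma measurable_char_comp:
  "s \<in> carrier \<Gamma> \<Longrightarrow> char_comp G \<alpha> s \<in> measurable (borel_algebra (dual_topology G)) (borel_algebra (dual_topology G))"
  by (rule continuous_map_measurable[OF continuous_char_comp])

lemma measurable_char_comp_sets:
  assumes "sets N = sets (borel_algebra (dual_topology G))" "s \<in> carrier \<Gamma>"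
  shows "char_comp G \<alpha> s \<in> measurable N (borel_algebra (dual_topology G))"
  using measurable_char_comp[OF assms(2)] measurable_cong_sets[OF assms(1) refl] by blast

lemma invariant_distr:
  assumes "\<nu> \<in> invariant_measures G \<Gamma> \<alpha>" "s \<in> carrier \<Gamma>"
  shows "distr \<nu> (borel_algebra (dual_topology G)) (char_comp G \<alpha> s) = \<nu>"
proof -
  have "distr \<nu> (borel_algebra (dual_topology G)) (char_comp G \<alpha> (inv\<^bsub>\<Gamma>\<^esub> (inv\<^bsub>\<Gamma>\<^esub> s))) = \<nu>"
    using assms Gam.inv_closed[OF assms(2)] unfolding invariant_measures_def by blast
  then show ?thesis using assms(2) by simp
qed

lemma invariant_AE:
  assumes \<nu>: "\<nu> \<in> invariant_measures G \<Gamma> \<alpha>" and s: "s \<in> carrier \<Gamma>" and ae: "AE \<psi> in \<nu>. Q \<psi>"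
  shows "AE \<psi> in \<nu>. Q (char_comp G \<alpha> s \<psi>)"
proof -
  have "sets \<nu> = sets (borel_algebra (dual_topology G))"
    using \<nu> by (simp add: invariant_measures_def regular_borel_prob_def)
  moreover have "AE \<psi> in distr \<nu> (borel_algebra (dual_topology G)) (char_comp G \<alpha> s). Q \<psi>"
    unfolding invariant_distr[OF \<nu> s] by (rule ae)
  ultimately show ?thesis by (intro AE_distrD[OF measurable_char_comp_sets[OF _ s]])
qed

text \<open>Outer regularity moves along the homeomorphism: a tight open neighbourhood of the
  preimage of \<open>A\<close> is carried forward by pulling it back along the inverse.\<close>

lemma regular_distr_char_comp:
  assumes M: "regular_borel_prob (dual_topology G) M" and s: "s \<in> carrier \<Gamma>"
  shows "regular_borel_prob (dual_topology G) (distr M (borel_algebra (dual_topology G)) (char_comp G \<alpha> s))"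
    (is "regular_borel_prob ?X ?N")
proof (rule dual_space.outer_regular_imp_regular)
  interpret prob_space M using M by (simp add: regular_borel_prob_def)
  have sM: "sets M = sets (borel_algebra ?X)" using M by (simp add: regular_borel_prob_def)
  have meas: "char_comp G \<alpha> s \<in> measurable M (borel_algebra ?X)"
    using measurable_char_comp[OF s] measurable_cong_sets[OF sM refl] by blast
  have spM: "space M = dual G" using regular_borel_prob_space[OF M] topspace_dual by simp
  show "sets ?N = sets (borel_algebra ?X)" by simp
  show "prob_space ?N" by (rule prob_space_distr[OF meas])
  fix A and e :: real assume A: "A \<in> sets ?N" and "0 < e"
  let ?B = "char_comp G \<alpha> s -` A \<inter> space M"
  have B: "?B \<in> sets M" using measurable_sets[OF meas] A by simp
  obtain U where U: "openin ?X U" "?B \<subseteq> U" "measure M U < measure M ?B + e"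
    using regular_borel_prob_approx[OF M B \<open>0 < e\<close>] by metis
  let ?V = "{\<psi> \<in> topspace ?X. char_comp G \<alpha> (inv\<^bsub>\<Gamma>\<^esub> s) \<psi> \<in> U}"
  have V: "openin ?X ?V"
    using openin_continuous_map_preimage[OF continuous_char_comp U(1)] s by simp
  have UD: "U \<subseteq> dual G" using openin_subset[OF U(1)] topspace_dual by simp
  have AD: "A \<subseteq> dual G" using sets.sets_into_space[OF A] by (simp add: space_borel_algebra topspace_dual)
  have "A \<subseteq> ?V"
  proof
    fix \<psi> assume "\<psi> \<in> A"
    then have "\<psi> \<in> dual G" using AD by auto
    then have "char_comp G \<alpha> (inv\<^bsub>\<Gamma>\<^esub> s) \<psi> \<in> ?B"
      using \<open>\<psi> \<in> A\<close> s char_comp_inverse(1)[OF s] spM char_comp_dual[of "inv\<^bsub>\<Gamma>\<^esub> s" \<psi>] by simp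
    then show "\<psi> \<in> ?V" using U(2) \<open>\<psi> \<in> dual G\<close> topspace_dual by auto
  qed
  moreover have "char_comp G \<alpha> s -` ?V \<inter> space M = U"
    using UD spM s char_comp_inverse(2)[OF s] char_comp_dual[OF s] topspace_dual by auto
  then have "measure ?N ?V = measure M U"
    using openin_in_borel_algebra[OF V] by (simp add: measure_distr[OF meas])
  moreover have "measure ?N A = measure M ?B" using A by (simp add: measure_distr[OF meas])
  ultimately show "\<exists>V. openin ?X V \<and> A \<subseteq> V \<and> measure ?N V \<le> measure ?N A + e"
    using V U(3) by (intro exI[of _ ?V]) simp
qed

end

locale invariant_vector = auto_action G \<Gamma> \<alpha>
  for G :: "('g, 'n) monoid_scheme" (structure) and \<Gamma> :: "('s, 'm) monoid_scheme" and \<alpha> +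
  fixes \<pi> :: "'g \<times> 's \<Rightarrow> 'h::complex_hilbert_space \<Rightarrow> 'h" and x :: 'h
  assumes irred: "irreducible_unitary_rep (semidirect G \<Gamma> \<alpha>) \<pi>"
    and x_fixed: "x \<in> fixed_space G \<Gamma> \<pi>" and x_norm: "norm x = 1"
begin

abbreviation P :: "'g \<Rightarrow> 'h \<Rightarrow> 'h" where "P g \<equiv> \<pi> (g, \<one>\<^bsub>\<Gamma>\<^esub>)"

abbreviation T :: "'s \<Rightarrow> 'h \<Rightarrow> 'h" where "T s \<equiv> \<pi> (\<one>, s)"

lemma rep_unitary: "g \<in> carrier G \<Longrightarrow> s \<in> carrier \<Gamma> \<Longrightarrow> unitary (\<pi> (g, s))"
  using irred
  by (auto simp: irreducible_unitary_rep_def unitary_rep_def hom_def semidirect_def unitary_group_def)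

lemma rep_mult:
  assumes "g \<in> carrier G" "s \<in> carrier \<Gamma>" "h \<in> carrier G" "t \<in> carrier \<Gamma>"
  shows "\<pi> (g, s) (\<pi> (h, t) v) = \<pi> (g \<otimes> \<alpha> s h, s \<otimes>\<^bsub>\<Gamma>\<^esub> t) v"
proof -
  have "\<pi> (g \<otimes> \<alpha> s h, s \<otimes>\<^bsub>\<Gamma>\<^esub> t) = \<pi> (g, s) \<circ> \<pi> (h, t)"
    using irred assms
    by (auto simp: irreducible_unitary_rep_def unitary_rep_def hom_def semidirect_def unitary_group_def)
  then show ?thesis by simp
qed

lemmas rep_add = unitaryD(1)[OF rep_unitary]
  and rep_scale = unitaryD(2)[OF rep_unitary]
  and rep_cinner = unitaryD(3)[OF rep_unitary]

lemma rep_diff: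
  assumes "g \<in> carrier G" "s \<in> carrier \<Gamma>"
  shows "\<pi> (g, s) (v - w) = \<pi> (g, s) v - \<pi> (g, s) w"
  using rep_add[OF assms, of "v - w" w] by simp

text \<open>The image of the identity is idempotent, so it kills \<open>?w\<close>; as it preserves
  inner products, \<open>?w\<close> is zero.\<close>

lemma rep_one: "\<pi> (\<one>, \<one>\<^bsub>\<Gamma>\<^esub>) v = v"
proof -
  let ?w = "\<pi> (\<one>, \<one>\<^bsub>\<Gamma>\<^esub>) v - v"
  have "\<pi> (\<one>, \<one>\<^bsub>\<Gamma>\<^esub>) ?w = 0"
    using rep_mult[of \<one> "\<one>\<^bsub>\<Gamma>\<^esub>" \<one> "\<one>\<^bsub>\<Gamma>\<^esub>" v] by (simp add: rep_diff act_one)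
  then have "cinner ?w ?w = 0"
    using rep_cinner[of \<one> "\<one>\<^bsub>\<Gamma>\<^esub>" ?w ?w] by simp
  then show ?thesis by (simp add: cinner_self_eq_zero)
qed

lemma P_mult: "g \<in> carrier G \<Longrightarrow> h \<in> carrier G \<Longrightarrow> P g (P h v) = P (g \<otimes> h) v"
  by (simp add: rep_mult act_one)

lemma rep_P: "g \<in> carrier G \<Longrightarrow> s \<in> carrier \<Gamma> \<Longrightarrow> h \<in> carrier G \<Longrightarrow>
    \<pi> (g, s) (P h v) = P (g \<otimes> \<alpha> s h) (T s v)"
  by (simp add: rep_mult act_one_G)

lemma P_cinner_inv:
  assumes "g \<in> carrier G"
  shows "cinner v (P g w) = cinner (P (inv g) v) w"
proof -
  have "cinner v (P g w) = cinner (P (inv g) v) (P (inv g) (P g w))"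
    using assms by (simp add: rep_cinner)
  then show ?thesis using assms by (simp add: P_mult rep_one)
qed

lemma fixedD: "y \<in> fixed_space G \<Gamma> \<pi> \<Longrightarrow> s \<in> carrier \<Gamma> \<Longrightarrow> T s y = y"
  by (simp add: fixed_space_def)

definition coeff_fun :: "'h \<Rightarrow> 'g \<Rightarrow> complex" where
  "coeff_fun v = (\<lambda>g\<in>carrier G. cinner (P g v) v)"

text \<open>The twist is multiplication by a square: moving (1 + l g) / sqrt 2 onto the vector turns
  it into another coefficient function. This uses that \<open>G\<close> is commutative. Iterated
  twists thus end at a squared norm when evaluated at the identity.\<close>

lemma twist_coeff_fun:
  assumes l: "cmod l = 1" and g: "g \<in> carrier G"
  shows "twist G (l, g) (coeff_fun v) = coeff_fun (scaleC (of_real (1 / sqrt 2)) (v + scaleC l (P g v)))"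
    (is "_ = coeff_fun (scaleC ?c ?w)")
proof
  fix h
  show "twist G (l, g) (coeff_fun v) h = coeff_fun (scaleC ?c ?w) h"
  proof (cases "h \<in> carrier G")
    case h: True
    have ll: "l * cnj l = 1" using l by (simp add: complex_norm_square[symmetric])
    have cc: "?c * cnj ?c = 1/2"
      by (simp add: of_real_mult[symmetric] del: of_real_mult)
    have hg: "h \<otimes> g = g \<otimes> h" by (rule m_comm[OF h g])
    have PP: "P h (P g v) = P g (P h v)" using g h hg by (simp add: P_mult)
    have e1: "cinner (P h (P g v)) (P g v) = cinner (P h v) v"
      unfolding PP using g by (simp add: rep_cinner)
    have e2: "cinner (P h v) (P g v) = cinner (P (inv g \<otimes> h) v) v"
      using g h by (simp add: P_cinner_inv P_mult)
    have "cinner (P h (scaleC ?c ?w)) (scaleC ?c ?w) = (?c * cnj ?c) * cinner (P h ?w) ?w"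
      using h by (simp only: rep_scale[OF h Gam.one_closed] cinner_scaleC_left cinner_scaleC_right mult_ac)
    also have "cinner (P h ?w) ?w = cinner (P h v) v + cnj l * cinner (P h v) (P g v)
        + (l * cinner (P h (P g v)) v + l * (cnj l * cinner (P h (P g v)) (P g v)))"
      by (simp only: rep_add[OF h Gam.one_closed] rep_scale[OF h Gam.one_closed] cinner_add_left
          cinner_add_right cinner_scaleC_left cinner_scaleC_right) (simp only: ring_distribs ac_simps)
    also have "l * (cnj l * cinner (P h (P g v)) (P g v)) = cinner (P h v) v"
      unfolding e1 using ll by (simp add: mult.assoc[symmetric])
    finally have "cinner (P h (scaleC ?c ?w)) (scaleC ?c ?w) =
        cinner (P h v) v + (l * cinner (P (g \<otimes> h) v) v + cnj l * cinner (P (inv g \<otimes> h) v) v) / 2"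
      unfolding cc e2 PP using g h by (simp add: P_mult field_simps)
    then show ?thesis using g h by (simp add: twist_def coeff_fun_def)
  qed (simp add: twist_def coeff_fun_def)
qed

lemma pos_functional_coeff_fun: "pos_functional G (coeff_fun v)"
  unfolding pos_functional_def
proof (intro allI impI)
  fix qs :: "(complex \<times> 'g) list" assume "set qs \<subseteq> sphere 0 1 \<times> carrier G"
  then have "\<exists>w. fold (twist G) qs (coeff_fun v) = coeff_fun w"
  proof (induction qs arbitrary: v)
    case (Cons q qs)
    then obtain l g where q: "q = (l, g)" "cmod l = 1" "g \<in> carrier G" by auto
    then show ?case using Cons twist_coeff_fun[OF q(2,3), of v] by simp
  qed auto
  then obtain w where w: "fold (twist G) qs (coeff_fun v) = coeff_fun w" by blast
  show "fold (twist G) qs (coeff_fun v) \<one> \<in> \<real>\<^sub>\<ge>\<^sub>0"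
    unfolding w by (simp add: coeff_fun_def rep_one cinner_self del: of_real_power)
qed

lemma coeff_fun_state: "coeff_fun x \<in> states G"
  using pos_functional_coeff_fun x_norm
  by (simp add: states_def) (simp add: coeff_fun_def rep_one cinner_self)

lemma coeff_fun_act:
  assumes s: "s \<in> carrier \<Gamma>" and g: "g \<in> carrier G"
  shows "coeff_fun x (\<alpha> s g) = coeff_fun x g"
proof -
  have "P (\<alpha> s g) x = T s (P g x)"
    using rep_P[OF one_closed s g, of x] fixedD[OF x_fixed s] s g by simp
  then have "cinner (P (\<alpha> s g) x) x = cinner (T s (P g x)) (T s x)"
    using fixedD[OF x_fixed s] by simp
  then show ?thesis using s g by (simp add: coeff_fun_def rep_cinner)
qed

text \<open>Cyclicity of a fixed vector for \<open>G\<close> alone. Because \<open>\<Gamma>\<close>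
  fixes \<open>y\<close>, the representation permutes the \<open>G\<close>-orbit of
  \<open>y\<close>, so the orthogonal complement \<open>N\<close> of the orbit is a closed invariant
  subspace; it misses \<open>y\<close>, hence is zero.\<close>

lemma fixed_separating:
  assumes y: "y \<in> fixed_space G \<Gamma> \<pi>" "y \<noteq> 0" and v: "\<And>g. g \<in> carrier G \<Longrightarrow> cinner v (P g y) = 0"
  shows "v = 0"
proof -
  define N where "N = {v. \<forall>g\<in>carrier G. cinner v (P g y) = 0}"
  have "complex_vector.subspace N"
    by (rule complex_vector.subspaceI) (auto simp: N_def cinner_add_left cinner_scaleC_left)
  moreover have "N = (\<Inter>g\<in>carrier G. {v. cinner v (P g y) = 0})" by (auto simp: N_def)
  then have "closed N" by (simp add: closed_INT closed_cinner_eq_zero)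
  moreover have "\<pi> k ` N \<subseteq> N" if kK: "k \<in> carrier (semidirect G \<Gamma> \<alpha>)" for k
  proof (intro image_subsetI)
    fix v assume v: "v \<in> N"
    obtain g s where k: "k = (g, s)" "g \<in> carrier G" "s \<in> carrier \<Gamma>"
      using kK by (auto simp: semidirect_def)
    show "\<pi> k v \<in> N"
      unfolding N_def
    proof (intro CollectI ballI)
      fix h assume h: "h \<in> carrier G"
      \<comment> \<open>Chosen so that \<open>\<pi> (g, s)\<close> carries the orbit point of
        \<open>?h\<close> to that of \<open>h\<close>.\<close>
      let ?h = "\<alpha> (inv\<^bsub>\<Gamma>\<^esub> s) (inv g \<otimes> h)"
      have "\<pi> (g, s) (P ?h y) = P h y"
        using k h rep_P[of g s ?h y] fixedD[OF y(1)] by (simp add: act_act_inv m_assoc[symmetric])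
      then have "cinner (\<pi> k v) (P h y) = cinner v (P ?h y)"
        using k rep_cinner[OF k(2,3), of v "P ?h y"] by simp
      then show "cinner (\<pi> k v) (P h y) = 0" using v k h by (simp add: N_def)
    qed
  qed
  ultimately have "N = {0} \<or> N = UNIV"
    using irred by (simp add: irreducible_unitary_rep_def)
  moreover have "y \<notin> N"
  proof
    assume "y \<in> N"
    then have "cinner y (P \<one> y) = 0" by (simp add: N_def)
    then show False using y(2) by (simp add: rep_one cinner_self_eq_zero)
  qed
  ultimately have "N = {0}" by blast
  then show ?thesis using v by (auto simp: N_def)
qed

end

section \<open>The correspondence between vectors and square-integrable functions\<close>

lemma L2_dist_triangle:
  assumes "f \<in> L2_fun M" "g \<in> L2_fun M" "h \<in> L2_fun M"
  shows "L2_dist2 M f h \<le> 2 * L2_dist2 M f g + 2 * L2_dist2 M g h"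
proof -
  note i = L2_funD(2)[OF L2_fun_diff[OF assms(1,3)]] L2_funD(2)[OF L2_fun_diff[OF assms(1,2)]]
    L2_funD(2)[OF L2_fun_diff[OF assms(2,3)]]
  have "L2_dist2 M f h \<le> (\<integral>x. 2 * (cmod (f x - g x))\<^sup>2 + 2 * (cmod (g x - h x))\<^sup>2 \<partial>M)"
  proof (rule integral_mono)
    show "(cmod (f x - h x))\<^sup>2 \<le> 2 * (cmod (f x - g x))\<^sup>2 + 2 * (cmod (g x - h x))\<^sup>2" for x
      using norm_add_squared_le[of "f x - g x" "g x - h x"] by simp
  qed (use i in auto)
  then show ?thesis using i by simp
qed

lemma L2_norm_inner:
  "(\<integral>x. f x * cnj (f x) \<partial>M) = complex_of_real (L2_norm2 M f)"
  unfolding integral_complex_of_real[symmetric] complex_norm_square ..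

context invariant_vector
begin

lemma ex_spectral_measure:
  obtains \<mu> where "regular_borel_prob (dual_topology G) \<mu>"
    "\<And>g. g \<in> carrier G \<Longrightarrow> (\<integral>\<psi>. \<psi> g \<partial>\<mu>) = coeff_fun x g"
  using Bochner[OF coeff_fun_state] by blast

end

locale spectral = invariant_vector G \<Gamma> \<alpha> \<pi> x
  for G :: "('g, 'n) monoid_scheme" (structure) and \<Gamma> :: "('s, 'm) monoid_scheme" and \<alpha>
    and \<pi> :: "'g \<times> 's \<Rightarrow> 'h::complex_hilbert_space \<Rightarrow> 'h" and x :: 'h +
  fixes \<mu> :: "('g \<Rightarrow> complex) measure"
  assumes regular: "regular_borel_prob (dual_topology G) \<mu>"
    and Fourier: "g \<in> carrier G \<Longrightarrow> (\<integral>\<psi>. \<psi> g \<partial>\<mu>) = coeff_fun x g"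
begin

sublocale mu: prob_space \<mu>
  using regular by (simp add: regular_borel_prob_def)

lemma sets_mu: "sets \<mu> = sets (borel_algebra (dual_topology G))"
  using regular by (simp add: regular_borel_prob_def)

lemma space_mu: "space \<mu> = dual G"
  using regular_borel_prob_space[OF regular] topspace_dual by simp

lemma measurable_char_comp_mu:
  "s \<in> carrier \<Gamma> \<Longrightarrow> char_comp G \<alpha> s \<in> measurable \<mu> (borel_algebra (dual_topology G))"
  by (rule measurable_char_comp_sets[OF sets_mu])

lemma borel_measurable_mu: "borel_measurable \<mu> = borel_measurable (borel_algebra (dual_topology G))"
  by (rule measurable_cong_sets[OF sets_mu refl])

text \<open>The coefficients of the image measure are those of \<open>\<mu>\<close> at
  \<open>\<alpha> s g\<close>, and invariance of \<open>x\<close> makes them equal to those at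
  \<open>g\<close>.\<close>

lemma distr_mu:
  assumes s: "s \<in> carrier \<Gamma>"
  shows "distr \<mu> (borel_algebra (dual_topology G)) (char_comp G \<alpha> s) = \<mu>"
proof (rule Fourier_unique[OF regular_distr_char_comp[OF regular s] regular])
  fix g assume g: "g \<in> carrier G"
  have "(\<integral>\<psi>. \<psi> g \<partial>distr \<mu> (borel_algebra (dual_topology G)) (char_comp G \<alpha> s)) =
      (\<integral>\<psi>. char_comp G \<alpha> s \<psi> g \<partial>\<mu>)"
    by (rule integral_distr[OF measurable_char_comp_mu[OF s]
          continuous_map_borel_measurable[OF continuous_eval refl]])
  also have "\<dots> = (\<integral>\<psi>. \<psi> (\<alpha> s g) \<partial>\<mu>)" by (simp add: char_comp_apply g)
  finally show "(\<integral>\<psi>. \<psi> g \<partial>distr \<mu> (borel_algebra (dual_topology G)) (char_comp G \<alpha> s)) = (\<integral>\<psi>. \<psi> g \<partial>\<mu>)"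
    using s g by (simp add: Fourier coeff_fun_act)
qed

lemma mu_invariant: "\<mu> \<in> invariant_measures G \<Gamma> \<alpha>"
  using regular distr_mu by (simp add: invariant_measures_def)

lemma integral_char_comp:
  fixes f :: "_ \<Rightarrow> 'b::{banach, second_countable_topology}"
  assumes "s \<in> carrier \<Gamma>" "f \<in> borel_measurable \<mu>"
  shows "(\<integral>\<psi>. f (char_comp G \<alpha> s \<psi>) \<partial>\<mu>) = (\<integral>\<psi>. f \<psi> \<partial>\<mu>)"
  using integral_distr[OF measurable_char_comp_mu[OF assms(1)], of f] assms(2)
  unfolding borel_measurable_mu by (simp add: distr_mu[OF assms(1)])

lemma L2_char_comp:
  assumes s: "s \<in> carrier \<Gamma>" and f: "f \<in> L2_fun \<mu>"
  shows "(\<lambda>\<psi>. f (char_comp G \<alpha> s \<psi>)) \<in> L2_fun \<mu>"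
proof -
  have fb: "f \<in> borel_measurable (borel_algebra (dual_topology G))"
    using L2_funD(1)[OF f] unfolding borel_measurable_mu .
  have "integrable (distr \<mu> (borel_algebra (dual_topology G)) (char_comp G \<alpha> s)) (\<lambda>\<psi>. (cmod (f \<psi>))\<^sup>2)"
    unfolding distr_mu[OF s] by (rule L2_funD(2)[OF f])
  then have "integrable \<mu> (\<lambda>\<psi>. (cmod (f (char_comp G \<alpha> s \<psi>)))\<^sup>2)"
    by (rule integrable_distr[OF measurable_char_comp_mu[OF s]])
  then show ?thesis
    using measurable_compose[OF measurable_char_comp_mu[OF s] fb] by (simp add: L2_fun_def)
qed

lemma eval_measurable: "(\<lambda>\<psi>. \<psi> g) \<in> borel_measurable \<mu>"
  by (rule continuous_map_borel_measurable[OF continuous_eval sets_mu])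

lemma L2_mult_eval:
  assumes f: "f \<in> L2_fun \<mu>" and g: "g \<in> carrier G"
  shows "(\<lambda>\<psi>. \<psi> g * f \<psi>) \<in> L2_fun \<mu>"
proof (rule L2_fun_bound[OF f, where c=1])
  show "(\<lambda>\<psi>. \<psi> g * f \<psi>) \<in> borel_measurable \<mu>"
    by (intro borel_measurable_times eval_measurable L2_funD(1)[OF f])
  show "AE \<psi> in \<mu>. cmod (\<psi> g * f \<psi>) \<le> 1 * cmod (f \<psi>)"
    using g by (intro AE_I2) (simp add: space_mu norm_mult dual_in_sphere)
qed

lemma L2_const: "(\<lambda>_. c) \<in> L2_fun \<mu>"
  by (simp add: L2_fun_def)

lemma L2_eval: "g \<in> carrier G \<Longrightarrow> (\<lambda>\<psi>. \<psi> g) \<in> L2_fun \<mu>"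
  using L2_mult_eval[OF L2_const[of 1]] by simp

text \<open>A finite combination of orbit vectors paired with the same combination of evaluations.
  Different combinations may give the same vector, so this is kept as a relation; being isometric,
  it matches equal vectors with functions equal almost everywhere.\<close>

inductive_set poly_pairs :: "('h \<times> (('g \<Rightarrow> complex) \<Rightarrow> complex)) set" where
  monomial: "g \<in> carrier G \<Longrightarrow> (scaleC c (P g x), \<lambda>\<psi>. c * \<psi> g) \<in> poly_pairs"
| add: "(v, p) \<in> poly_pairs \<Longrightarrow> (w, q) \<in> poly_pairs \<Longrightarrow> (v + w, \<lambda>\<psi>. p \<psi> + q \<psi>) \<in> poly_pairs"

lemma poly_pairs_L2: "(v, p) \<in> poly_pairs \<Longrightarrow> p \<in> L2_fun \<mu>"
  by (induction rule: poly_pairs.induct) (auto intro: L2_fun_add L2_fun_scale L2_eval)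

lemma poly_pairs_scale: "(v, p) \<in> poly_pairs \<Longrightarrow> (scaleC a v, \<lambda>\<psi>. a * p \<psi>) \<in> poly_pairs"
proof (induction rule: poly_pairs.induct)
  case (monomial g c)
  then show ?case using poly_pairs.monomial[OF monomial, of "a * c"]
    by (simp add: scaleC_scaleC mult.assoc)
next
  case (add v p w q)
  then show ?case using poly_pairs.add[of "scaleC a v" "\<lambda>\<psi>. a * p \<psi>" "scaleC a w" "\<lambda>\<psi>. a * q \<psi>"]
    by (simp add: scaleC_add_right distrib_left)
qed

lemma poly_pairs_diff:
  assumes "(v, p) \<in> poly_pairs" "(w, q) \<in> poly_pairs"
  shows "(v - w, \<lambda>\<psi>. p \<psi> - q \<psi>) \<in> poly_pairs"
  using poly_pairs.add[OF assms(1) poly_pairs_scale[OF assms(2), of "-1"]]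
  by (simp add: scaleC_minus_one)

lemma poly_pairs_inner_eval:
  assumes "(v, p) \<in> poly_pairs" and h: "h \<in> carrier G"
  shows "cinner v (P h x) = (\<integral>\<psi>. p \<psi> * cnj (\<psi> h) \<partial>\<mu>)"
  using assms(1)
proof (induction rule: poly_pairs.induct)
  case (monomial g c)
  have "cinner (P g x) (P h x) = coeff_fun x (inv h \<otimes> g)"
    using monomial h by (simp add: P_cinner_inv P_mult coeff_fun_def)
  also have "\<dots> = (\<integral>\<psi>. \<psi> (inv h \<otimes> g) \<partial>\<mu>)" using monomial h by (simp add: Fourier)
  also have "\<dots> = (\<integral>\<psi>. \<psi> g * cnj (\<psi> h) \<partial>\<mu>)"
    using monomial h by (intro Bochner_Integration.integral_cong) (auto simp: space_mu dual_mult dual_inv)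
  finally show ?case by (simp add: cinner_scaleC_left mult.assoc)
next
  case (add v p w q)
  then show ?case
    using L2_mult_integrable[OF poly_pairs_L2[OF add(1)] L2_eval[OF h]]
      L2_mult_integrable[OF poly_pairs_L2[OF add(2)] L2_eval[OF h]]
    by (simp add: cinner_add_left distrib_right)
qed

lemma poly_pairs_inner:
  assumes vp: "(v, p) \<in> poly_pairs" and "(w, q) \<in> poly_pairs"
  shows "cinner v w = (\<integral>\<psi>. p \<psi> * cnj (q \<psi>) \<partial>\<mu>)"
  using assms(2)
proof (induction rule: poly_pairs.induct)
  case (monomial g c)
  have "(\<integral>\<psi>. p \<psi> * cnj (c * \<psi> g) \<partial>\<mu>) = (\<integral>\<psi>. cnj c * (p \<psi> * cnj (\<psi> g)) \<partial>\<mu>)"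
    by (intro Bochner_Integration.integral_cong) auto
  then show ?case
    using poly_pairs_inner_eval[OF vp monomial] by (simp add: cinner_scaleC_right)
next
  case (add w q w' q')
  then show ?case
    using L2_mult_integrable[OF poly_pairs_L2[OF vp] poly_pairs_L2[OF add(1)]]
      L2_mult_integrable[OF poly_pairs_L2[OF vp] poly_pairs_L2[OF add(2)]]
    by (simp add: cinner_add_right distrib_left)
qed

lemma poly_pairs_norm:
  assumes "(v, p) \<in> poly_pairs"
  shows "(norm v)\<^sup>2 = L2_norm2 \<mu> p"
  using poly_pairs_inner[OF assms assms] unfolding L2_norm_inner cinner_self of_real_eq_iff .

section \<open>Density of trigonometric polynomials in the square-integrable functions\<close>

definition approximable :: "(('g \<Rightarrow> complex) \<Rightarrow> complex) \<Rightarrow> bool" where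
  "approximable f \<longleftrightarrow> f \<in> L2_fun \<mu> \<and>
     (\<forall>e>0. \<exists>v p. (v, p) \<in> poly_pairs \<and> L2_dist2 \<mu> p f < e)"

lemma approximableD:
  assumes "approximable f" "0 < e"
  obtains v p where "(v, p) \<in> poly_pairs" "L2_dist2 \<mu> p f < e"
  using assms unfolding approximable_def by blast

lemma approximable_limit:
  assumes f: "f \<in> L2_fun \<mu>"
    and lim: "\<And>e. 0 < e \<Longrightarrow> \<exists>h. approximable h \<and> L2_dist2 \<mu> h f < e"
  shows "approximable f"
  unfolding approximable_def
proof (intro conjI allI impI f)
  fix e :: real assume "0 < e"
  then obtain h where h: "approximable h" "L2_dist2 \<mu> h f < e / 4"
    using lim[of "e/4"] by auto
  obtain v p where p: "(v, p) \<in> poly_pairs" "L2_dist2 \<mu> p h < e / 4"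
    using approximableD[OF h(1), of "e/4"] \<open>0 < e\<close> by auto
  have "h \<in> L2_fun \<mu>" using h(1) by (simp add: approximable_def)
  then have "L2_dist2 \<mu> p f < e"
    using L2_dist_triangle[OF poly_pairs_L2[OF p(1)] _ f, of h] p(2) h(2) by simp
  then show "\<exists>v p. (v, p) \<in> poly_pairs \<and> L2_dist2 \<mu> p f < e"
    using p(1) by blast
qed

lemma approximable_add:
  assumes f: "approximable f" and g: "approximable g"
  shows "approximable (\<lambda>\<psi>. f \<psi> + g \<psi>)"
  unfolding approximable_def
proof (intro conjI allI impI)
  have fg: "f \<in> L2_fun \<mu>" "g \<in> L2_fun \<mu>" using f g by (auto simp: approximable_def)
  show "(\<lambda>\<psi>. f \<psi> + g \<psi>) \<in> L2_fun \<mu>" by (rule L2_fun_add[OF fg])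
  fix e :: real assume "0 < e"
  then have "0 < e / 4" by simp
  obtain v p where p: "(v, p) \<in> poly_pairs" "L2_dist2 \<mu> p f < e / 4"
    using approximableD[OF f \<open>0 < e / 4\<close>] by blast
  obtain w q where q: "(w, q) \<in> poly_pairs" "L2_dist2 \<mu> q g < e / 4"
    using approximableD[OF g \<open>0 < e / 4\<close>] by blast
  note L = L2_fun_add[OF poly_pairs_L2[OF p(1)] poly_pairs_L2[OF q(1)]]
    L2_fun_add[OF fg(1) poly_pairs_L2[OF q(1)]] L2_fun_add[OF fg]
  have "(\<integral>\<psi>. (cmod ((p \<psi> + q \<psi>) - (f \<psi> + g \<psi>)))\<^sup>2 \<partial>\<mu>) < e"
    using L2_dist_triangle[OF L] p(2) q(2) by simp
  then show "\<exists>v p. (v, p) \<in> poly_pairs \<and> (\<integral>\<psi>. (cmod (p \<psi> - (f \<psi> + g \<psi>)))\<^sup>2 \<partial>\<mu>) < e"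
    using poly_pairs.add[OF p(1) q(1)] by blast
qed

lemma approximable_scale:
  assumes f: "approximable f"
  shows "approximable (\<lambda>\<psi>. a * f \<psi>)"
  unfolding approximable_def
proof (intro conjI allI impI)
  have fL: "f \<in> L2_fun \<mu>" using f by (simp add: approximable_def)
  show "(\<lambda>\<psi>. a * f \<psi>) \<in> L2_fun \<mu>" by (rule L2_fun_scale[OF fL])
  fix e :: real assume "0 < e"
  \<comment> \<open>Adding 1 covers the scalar 0 without a case distinction.\<close>
  have c: "0 < (cmod a)\<^sup>2 + 1" by (simp add: add_nonneg_pos)
  then have e': "0 < e / ((cmod a)\<^sup>2 + 1)" using \<open>0 < e\<close> by simp
  obtain v p where p: "(v, p) \<in> poly_pairs" "L2_dist2 \<mu> p f < e / ((cmod a)\<^sup>2 + 1)"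
    using approximableD[OF f e'] by blast
  have "(\<integral>\<psi>. (cmod (a * p \<psi> - a * f \<psi>))\<^sup>2 \<partial>\<mu>) = (\<integral>\<psi>. (cmod a)\<^sup>2 * (cmod (p \<psi> - f \<psi>))\<^sup>2 \<partial>\<mu>)"
    by (simp add: norm_mult power_mult_distrib flip: right_diff_distrib)
  also have "\<dots> = (cmod a)\<^sup>2 * L2_dist2 \<mu> p f" by simp
  also have "\<dots> \<le> (cmod a)\<^sup>2 * (e / ((cmod a)\<^sup>2 + 1))"
    using p(2) by (intro mult_left_mono) auto
  also have "\<dots> < e" using c \<open>0 < e\<close> by (simp add: field_simps)
  finally show "\<exists>v p. (v, p) \<in> poly_pairs \<and> (\<integral>\<psi>. (cmod (p \<psi> - a * f \<psi>))\<^sup>2 \<partial>\<mu>) < e"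
    using poly_pairs_scale[OF p(1)] by blast
qed

lemma approximable_cong:
  assumes "approximable f" "\<And>\<psi>. \<psi> \<in> dual G \<Longrightarrow> f \<psi> = g \<psi>"
  shows "approximable g"
proof -
  have f: "f \<in> L2_fun \<mu>" using assms(1) by (simp add: approximable_def)
  have "f \<in> borel_measurable \<mu> \<longleftrightarrow> g \<in> borel_measurable \<mu>"
    using assms(2) by (intro measurable_cong) (simp add: space_mu)
  then have "g \<in> L2_fun \<mu>"
    using assms(2) by (intro L2_fun_bound[OF f, where c=1]) (auto simp: L2_funD(1)[OF f] space_mu intro!: AE_I2)
  moreover have "L2_dist2 \<mu> p f = L2_dist2 \<mu> p g" for p
    using assms(2) by (intro Bochner_Integration.integral_cong) (auto simp: space_mu)
  ultimately show ?thesis using assms(1) by (simp add: approximable_def)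
qed

lemma approximable_poly: "(v, p) \<in> poly_pairs \<Longrightarrow> approximable p"
  unfolding approximable_def
proof (intro conjI allI impI)
  assume p: "(v, p) \<in> poly_pairs"
  then show "p \<in> L2_fun \<mu>" by (rule poly_pairs_L2)
  fix e :: real assume "0 < e"
  then show "\<exists>w q. (w, q) \<in> poly_pairs \<and> L2_dist2 \<mu> q p < e"
    using p by (intro exI[of _ v] exI[of _ p]) simp
qed

lemma approximable_trig_poly:
  "p \<in> trig_polys G \<Longrightarrow> approximable (\<lambda>\<psi>. of_real (p \<psi>))"
proof (induction rule: trig_polys.induct)
  case (monomial g c)
  \<comment> \<open>The real part is half the sum with the conjugate, and at a character conjugation
    is evaluation at the inverse.\<close>
  have "approximable (\<lambda>\<psi>. (c / 2) * \<psi> g + (cnj c / 2) * \<psi> (inv g))"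
    using monomial by (intro approximable_add approximable_poly[OF poly_pairs.monomial]) auto
  then show ?case
  proof (rule approximable_cong)
    fix \<psi> assume "\<psi> \<in> dual G"
    then have "\<psi> (inv g) = cnj (\<psi> g)" using monomial by (rule dual_inv)
    then show "(c / 2) * \<psi> g + (cnj c / 2) * \<psi> (inv g) = of_real (Re (c * \<psi> g))"
      by (simp add: complex_eq_iff field_simps)
  qed
next
  case (add p q)
  then show ?case using approximable_add by simp
qed

lemma approximable_continuous:
  assumes f: "continuous_map (dual_topology G) euclideanreal f"
  shows "approximable (\<lambda>\<psi>. of_real (f \<psi>))"
proof (rule approximable_limit)
  have fm: "f \<in> borel_measurable \<mu>" by (rule continuous_map_borel_measurable[OF f sets_mu])
  have "integrable \<mu> (\<lambda>\<psi>. (f \<psi>)\<^sup>2)"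
    by (intro continuous_map_integrable[OF dual_space.compact _ sets_mu mu.finite_measure_axioms]
        continuous_intros f)
  then show fL: "(\<lambda>\<psi>. complex_of_real (f \<psi>)) \<in> L2_fun \<mu>" using fm by (simp add: L2_fun_def)
  fix e :: real assume "0 < e"
  \<comment> \<open>A uniform error \<open>d\<close> gives squared distance at most
    \<open>e / 2\<close> over a probability measure, strictly below \<open>e\<close>.\<close>
  define d where "d = sqrt (e / 2)"
  have d: "0 < d" "d\<^sup>2 = e / 2" using \<open>0 < e\<close> by (auto simp: d_def)
  obtain p where p: "p \<in> trig_polys G" "\<And>\<psi>. \<psi> \<in> dual G \<Longrightarrow> \<bar>f \<psi> - p \<psi>\<bar> < d"
    using trig_polys_dense[OF f[unfolded continuous_map_dual_iff] d(1)] by blast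
  have a: "approximable (\<lambda>\<psi>. of_real (p \<psi>))" by (rule approximable_trig_poly[OF p(1)])
  then have pL: "(\<lambda>\<psi>. complex_of_real (p \<psi>)) \<in> L2_fun \<mu>" by (simp add: approximable_def)
  have "(\<integral>\<psi>. (cmod (of_real (p \<psi>) - of_real (f \<psi>)))\<^sup>2 \<partial>\<mu>) \<le> (\<integral>\<psi>. d\<^sup>2 \<partial>\<mu>)"
  proof (rule integral_mono)
    fix \<psi> assume "\<psi> \<in> space \<mu>"
    then have "\<bar>p \<psi> - f \<psi>\<bar> \<le> d" using p(2)[of \<psi>] by (simp add: space_mu abs_minus_commute)
    then have "\<bar>p \<psi> - f \<psi>\<bar>\<^sup>2 \<le> d\<^sup>2" by (rule power_mono) simp
    then show "(cmod (of_real (p \<psi>) - of_real (f \<psi>)))\<^sup>2 \<le> d\<^sup>2"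
      by (simp flip: of_real_diff)
  qed (use L2_funD(2)[OF L2_fun_diff[OF pL fL]] in auto)
  then have "(\<integral>\<psi>. (cmod (of_real (p \<psi>) - of_real (f \<psi>)))\<^sup>2 \<partial>\<mu>) < e"
    using d \<open>0 < e\<close> by (simp add: mu.prob_space)
  then show "\<exists>h. approximable h \<and> (\<integral>\<psi>. (cmod (h \<psi> - of_real (f \<psi>)))\<^sup>2 \<partial>\<mu>) < e"
    using a by blast
qed

lemma approximable_indicator:
  assumes A: "A \<in> sets \<mu>"
  shows "approximable (indicator A)"
proof (rule approximable_limit)
  show "(indicator A :: _ \<Rightarrow> complex) \<in> L2_fun \<mu>"
    using A by (intro L2_fun_bound[OF L2_const[of 1], where c=1]) (auto simp: indicator_def)
  fix e :: real assume "0 < e"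
  obtain f where f: "continuous_map (dual_topology G) euclideanreal f"
    "(\<integral>\<psi>. (indicator A \<psi> - f \<psi>)\<^sup>2 \<partial>\<mu>) < e"
    using dual_space.indicator_approx[OF regular A \<open>0 < e\<close>] by blast
  have "(cmod (of_real (f \<psi>) - indicator A \<psi>))\<^sup>2 = (indicator A \<psi> - f \<psi>)\<^sup>2" for \<psi>
  proof -
    have "complex_of_real (f \<psi>) - indicator A \<psi> = of_real (f \<psi> - indicator A \<psi>)"
      by (simp add: indicator_def)
    then have "cmod (of_real (f \<psi>) - indicator A \<psi>) = \<bar>f \<psi> - indicator A \<psi>\<bar>"
      by (simp only: norm_of_real)
    then show ?thesis by (simp add: power2_commute)
  qed
  then have "(\<integral>\<psi>. (cmod (of_real (f \<psi>) - indicator A \<psi>))\<^sup>2 \<partial>\<mu>) < e" using f(2) by simp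
  then show "\<exists>h. approximable h \<and> (\<integral>\<psi>. (cmod (h \<psi> - indicator A \<psi>))\<^sup>2 \<partial>\<mu>) < e"
    using approximable_continuous[OF f(1)] by blast
qed

lemma approximable_simple:
  assumes s: "simple_function \<mu> s"
  shows "approximable s"
proof -
  have fin: "finite (s ` space \<mu>)" and meas: "\<And>y. s -` {y} \<inter> space \<mu> \<in> sets \<mu>"
    using s simple_functionD by auto
  have "approximable (\<lambda>\<psi>. \<Sum>y\<in>Y. y * indicator (s -` {y} \<inter> space \<mu>) \<psi>)" if "finite Y" for Y
    using that
  proof (induction rule: finite_induct)
    case empty
    have "approximable (\<lambda>\<psi>. 0 * indicator (space \<mu>) \<psi>)"
      by (intro approximable_scale approximable_indicator) simp
    then show ?case by simp
  next
    case (insert y Y)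
    show ?case
      unfolding sum.insert[OF insert.hyps]
      by (intro approximable_add approximable_scale approximable_indicator meas insert.IH)
  qed
  from this[OF fin] show ?thesis
  proof (rule approximable_cong)
    fix \<psi> assume p: "\<psi> \<in> dual G"
    have "(\<Sum>y\<in>s ` space \<mu>. y * indicator (s -` {y} \<inter> space \<mu>) \<psi>) =
        (\<Sum>y\<in>s ` space \<mu>. if y = s \<psi> then y else 0)"
      using p by (intro sum.cong) (auto simp: space_mu indicator_def)
    also have "\<dots> = s \<psi>" using fin p by (simp add: sum.delta' space_mu)
    finally show "(\<Sum>y\<in>s ` space \<mu>. y * indicator (s -` {y} \<inter> space \<mu>) \<psi>) = s \<psi>" .
  qed
qed

lemma approximable_L2:
  assumes f: "f \<in> L2_fun \<mu>"
  shows "approximable f"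
proof (rule approximable_limit[OF f])
  fix e :: real assume "0 < e"
  obtain s where s: "\<And>n. simple_function \<mu> (s n)" "\<And>n. s n \<in> L2_fun \<mu>"
    "(\<lambda>n. L2_dist2 \<mu> (s n) f) \<longlonglongrightarrow> 0"
    by (rule L2_simple_approx[OF f]) (rule that; simp)
  have "\<forall>\<^sub>F n in sequentially. L2_dist2 \<mu> (s n) f < e"
    using order_tendstoD(2)[OF s(3) \<open>0 < e\<close>] .
  then obtain n where "L2_dist2 \<mu> (s n) f < e"
    using eventually_happens'[OF sequentially_bot] by blast
  then show "\<exists>h. approximable h \<and> L2_dist2 \<mu> h f < e"
    using approximable_simple[OF s(1)] by blast
qed

text \<open>\<open>corr v f\<close> says that \<open>f\<close> represents \<open>v\<close> in the cyclic representation generated by \<open>x\<close>.\<close>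

definition corr :: "'h \<Rightarrow> (('g \<Rightarrow> complex) \<Rightarrow> complex) \<Rightarrow> bool" where
  "corr v f \<longleftrightarrow> f \<in> L2_fun \<mu> \<and>
     (\<forall>g\<in>carrier G. cinner v (P g x) = (\<integral>\<psi>. f \<psi> * cnj (\<psi> g) \<partial>\<mu>))"

lemma corr_L2: "corr v f \<Longrightarrow> f \<in> L2_fun \<mu>"
  by (simp add: corr_def)

lemma corr_eval: "corr v f \<Longrightarrow> g \<in> carrier G \<Longrightarrow> cinner v (P g x) = (\<integral>\<psi>. f \<psi> * cnj (\<psi> g) \<partial>\<mu>)"
  by (simp add: corr_def)

lemma corr_poly: "(v, p) \<in> poly_pairs \<Longrightarrow> corr v p"
  by (simp add: corr_def poly_pairs_L2 poly_pairs_inner_eval)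

lemma x_nonzero: "x \<noteq> 0"
  using x_norm by auto

text \<open>The difference is orthogonal to the whole orbit of \<open>x\<close>, which is
  separating.\<close>

lemma corr_unique:
  assumes "corr v f" "corr w f"
  shows "v = w"
proof -
  have "v - w = 0"
    by (rule fixed_separating[OF x_fixed x_nonzero])
      (use assms in \<open>simp add: corr_def cinner_diff_left\<close>)
  then show ?thesis by simp
qed

lemma corr_limit:
  assumes F: "\<And>n. corr (v n) (F n)" and f: "f \<in> L2_fun \<mu>" and v: "v \<longlonglongrightarrow> w"
    and lim: "(\<lambda>n. L2_dist2 \<mu> (F n) f) \<longlonglongrightarrow> 0"
  shows "corr w f"
  unfolding corr_def
proof (intro conjI ballI f)
  fix g assume g: "g \<in> carrier G"
  have "(\<lambda>n. cinner (v n) (P g x)) \<longlonglongrightarrow> (\<integral>\<psi>. f \<psi> * cnj (\<psi> g) \<partial>\<mu>)"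
    unfolding corr_eval[OF F g] by (rule L2_tendsto_inner[OF corr_L2[OF F] f L2_eval[OF g] lim])
  then show "cinner w (P g x) = (\<integral>\<psi>. f \<psi> * cnj (\<psi> g) \<partial>\<mu>)"
    using tendsto_cinner_left[OF v] LIMSEQ_unique by blast
qed

text \<open>Polynomials tending to \<open>f\<close> pair with vectors that form a Cauchy sequence,
  since the pairing is isometric. The norm identity is produced together with the vector;
  \<open>corr_unique\<close> then extends it to every corresponding pair.\<close>

lemma corr_exists_norm:
  assumes f: "f \<in> L2_fun \<mu>"
  obtains v where "corr v f" "(norm v)\<^sup>2 = L2_norm2 \<mu> f"
proof -
  have "\<exists>v p. (v, p) \<in> poly_pairs \<and> L2_dist2 \<mu> p f < 1 / real (Suc n)" for n
    by (rule approximableD[OF approximable_L2[OF f], of "1 / real (Suc n)"]) auto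
  then obtain v p where p: "\<And>n. (v n, p n) \<in> poly_pairs"
    "\<And>n. L2_dist2 \<mu> (p n) f < 1 / real (Suc n)" by metis
  note pL = poly_pairs_L2[OF p(1)]
  have lim: "(\<lambda>n. L2_dist2 \<mu> (p n) f) \<longlonglongrightarrow> 0"
  proof (rule tendsto_sandwich[OF _ _ tendsto_const])
    show "(\<lambda>n. 1 / real (Suc n)) \<longlonglongrightarrow> 0"
      using LIMSEQ_inverse_real_of_nat by (simp add: inverse_eq_divide)
    show "\<forall>\<^sub>F n in sequentially. L2_dist2 \<mu> (p n) f \<le> 1 / real (Suc n)"
      by (intro always_eventually allI less_imp_le p(2))
  qed simp
  have dist: "(norm (v m - v n))\<^sup>2 \<le> 2 / real (Suc m) + 2 / real (Suc n)" for m n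
  proof -
    have "(norm (v m - v n))\<^sup>2 = L2_dist2 \<mu> (p m) (p n)"
      by (rule poly_pairs_norm[OF poly_pairs_diff[OF p(1) p(1)]])
    also have "\<dots> \<le> 2 * L2_dist2 \<mu> (p m) f + 2 * L2_dist2 \<mu> f (p n)"
      by (rule L2_dist_triangle[OF pL f pL])
    also have "\<dots> \<le> 2 / real (Suc m) + 2 / real (Suc n)"
      using p(2)[of m] p(2)[of n] by (simp add: norm_minus_commute)
    finally show ?thesis .
  qed
  have "Cauchy v"
  proof (rule metric_CauchyI)
    fix e :: real assume "0 < e"
    \<comment> \<open>Makes each of the two terms of \<open>dist\<close> smaller than half of the
      square of \<open>e\<close>.\<close>
    obtain N :: nat where N: "4 / e\<^sup>2 < real N" using reals_Archimedean2 by blast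
    have N0: "0 < real N" using N \<open>0 < e\<close> by (smt (verit) divide_pos_pos zero_less_power)
    have small: "2 / real (Suc m) < e\<^sup>2 / 2" if "N \<le> m" for m
    proof -
      have "2 / real (Suc m) < 2 / real N" using that N0 by (intro divide_strict_left_mono) auto
      also have "\<dots> < e\<^sup>2 / 2" using N N0 \<open>0 < e\<close> by (simp add: field_simps)
      finally show ?thesis .
    qed
    have "dist (v m) (v n) < e" if "N \<le> m" "N \<le> n" for m n
    proof -
      have "(norm (v m - v n))\<^sup>2 < e\<^sup>2" using dist[of m n] small[OF that(1)] small[OF that(2)] by linarith
      then show ?thesis using \<open>0 < e\<close> by (simp add: dist_norm power2_less_imp_less)
    qed
    then show "\<exists>N. \<forall>m\<ge>N. \<forall>n\<ge>N. dist (v m) (v n) < e" by blast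
  qed
  then obtain w where w: "v \<longlonglongrightarrow> w" by (auto simp: Cauchy_convergent_iff convergent_def)
  have "(\<lambda>n. (norm (v n))\<^sup>2) \<longlonglongrightarrow> L2_norm2 \<mu> f"
    unfolding poly_pairs_norm[OF p(1)] by (rule L2_tendsto_norm[OF pL f lim])
  moreover have "(\<lambda>n. (norm (v n))\<^sup>2) \<longlonglongrightarrow> (norm w)\<^sup>2" by (intro tendsto_intros w)
  ultimately have "(norm w)\<^sup>2 = L2_norm2 \<mu> f" by (rule LIMSEQ_unique[rotated])
  then show thesis using that corr_limit[OF corr_poly[OF p(1)] f w lim] by blast
qed

lemma corr_norm:
  assumes "corr v f"
  shows "(norm v)\<^sup>2 = L2_norm2 \<mu> f"
proof -
  obtain w where w: "corr w f" "(norm w)\<^sup>2 = L2_norm2 \<mu> f"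
    using corr_exists_norm[OF corr_L2[OF assms]] by blast
  then show ?thesis using corr_unique[OF assms w(1)] by simp
qed

lemma corr_add:
  assumes "corr v f" "corr w h"
  shows "corr (v + w) (\<lambda>\<psi>. f \<psi> + h \<psi>)"
  unfolding corr_def
proof (intro conjI ballI)
  show "(\<lambda>\<psi>. f \<psi> + h \<psi>) \<in> L2_fun \<mu>" by (intro L2_fun_add corr_L2[OF assms(1)] corr_L2[OF assms(2)])
  fix g assume g: "g \<in> carrier G"
  show "cinner (v + w) (P g x) = (\<integral>\<psi>. (f \<psi> + h \<psi>) * cnj (\<psi> g) \<partial>\<mu>)"
    using L2_mult_integrable[OF corr_L2[OF assms(1)] L2_eval[OF g]]
      L2_mult_integrable[OF corr_L2[OF assms(2)] L2_eval[OF g]]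
    by (simp add: cinner_add_left distrib_right corr_eval[OF assms(1) g] corr_eval[OF assms(2) g])
qed

lemma corr_scale:
  assumes "corr v f"
  shows "corr (scaleC a v) (\<lambda>\<psi>. a * f \<psi>)"
  using assms by (simp add: corr_def L2_fun_scale cinner_scaleC_left mult.assoc)

lemma corr_diff:
  assumes "corr v f" "corr w h"
  shows "corr (v - w) (\<lambda>\<psi>. f \<psi> - h \<psi>)"
  using corr_add[OF assms(1) corr_scale[OF assms(2), of "-1"]] by (simp add: scaleC_minus_one)

text \<open>Polarisation of \<open>corr_norm\<close>. The imaginary part is the real part against
  \<open>\<i>\<close> times the second vector.\<close>

lemma corr_inner:
  assumes v: "corr v f" and w: "corr w h"
  shows "cinner v w = (\<integral>\<psi>. f \<psi> * cnj (h \<psi>) \<partial>\<mu>)"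
proof -
  have Re: "Re (cinner v w) = Re (\<integral>\<psi>. f \<psi> * cnj (h \<psi>) \<partial>\<mu>)" if w: "corr w h" for w h
  proof -
    note fL = corr_L2[OF v] and hL = corr_L2[OF w]
    note i = L2_mult_integrable[OF fL hL] L2_funD(2)[OF fL] L2_funD(2)[OF hL] L2_funD(2)[OF L2_fun_add[OF fL hL]]
    have pw: "Re (a * cnj b) = ((cmod (a + b))\<^sup>2 - (cmod a)\<^sup>2 - (cmod b)\<^sup>2) / 2" for a b :: complex
      by (simp only: cmod_power2) (simp add: power2_eq_square algebra_simps)
    have "Re (\<integral>\<psi>. f \<psi> * cnj (h \<psi>) \<partial>\<mu>) = (\<integral>\<psi>. Re (f \<psi> * cnj (h \<psi>)) \<partial>\<mu>)"
      by (rule integral_Re[OF i(1), symmetric])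
    also have "\<dots> = ((norm (v + w))\<^sup>2 - (norm v)\<^sup>2 - (norm w)\<^sup>2) / 2"
      unfolding pw corr_norm[OF corr_add[OF v w]] corr_norm[OF v] corr_norm[OF w] using i by simp
    finally show ?thesis by (simp add: Re_cinner)
  qed
  have "Im (cinner v w) = Re (\<integral>\<psi>. f \<psi> * cnj (\<i> * h \<psi>) \<partial>\<mu>)"
    unfolding Im_cinner by (rule Re[OF corr_scale[OF w]])
  also have "(\<integral>\<psi>. f \<psi> * cnj (\<i> * h \<psi>) \<partial>\<mu>) = (\<integral>\<psi>. - \<i> * (f \<psi> * cnj (h \<psi>)) \<partial>\<mu>)"
    by (intro Bochner_Integration.integral_cong) auto
  also have "\<dots> = - \<i> * (\<integral>\<psi>. f \<psi> * cnj (h \<psi>) \<partial>\<mu>)" by (rule integral_mult_right_zero)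
  finally have "Im (cinner v w) = Im (\<integral>\<psi>. f \<psi> * cnj (h \<psi>) \<partial>\<mu>)" by simp
  then show ?thesis using Re[OF w] by (simp add: complex_eq_iff)
qed

lemma corr_AE_iff:
  assumes "corr v f" "h \<in> L2_fun \<mu>"
  shows "corr v h \<longleftrightarrow> (AE \<psi> in \<mu>. f \<psi> = h \<psi>)"
proof
  assume "corr v h"
  then have "L2_dist2 \<mu> f h = 0"
    using corr_norm[OF corr_diff[OF assms(1), of v h]] by simp
  then have "AE \<psi> in \<mu>. f \<psi> - h \<psi> = 0"
    using L2_zero_iff[OF L2_fun_diff[OF corr_L2[OF assms(1)] assms(2)]] by simp
  then show "AE \<psi> in \<mu>. f \<psi> = h \<psi>" by simp
next
  assume ae: "AE \<psi> in \<mu>. f \<psi> = h \<psi>"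
  show "corr v h"
    unfolding corr_def
  proof (intro conjI ballI assms(2))
    fix g assume g: "g \<in> carrier G"
    have "(\<integral>\<psi>. f \<psi> * cnj (\<psi> g) \<partial>\<mu>) = (\<integral>\<psi>. h \<psi> * cnj (\<psi> g) \<partial>\<mu>)"
    proof (rule integral_cong_AE)
      show "(\<lambda>\<psi>. f \<psi> * cnj (\<psi> g)) \<in> borel_measurable \<mu>" "(\<lambda>\<psi>. h \<psi> * cnj (\<psi> g)) \<in> borel_measurable \<mu>"
        using L2_mult_integrable[OF corr_L2[OF assms(1)] L2_eval[OF g]]
          L2_mult_integrable[OF assms(2) L2_eval[OF g]] by auto
    qed (use ae in auto)
    then show "cinner v (P g x) = (\<integral>\<psi>. h \<psi> * cnj (\<psi> g) \<partial>\<mu>)" using corr_eval[OF assms(1) g] by simp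
  qed
qed

text \<open>Unitarity moves \<open>\<pi> (g, s)\<close> off \<open>v\<close> by replacing the orbit
  point of \<open>h\<close> with that of \<open>?h\<close>; invariance of \<open>\<mu>\<close> then
  allows the substitution of \<open>char_comp G \<alpha> s\<close> in the integral.\<close>

lemma corr_rep:
  assumes v: "corr v f" and g: "g \<in> carrier G" and s: "s \<in> carrier \<Gamma>"
  shows "corr (\<pi> (g, s) v) (\<lambda>\<psi>. \<psi> g * f (char_comp G \<alpha> s \<psi>))"
  unfolding corr_def
proof (intro conjI ballI)
  show L: "(\<lambda>\<psi>. \<psi> g * f (char_comp G \<alpha> s \<psi>)) \<in> L2_fun \<mu>"
    by (rule L2_mult_eval[OF L2_char_comp[OF s corr_L2[OF v]] g])
  fix h assume h: "h \<in> carrier G"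
  let ?h = "\<alpha> (inv\<^bsub>\<Gamma>\<^esub> s) (inv g \<otimes> h)"
  have ah: "\<alpha> s ?h = inv g \<otimes> h" using g h s by (simp add: act_act_inv)
  have "\<pi> (g, s) (P ?h x) = P h x"
    using g s h rep_P[of g s ?h x] fixedD[OF x_fixed s] by (simp add: ah m_assoc[symmetric])
  then have "cinner (\<pi> (g, s) v) (P h x) = cinner v (P ?h x)"
    using rep_cinner[OF g s, of v "P ?h x"] by simp
  also have "\<dots> = (\<integral>\<psi>. f \<psi> * cnj (\<psi> ?h) \<partial>\<mu>)" using g h s by (intro corr_eval[OF v]) simp
  also have "\<dots> = (\<integral>\<psi>. f (char_comp G \<alpha> s \<psi>) * cnj (char_comp G \<alpha> s \<psi> ?h) \<partial>\<mu>)"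
    using g h s L2_mult_integrable[OF corr_L2[OF v] L2_eval[of ?h]]
    by (intro integral_char_comp[OF s, symmetric]) auto
  also have "\<dots> = (\<integral>\<psi>. \<psi> g * f (char_comp G \<alpha> s \<psi>) * cnj (\<psi> h) \<partial>\<mu>)"
    using g h s
    by (intro Bochner_Integration.integral_cong)
      (auto simp: space_mu char_comp_apply ah dual_mult dual_inv)
  finally show "cinner (\<pi> (g, s) v) (P h x) = (\<integral>\<psi>. \<psi> g * f (char_comp G \<alpha> s \<psi>) * cnj (\<psi> h) \<partial>\<mu>)" .
qed

lemma corr_x: "corr x (\<lambda>_. 1)"
proof -
  have "corr (scaleC 1 (P \<one> x)) (\<lambda>\<psi>. 1 * \<psi> \<one>)"
    by (rule corr_poly[OF poly_pairs.monomial]) simp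
  then have "corr x (\<lambda>\<psi>. \<psi> \<one>)" by (simp add: scaleC_one rep_one)
  moreover have "AE \<psi> in \<mu>. \<psi> \<one> = 1" by (intro AE_I2) (simp add: space_mu dual_one)
  ultimately show ?thesis using corr_AE_iff[OF _ L2_const[of 1]] by blast
qed

text \<open>The represented vectors form an invariant subspace that contains \<open>x\<close>. It is
  closed because the correspondence is isometric and square-integrable functions are
  complete.\<close>

lemma corr_total: obtains f where "corr v f"
proof -
  define I where "I = {v. \<exists>f. corr v f}"
  have "complex_vector.subspace I"
  proof (rule complex_vector.subspaceI)
    show "0 \<in> I" using corr_scale[OF corr_x, of 0] by (auto simp: I_def)
  qed (auto simp: I_def intro: corr_add corr_scale)
  moreover have "closed I"
    unfolding closed_sequential_limits
  proof (intro allI impI)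
    fix X v assume X: "(\<forall>n. X n \<in> I) \<and> X \<longlonglongrightarrow> v"
    \<comment> \<open>Two errors of this size add up to at most (1/2)^n, whose square is the rate
      (1/4)^n that \<open>L2_complete\<close> asks for.\<close>
    have "\<exists>w f. corr w f \<and> norm (w - v) < (1/2) ^ n / 2" for n
    proof -
      have "\<forall>\<^sub>F k in sequentially. dist (X k) v < (1/2) ^ n / 2"
        using X by (intro tendstoD) auto
      then obtain k where "dist (X k) v < (1/2) ^ n / 2"
        using eventually_happens'[OF sequentially_bot] by blast
      moreover obtain f where "corr (X k) f" using X by (auto simp: I_def)
      ultimately show ?thesis by (intro exI[of _ "X k"] exI[of _ f]) (simp add: dist_norm)
    qed
    then obtain w F where wF: "\<And>n. corr (w n) (F n)" "\<And>n. norm (w n - v) < (1/2) ^ n / 2" by metis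
    have le: "L2_dist2 \<mu> (F n) (F m) \<le> (1/4) ^ n" if "n \<le> m" for n m
    proof -
      have half: "(1/2 :: real) ^ m \<le> (1/2) ^ n" using that by (rule power_decreasing) auto
      have "norm (w n - w m) \<le> norm (w n - v) + norm (w m - v)"
        using norm_triangle_ineq4[of "w n - v" "w m - v"] by simp
      also have "\<dots> \<le> (1/2) ^ n / 2 + (1/2) ^ m / 2" using wF(2)[of n] wF(2)[of m] by simp
      also have "\<dots> \<le> (1/2) ^ n" using half by linarith
      finally have "(norm (w n - w m))\<^sup>2 \<le> ((1/2) ^ n)\<^sup>2" by (rule power_mono) simp
      also have "((1/2 :: real) ^ n)\<^sup>2 = (1/4) ^ n"
        by (simp add: power2_eq_square flip: power_mult_distrib)
      finally show ?thesis using corr_norm[OF corr_diff[OF wF(1) wF(1)], of n m] by simp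
    qed
    have "\<exists>f. f \<in> L2_fun \<mu> \<and> (\<forall>n. L2_dist2 \<mu> (F n) f \<le> (1/4) ^ n)"
      by (rule L2_complete[OF mu.prob_space_axioms corr_L2[OF wF(1)] le], assumption) blast
    then obtain f where f: "f \<in> L2_fun \<mu>" "\<And>n. L2_dist2 \<mu> (F n) f \<le> (1/4) ^ n"
      by blast
    have lim: "(\<lambda>n. L2_dist2 \<mu> (F n) f) \<longlonglongrightarrow> 0"
    proof (rule tendsto_sandwich[OF _ _ tendsto_const])
      show "(\<lambda>n. (1/4 :: real) ^ n) \<longlonglongrightarrow> 0" by (rule LIMSEQ_realpow_zero) auto
    qed (use f(2) in auto)
    have "(\<lambda>n. norm (w n - v)) \<longlonglongrightarrow> 0"
    proof (rule tendsto_sandwich[OF _ _ tendsto_const])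
      show "(\<lambda>n. (1/2 :: real) ^ n / 2) \<longlonglongrightarrow> 0"
        by (rule tendsto_eq_intros LIMSEQ_realpow_zero | simp)+
      show "\<forall>\<^sub>F n in sequentially. norm (w n - v) \<le> (1/2) ^ n / 2"
        by (intro always_eventually allI less_imp_le wF(2))
    qed simp
    then have "w \<longlonglongrightarrow> v" by (simp add: tendsto_norm_zero_iff LIM_zero_iff)
    from corr_limit[OF wF(1) f(1) this lim] show "v \<in> I" by (auto simp: I_def)
  qed
  moreover have "\<pi> k ` I \<subseteq> I" if kK: "k \<in> carrier (semidirect G \<Gamma> \<alpha>)" for k
  proof (intro image_subsetI)
    fix v assume "v \<in> I"
    then obtain f where "corr v f" by (auto simp: I_def)
    moreover obtain g s where "k = (g, s)" "g \<in> carrier G" "s \<in> carrier \<Gamma>"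
      using kK by (auto simp: semidirect_def)
    ultimately show "\<pi> k v \<in> I" using corr_rep[of v f g s] by (auto simp: I_def)
  qed
  ultimately have "I = {0} \<or> I = UNIV"
    using irred by (simp add: irreducible_unitary_rep_def)
  moreover have "x \<in> I" using corr_x by (auto simp: I_def)
  ultimately have "I = UNIV" using x_nonzero by blast
  then show thesis using that by (auto simp: I_def)
qed

end

section \<open>Invariant vectors and ergodicity\<close>

context spectral
begin

lemma corr_T:
  assumes v: "corr v f" and s: "s \<in> carrier \<Gamma>"
  shows "corr (T s v) (\<lambda>\<psi>. f (char_comp G \<alpha> s \<psi>))"
proof -
  have "corr (T s v) (\<lambda>\<psi>. \<psi> \<one> * f (char_comp G \<alpha> s \<psi>))" by (rule corr_rep[OF v one_closed s])
  moreover have "AE \<psi> in \<mu>. \<psi> \<one> * f (char_comp G \<alpha> s \<psi>) = f (char_comp G \<alpha> s \<psi>)"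
    by (intro AE_I2) (simp add: space_mu dual_one)
  ultimately show ?thesis using corr_AE_iff[OF _ L2_char_comp[OF s corr_L2[OF v]]] by blast
qed

lemma fixed_iff_invariant:
  assumes v: "corr v f"
  shows "v \<in> fixed_space G \<Gamma> \<pi> \<longleftrightarrow> (\<forall>s\<in>carrier \<Gamma>. AE \<psi> in \<mu>. f (char_comp G \<alpha> s \<psi>) = f \<psi>)"
proof -
  have "T s v = v \<longleftrightarrow> (AE \<psi> in \<mu>. f (char_comp G \<alpha> s \<psi>) = f \<psi>)" if s: "s \<in> carrier \<Gamma>" for s
  proof -
    have "(AE \<psi> in \<mu>. f (char_comp G \<alpha> s \<psi>) = f \<psi>) \<longleftrightarrow> corr (T s v) f"
      using corr_AE_iff[OF corr_T[OF v s] corr_L2[OF v]] by simp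
    also have "\<dots> \<longleftrightarrow> T s v = v"
    proof
      assume "corr (T s v) f"
      then show "T s v = v" by (rule corr_unique[OF _ v])
    next
      assume "T s v = v"
      then show "corr (T s v) f" using v by simp
    qed
    finally show ?thesis by simp
  qed
  then show ?thesis by (auto simp: fixed_space_def)
qed

text \<open>The positive and the negative part of \<open>u - m\<close> represent invariant vectors, and the cyclic
  subspaces they generate are orthogonal; irreducibility forces one of them to vanish.\<close>

lemma invariant_real_const:
  fixes u :: "('g \<Rightarrow> complex) \<Rightarrow> real"
  assumes u: "(\<lambda>\<psi>. complex_of_real (u \<psi>)) \<in> L2_fun \<mu>"
    and inv: "\<And>s. s \<in> carrier \<Gamma> \<Longrightarrow> AE \<psi> in \<mu>. u (char_comp G \<alpha> s \<psi>) = u \<psi>"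
  shows "AE \<psi> in \<mu>. u \<psi> = (\<integral>\<psi>. u \<psi> \<partial>\<mu>)"
proof -
  define m where "m = (\<integral>\<psi>. u \<psi> \<partial>\<mu>)"
  have um [measurable]: "u \<in> borel_measurable \<mu>"
    using measurable_compose[OF L2_funD(1)[OF u] borel_measurable_Re] by simp
  have ui: "integrable \<mu> u"
    using integrable_Re[OF L2_mult_integrable[OF u L2_const[of 1]]] by simp
  define p n where "p = (\<lambda>\<psi>. complex_of_real (max (u \<psi> - m) 0))"
    and "n = (\<lambda>\<psi>. complex_of_real (max (m - u \<psi>) 0))"
  have d: "(\<lambda>\<psi>. complex_of_real (u \<psi>) - of_real m) \<in> L2_fun \<mu>"
    by (rule L2_fun_diff[OF u L2_const])
  have nd: "cmod (complex_of_real (u \<psi>) - of_real m) = \<bar>u \<psi> - m\<bar>" for \<psi>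
    by (simp only: of_real_diff[symmetric] norm_of_real)
  have pL: "p \<in> L2_fun \<mu>"
    by (rule L2_fun_bound[OF d, where c=1]) (auto simp: p_def nd intro!: AE_I2)
  have nL: "n \<in> L2_fun \<mu>"
    by (rule L2_fun_bound[OF d, where c=1]) (auto simp: n_def nd intro!: AE_I2)
  obtain v where v: "corr v p" using corr_exists_norm[OF pL] by blast
  obtain w where w: "corr w n" using corr_exists_norm[OF nL] by blast
  have vf: "v \<in> fixed_space G \<Gamma> \<pi>"
    unfolding fixed_iff_invariant[OF v]
  proof
    fix s assume "s \<in> carrier \<Gamma>"
    from inv[OF this] show "AE \<psi> in \<mu>. p (char_comp G \<alpha> s \<psi>) = p \<psi>"
      by eventually_elim (simp add: p_def)
  qed
  have "v = 0 \<or> w = 0"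
  proof (cases "v = 0")
    case False
    have "cinner w (P g v) = 0" if g: "g \<in> carrier G" for g
    proof -
      have "corr (P g v) (\<lambda>\<psi>. \<psi> g * p (char_comp G \<alpha> \<one>\<^bsub>\<Gamma>\<^esub> \<psi>))" by (rule corr_rep[OF v g Gam.one_closed])
      from corr_inner[OF w this]
      have "cinner w (P g v) = (\<integral>\<psi>. n \<psi> * cnj (\<psi> g * p (char_comp G \<alpha> \<one>\<^bsub>\<Gamma>\<^esub> \<psi>)) \<partial>\<mu>)" .
      also have "\<dots> = (\<integral>\<psi>. 0 \<partial>\<mu>)"
      \<comment> \<open>The identity of \<open>\<Gamma>\<close> moves no character, and at each
        character one of the positive and negative parts is 0.\<close>
      proof (rule Bochner_Integration.integral_cong[OF refl])
        fix \<psi> assume "\<psi> \<in> space \<mu>"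
        then have "\<psi> \<in> dual G" by (simp add: space_mu)
        then have "char_comp G \<alpha> \<one>\<^bsub>\<Gamma>\<^esub> \<psi> = \<psi>"
          by (intro extensionalityI[OF dual_extensional dual_extensional] char_comp_dual)
            (simp_all add: char_comp_apply act_one)
        then show "n \<psi> * cnj (\<psi> g * p (char_comp G \<alpha> \<one>\<^bsub>\<Gamma>\<^esub> \<psi>)) = 0"
          by (auto simp: n_def p_def max_def)
      qed
      finally show ?thesis by simp
    qed
    then show ?thesis using fixed_separating[OF vf False] by blast
  qed simp
  \<comment> \<open>So \<open>u\<close> lies on one side of its own mean almost everywhere; a
    nonnegative function with integral 0 vanishes almost everywhere.\<close>
  then have "(AE \<psi> in \<mu>. p \<psi> = 0) \<or> (AE \<psi> in \<mu>. n \<psi> = 0)"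
    using corr_norm[OF v] corr_norm[OF w] L2_zero_iff[OF pL] L2_zero_iff[OF nL] by auto
  then show ?thesis
  proof
    assume "AE \<psi> in \<mu>. p \<psi> = 0"
    then have le: "AE \<psi> in \<mu>. 0 \<le> m - u \<psi>"
      by eventually_elim (simp add: p_def max_def split: if_splits)
    have "(\<integral>\<psi>. m - u \<psi> \<partial>\<mu>) = 0" using ui by (simp add: m_def mu.prob_space)
    then have "AE \<psi> in \<mu>. m - u \<psi> = 0"
      using integral_nonneg_eq_0_iff_AE[OF _ le] ui by simp
    then show ?thesis by eventually_elim (simp add: m_def)
  next
    assume "AE \<psi> in \<mu>. n \<psi> = 0"
    then have le: "AE \<psi> in \<mu>. 0 \<le> u \<psi> - m"
      by eventually_elim (simp add: n_def max_def split: if_splits)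
    have "(\<integral>\<psi>. u \<psi> - m \<partial>\<mu>) = 0" using ui by (simp add: m_def mu.prob_space)
    then have "AE \<psi> in \<mu>. u \<psi> - m = 0"
      using integral_nonneg_eq_0_iff_AE[OF _ le] ui by simp
    then show ?thesis by eventually_elim (simp add: m_def)
  qed
qed

theorem fixed_multiple:
  assumes y: "y \<in> fixed_space G \<Gamma> \<pi>"
  obtains c where "y = scaleC c x"
proof -
  obtain f where f: "corr y f" by (rule corr_total)
  have inv: "AE \<psi> in \<mu>. f (char_comp G \<alpha> s \<psi>) = f \<psi>" if "s \<in> carrier \<Gamma>" for s
    using y that fixed_iff_invariant[OF f] by blast
  note fL = corr_L2[OF f] and fm [measurable] = L2_funD(1)[OF corr_L2[OF f]]
  have "AE \<psi> in \<mu>. Re (f \<psi>) = (\<integral>\<psi>. Re (f \<psi>) \<partial>\<mu>)"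
  proof (rule invariant_real_const)
    show "(\<lambda>\<psi>. complex_of_real (Re (f \<psi>))) \<in> L2_fun \<mu>"
      by (rule L2_fun_bound[OF fL, where c=1]) (auto simp: abs_Re_le_cmod)
    fix s assume "s \<in> carrier \<Gamma>"
    from inv[OF this] show "AE \<psi> in \<mu>. Re (f (char_comp G \<alpha> s \<psi>)) = Re (f \<psi>)" by eventually_elim simp
  qed
  moreover have "AE \<psi> in \<mu>. Im (f \<psi>) = (\<integral>\<psi>. Im (f \<psi>) \<partial>\<mu>)"
  proof (rule invariant_real_const)
    show "(\<lambda>\<psi>. complex_of_real (Im (f \<psi>))) \<in> L2_fun \<mu>"
      by (rule L2_fun_bound[OF fL, where c=1]) (auto simp: abs_Im_le_cmod)
    fix s assume "s \<in> carrier \<Gamma>"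
    from inv[OF this] show "AE \<psi> in \<mu>. Im (f (char_comp G \<alpha> s \<psi>)) = Im (f \<psi>)" by eventually_elim simp
  qed
  ultimately have "AE \<psi> in \<mu>. f \<psi> = Complex (\<integral>\<psi>. Re (f \<psi>) \<partial>\<mu>) (\<integral>\<psi>. Im (f \<psi>) \<partial>\<mu>) * 1"
    by eventually_elim (simp add: complex_eq_iff)
  then have "corr y (\<lambda>\<psi>. Complex (\<integral>\<psi>. Re (f \<psi>) \<partial>\<mu>) (\<integral>\<psi>. Im (f \<psi>) \<partial>\<mu>) * 1)"
    using corr_AE_iff[OF f L2_const] by blast
  then have "y = scaleC (Complex (\<integral>\<psi>. Re (f \<psi>) \<partial>\<mu>) (\<integral>\<psi>. Im (f \<psi>) \<partial>\<mu>)) x"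
    by (rule corr_unique[OF _ corr_scale[OF corr_x]])
  then show thesis by (rule that)
qed

text \<open>The density \<open>h\<close> of \<open>\<nu>\<close> is invariant because densities are
  unique. Its truncations are bounded, hence constant almost everywhere by
  \<open>invariant_real_const\<close>; \<open>h\<close> is their supremum, so it is constant too,
  and total mass 1 makes the constant 1.\<close>

lemma invariant_ac_unique:
  assumes \<nu>: "\<nu> \<in> invariant_measures G \<Gamma> \<alpha>" and ac: "absolutely_continuous \<mu> \<nu>"
  shows "\<nu> = \<mu>"
proof -
  have sets_\<nu>: "sets \<nu> = sets \<mu>"
    using \<nu> sets_mu by (simp add: invariant_measures_def regular_borel_prob_def)
  interpret nu: prob_space \<nu> using \<nu> by (simp add: invariant_measures_def regular_borel_prob_def)
  obtain h where h [measurable]: "h \<in> borel_measurable \<mu>" and dens: "density \<mu> h = \<nu>"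
    using mu.Radon_Nikodym[OF ac sets_\<nu>] by blast
  have inv: "AE \<psi> in \<mu>. h (char_comp G \<alpha> s \<psi>) = h \<psi>" if s: "s \<in> carrier \<Gamma>" for s
  proof -
    have cm: "char_comp G \<alpha> s \<in> measurable \<mu> \<mu>"
      using measurable_char_comp_mu[OF s] measurable_cong_sets[OF refl sets_mu] by blast
    have hc [measurable]: "(\<lambda>\<psi>. h (char_comp G \<alpha> s \<psi>)) \<in> borel_measurable \<mu>"
      by (rule measurable_compose[OF cm h])
    have si: "inv\<^bsub>\<Gamma>\<^esub> s \<in> carrier \<Gamma>" using s by simp
    have cm': "char_comp G \<alpha> (inv\<^bsub>\<Gamma>\<^esub> s) \<in> measurable \<mu> \<mu>"
      using measurable_char_comp_mu[OF si] measurable_cong_sets[OF refl sets_mu] by blast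
    \<comment> \<open>Substituting in \<open>\<mu>\<close> turns the mass of \<open>A\<close> under
      the moved density into the \<open>\<nu>\<close>-mass of \<open>?B\<close>, the preimage of
      \<open>A\<close> under the inverse of \<open>s\<close>; invariance of \<open>\<nu>\<close>
      gives back the mass of \<open>A\<close>.\<close>
    have "density \<mu> (\<lambda>\<psi>. h (char_comp G \<alpha> s \<psi>)) = \<nu>"
    proof (rule measure_eqI)
      show "sets (density \<mu> (\<lambda>\<psi>. h (char_comp G \<alpha> s \<psi>))) = sets \<nu>" using sets_\<nu> by simp
      fix A assume "A \<in> sets (density \<mu> (\<lambda>\<psi>. h (char_comp G \<alpha> s \<psi>)))"
      then have A [measurable]: "A \<in> sets \<mu>" by simp
      let ?B = "char_comp G \<alpha> (inv\<^bsub>\<Gamma>\<^esub> s) -` A \<inter> space \<mu>"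
      have B [measurable]: "?B \<in> sets \<mu>" by (rule measurable_sets[OF cm' A])
      have "emeasure (density \<mu> (\<lambda>\<psi>. h (char_comp G \<alpha> s \<psi>))) A =
          (\<integral>\<^sup>+\<psi>. h (char_comp G \<alpha> s \<psi>) * indicator A \<psi> \<partial>\<mu>)"
        by (rule emeasure_density[OF hc A])
      also have "\<dots> = (\<integral>\<^sup>+\<psi>. h (char_comp G \<alpha> s \<psi>) * indicator ?B (char_comp G \<alpha> s \<psi>) \<partial>\<mu>)"
        by (intro nn_integral_cong)
          (simp add: space_mu indicator_def char_comp_inverse(2)[OF s] char_comp_dual[OF s])
      also have "\<dots> = (\<integral>\<^sup>+\<psi>. h \<psi> * indicator ?B \<psi> \<partial>distr \<mu> \<mu> (char_comp G \<alpha> s))"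
        by (rule nn_integral_distr[OF cm, symmetric]) measurable
      also have "distr \<mu> \<mu> (char_comp G \<alpha> s) = \<mu>"
        using distr_mu[OF s] distr_cong[OF refl sets_mu] by metis
      also have "(\<integral>\<^sup>+\<psi>. h \<psi> * indicator ?B \<psi> \<partial>\<mu>) = emeasure \<nu> ?B"
        unfolding dens[symmetric] by (rule emeasure_density[OF h B, symmetric])
      also have "\<dots> = emeasure (distr \<nu> (borel_algebra (dual_topology G)) (char_comp G \<alpha> (inv\<^bsub>\<Gamma>\<^esub> s))) A"
        using A sets_mu sets_\<nu> sets_eq_imp_space_eq[OF sets_\<nu>]
        by (subst emeasure_distr[OF measurable_char_comp_sets[OF _ si]]) auto
      also have "\<dots> = emeasure \<nu> A" by (simp only: invariant_distr[OF \<nu> si])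
      finally show "emeasure (density \<mu> (\<lambda>\<psi>. h (char_comp G \<alpha> s \<psi>))) A = emeasure \<nu> A" .
    qed
    then show ?thesis using mu.density_unique_iff[OF hc h] dens by simp
  qed
  have "\<exists>c. AE \<psi> in \<mu>. min (h \<psi>) (of_nat k) = c" for k :: nat
  proof -
    define u where "u = (\<lambda>\<psi>. enn2real (min (h \<psi>) (of_nat k)))"
    have "AE \<psi> in \<mu>. u \<psi> = (\<integral>\<psi>. u \<psi> \<partial>\<mu>)"
    proof (rule invariant_real_const)
      have "u \<psi> \<le> real k" for \<psi>
      proof -
        have "min (h \<psi>) (of_nat k) \<le> ennreal (real k)" by (simp add: ennreal_of_nat_eq_real_of_nat)
        then show ?thesis unfolding u_def by (rule enn2real_leI[rotated]) simp
      qed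
      moreover have "0 \<le> u \<psi>" for \<psi> by (simp add: u_def)
      moreover have "u \<in> borel_measurable \<mu>" unfolding u_def by measurable
      ultimately show "(\<lambda>\<psi>. complex_of_real (u \<psi>)) \<in> L2_fun \<mu>"
        by (intro L2_fun_bound[OF L2_const[of 1], where c="real k"]) auto
      fix s assume "s \<in> carrier \<Gamma>"
      from inv[OF this] show "AE \<psi> in \<mu>. u (char_comp G \<alpha> s \<psi>) = u \<psi>"
        by eventually_elim (simp add: u_def)
    qed
    then have "AE \<psi> in \<mu>. min (h \<psi>) (of_nat k) = ennreal (\<integral>\<psi>. u \<psi> \<partial>\<mu>)"
    proof eventually_elim
      case (elim \<psi>)
      have "min (h \<psi>) (of_nat k) < \<infinity>"
        by (simp add: min_less_iff_disj ennreal_of_nat_eq_real_of_nat)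
      then have "ennreal (u \<psi>) = min (h \<psi>) (of_nat k)"
        unfolding u_def by (intro ennreal_enn2real) simp
      then show ?case unfolding elim[symmetric] by simp
    qed
    then show ?thesis by blast
  qed
  then obtain c where "\<And>k. AE \<psi> in \<mu>. min (h \<psi>) (of_nat k) = c k" by metis
  then have "AE \<psi> in \<mu>. \<forall>k. min (h \<psi>) (of_nat k) = c k" by (simp add: AE_all_countable)
  then have const: "AE \<psi> in \<mu>. h \<psi> = (SUP k. c k)"
  proof eventually_elim
    case (elim \<psi>)
    have "(SUP k. c k) = (SUP k. inf (h \<psi>) (of_nat k))" using elim by (simp add: inf_min)
    also have "\<dots> = inf (h \<psi>) (SUP k::nat. of_nat k)" by (rule inf_SUP[symmetric])
    also have "\<dots> = h \<psi>" by (simp add: ennreal_SUP_of_nat_eq_top)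
    finally show ?case by simp
  qed
  then have "\<nu> = density \<mu> (\<lambda>_. SUP k. c k)"
    unfolding dens[symmetric] by (intro density_cong) auto
  then have e: "emeasure \<nu> A = (SUP k. c k) * emeasure \<mu> A" if "A \<in> sets \<mu>" for A
    using that by (simp add: emeasure_density_const)
  from e[of "space \<mu>"] have "(SUP k. c k) = 1"
    using mu.emeasure_space_1 nu.emeasure_space_1 sets_eq_imp_space_eq[OF sets_\<nu>] by simp
  then show ?thesis using e sets_\<nu> by (intro measure_eqI) auto
qed

text \<open>Both weights are positive, so a null set of \<open>\<mu>\<close> is null for both
  components; absolutely continuous invariant measures coincide with \<open>\<mu>\<close>.\<close>

theorem mu_ergodic: "\<mu> \<in> ergodic_measures G \<Gamma> \<alpha>"
  unfolding ergodic_measures_def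
proof (intro CollectI conjI ballI impI mu_invariant)
  fix \<nu>\<^sub>1 \<nu>\<^sub>2 and t :: real
  assume \<nu>: "\<nu>\<^sub>1 \<in> invariant_measures G \<Gamma> \<alpha>" "\<nu>\<^sub>2 \<in> invariant_measures G \<Gamma> \<alpha>" and t: "t \<in> {0<..<1}"
    and eq: "\<forall>A\<in>sets \<mu>. measure \<mu> A = (1 - t) * measure \<nu>\<^sub>1 A + t * measure \<nu>\<^sub>2 A"
  have p: "prob_space \<nu>" "sets \<nu> = sets \<mu>" if "\<nu> \<in> invariant_measures G \<Gamma> \<alpha>" for \<nu>
    using that sets_mu by (auto simp: invariant_measures_def regular_borel_prob_def)
  have ac: "absolutely_continuous \<mu> \<nu>"
    if "\<nu> \<in> invariant_measures G \<Gamma> \<alpha>" "\<And>A. A \<in> sets \<mu> \<Longrightarrow> measure \<mu> A = 0 \<Longrightarrow> measure \<nu> A = 0" for \<nu>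
  proof -
    interpret nu: prob_space \<nu> using p[OF that(1)] by simp
    show ?thesis
      unfolding absolutely_continuous_def null_sets_def
      using that(2) p(2)[OF that(1)] by (auto simp: mu.emeasure_eq_measure nu.emeasure_eq_measure)
  qed
  have z: "measure \<nu>\<^sub>1 A = 0 \<and> measure \<nu>\<^sub>2 A = 0" if "A \<in> sets \<mu>" "measure \<mu> A = 0" for A
  proof -
    have "(1 - t) * measure \<nu>\<^sub>1 A + t * measure \<nu>\<^sub>2 A = 0" using eq that by simp
    moreover have "0 \<le> (1 - t) * measure \<nu>\<^sub>1 A" "0 \<le> t * measure \<nu>\<^sub>2 A" using t by auto
    ultimately have "(1 - t) * measure \<nu>\<^sub>1 A = 0" "t * measure \<nu>\<^sub>2 A = 0" by linarith+
    then show ?thesis using t by auto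
  qed
  have "\<nu>\<^sub>1 = \<mu>" by (rule invariant_ac_unique[OF \<nu>(1) ac[OF \<nu>(1)]]) (use z in blast)
  moreover have "\<nu>\<^sub>2 = \<mu>" by (rule invariant_ac_unique[OF \<nu>(2) ac[OF \<nu>(2)]]) (use z in blast)
  ultimately show "\<nu>\<^sub>1 = \<nu>\<^sub>2" by simp
qed

end

section \<open>Unitary equivalence\<close>

lemma L2_rel_iff: "(f, g) \<in> L2_rel M \<longleftrightarrow> f \<in> L2_fun M \<and> g \<in> L2_fun M \<and> (AE x in M. f x = g x)"
  by (simp add: L2_rel_def)

lemma equiv_L2_rel: "equiv (L2_fun M) (L2_rel M)"
proof (rule equivI)
  show "L2_rel M \<subseteq> L2_fun M \<times> L2_fun M" by (auto simp: L2_rel_def)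
  show "refl_on (L2_fun M) (L2_rel M)" by (auto simp: refl_on_def L2_rel_def)
  show "sym (L2_rel M)"
  proof (rule symI)
    fix f g assume "(f, g) \<in> L2_rel M"
    then have "f \<in> L2_fun M" "g \<in> L2_fun M" "AE x in M. f x = g x" by (auto simp: L2_rel_iff)
    moreover from this(3) have "AE x in M. g x = f x" by eventually_elim simp
    ultimately show "(g, f) \<in> L2_rel M" by (simp add: L2_rel_iff)
  qed
  show "trans (L2_rel M)"
  proof (rule transI)
    fix f g h assume "(f, g) \<in> L2_rel M" "(g, h) \<in> L2_rel M"
    then have "f \<in> L2_fun M" "h \<in> L2_fun M" "AE x in M. f x = g x" "AE x in M. g x = h x"
      by (auto simp: L2_rel_iff)
    moreover from this(3,4) have "AE x in M. f x = h x" by eventually_elim simp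
    ultimately show "(f, h) \<in> L2_rel M" by (simp add: L2_rel_iff)
  qed
qed

lemma L2_class_eq: "(f, g) \<in> L2_rel M \<Longrightarrow> L2_rel M `` {f} = L2_rel M `` {g}"
  by (rule equiv_class_eq[OF equiv_L2_rel])

lemma L2_class_self: "f \<in> L2_fun M \<Longrightarrow> f \<in> L2_rel M `` {f}"
  by (rule equiv_class_self[OF equiv_L2_rel])

text \<open>\<open>L2_lift\<close> unites the classes over all representatives; compatibility with
  almost everywhere equality makes them one class.\<close>

lemma L2_lift_class:
  assumes f: "f \<in> L2_fun M" and T: "\<And>h. (f, h) \<in> L2_rel M \<Longrightarrow> (S f, S h) \<in> L2_rel M"
  shows "L2_lift M S (L2_rel M `` {f}) = L2_rel M `` {S f}"
proof -
  have "L2_rel M `` {S h} = L2_rel M `` {S f}" if "h \<in> L2_rel M `` {f}" for h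
    using L2_class_eq[OF T] that by auto
  then have "L2_lift M S (L2_rel M `` {f}) = (\<Union>h\<in>L2_rel M `` {f}. L2_rel M `` {S f})"
    unfolding L2_lift_def by (rule SUP_cong[OF refl])
  then show ?thesis using L2_class_self[OF f] by auto
qed

lemma L2_inner_class:
  assumes f: "f \<in> L2_fun M" and g: "g \<in> L2_fun M"
  shows "L2_inner M (L2_rel M `` {f}) (L2_rel M `` {g}) = (\<integral>x. f x * cnj (g x) \<partial>M)"
proof -
  have "(\<integral>x. f' x * cnj (g' x) \<partial>M) = (\<integral>x. f x * cnj (g x) \<partial>M)"
    if "f' \<in> L2_rel M `` {f}" "g' \<in> L2_rel M `` {g}" for f' g'
  proof (rule integral_cong_AE)
    have *: "f' \<in> L2_fun M" "g' \<in> L2_fun M" "AE x in M. f x = f' x" "AE x in M. g x = g' x"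
      using that by (auto simp: L2_rel_iff)
    show "(\<lambda>x. f' x * cnj (g' x)) \<in> borel_measurable M"
      by (rule borel_measurable_integrable[OF L2_mult_integrable[OF *(1,2)]])
    show "(\<lambda>x. f x * cnj (g x)) \<in> borel_measurable M"
      by (rule borel_measurable_integrable[OF L2_mult_integrable[OF f g]])
    from *(3,4) show "AE x in M. f' x * cnj (g' x) = f x * cnj (g x)" by eventually_elim simp
  qed
  then have "(\<Union>f'\<in>L2_rel M `` {f}. \<Union>g'\<in>L2_rel M `` {g}. {\<integral>x. f' x * cnj (g' x) \<partial>M}) =
      (\<Union>f'\<in>L2_rel M `` {f}. \<Union>g'\<in>L2_rel M `` {g}. {\<integral>x. f x * cnj (g x) \<partial>M})"
    by (intro SUP_cong refl) simp
  also have "\<dots> = {\<integral>x. f x * cnj (g x) \<partial>M}"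
    using L2_class_self[OF f] L2_class_self[OF g] by auto
  finally show ?thesis by (simp add: L2_inner_def)
qed

context spectral
begin

text \<open>All functions that represent \<open>v\<close> together are its L2 class, so the unitary
  needs no choice of representative.\<close>

definition vector_class :: "'h \<Rightarrow> (('g \<Rightarrow> complex) \<Rightarrow> complex) set" where
  "vector_class v = {f. corr v f}"

lemma vector_class_eq:
  assumes f: "corr v f"
  shows "vector_class v = L2_rel \<mu> `` {f}"
proof (rule Set.set_eqI)
  fix h
  show "h \<in> vector_class v \<longleftrightarrow> h \<in> L2_rel \<mu> `` {f}"
  proof (cases "h \<in> L2_fun \<mu>")
    case True
    then show ?thesis
      using corr_AE_iff[OF f True] corr_L2[OF f] by (simp add: vector_class_def L2_rel_iff)
  next
    case False
    then show ?thesis using corr_L2[of v h] by (auto simp: vector_class_def L2_rel_iff)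
  qed
qed

lemma vector_class_nonempty: "vector_class v \<noteq> {}"
proof -
  obtain f where "corr v f" by (rule corr_total)
  then show ?thesis by (auto simp: vector_class_def)
qed

lemma bij_vector_class: "bij_betw vector_class UNIV (L2 \<mu>)"
  unfolding bij_betw_def
proof
  show "inj vector_class"
  proof (rule injI)
    fix v w assume eq: "vector_class v = vector_class w"
    obtain f where "corr v f" by (rule corr_total)
    moreover from this have "corr w f" using eq by (auto simp: vector_class_def)
    ultimately show "v = w" by (rule corr_unique)
  qed
  show "range vector_class = L2 \<mu>"
  proof
    show "range vector_class \<subseteq> L2 \<mu>"
    proof
      fix F assume "F \<in> range vector_class"
      then obtain v where v: "F = vector_class v" by blast
      obtain f where f: "corr v f" by (rule corr_total)
      show "F \<in> L2 \<mu>"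
        unfolding v vector_class_eq[OF f] L2_def by (rule quotientI[OF corr_L2[OF f]])
    qed
    show "L2 \<mu> \<subseteq> range vector_class"
    proof
      fix F assume "F \<in> L2 \<mu>"
      then obtain f where f: "f \<in> L2_fun \<mu>" "F = L2_rel \<mu> `` {f}"
        unfolding L2_def by (rule quotientE)
      obtain v where "corr v f" using corr_exists_norm[OF f(1)] by blast
      then show "F \<in> range vector_class" using vector_class_eq f(2) by blast
    qed
  qed
qed

lemma unitary_vector_class: "unitary_onto_L2 \<mu> vector_class"
  unfolding unitary_onto_L2_def
proof (intro conjI allI bij_vector_class)
  fix v w
  show "vector_class (v + w) = L2_add \<mu> (vector_class v) (vector_class w)"
  proof -
    have "L2_rel \<mu> `` {\<lambda>\<psi>. f \<psi> + h \<psi>} = vector_class (v + w)"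
      if "f \<in> vector_class v" "h \<in> vector_class w" for f h
      using that corr_add[of v f w h] vector_class_eq by (simp add: vector_class_def)
    then have "L2_add \<mu> (vector_class v) (vector_class w) =
        (\<Union>f\<in>vector_class v. \<Union>h\<in>vector_class w. vector_class (v + w))"
      unfolding L2_add_def by simp
    then show ?thesis using vector_class_nonempty by simp
  qed
  obtain f where f: "corr v f" by (rule corr_total)
  obtain h where h: "corr w h" by (rule corr_total)
  show "L2_inner \<mu> (vector_class v) (vector_class w) = cinner v w"
    unfolding vector_class_eq[OF f] vector_class_eq[OF h] corr_inner[OF f h]
    by (rule L2_inner_class[OF corr_L2[OF f] corr_L2[OF h]])
next
  fix a v
  have "L2_rel \<mu> `` {\<lambda>\<psi>. a * f \<psi>} = vector_class (scaleC a v)" if "f \<in> vector_class v" for f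
    using that corr_scale[of v f a] vector_class_eq by (simp add: vector_class_def)
  then have "L2_scale \<mu> a (vector_class v) = (\<Union>f\<in>vector_class v. vector_class (scaleC a v))"
    unfolding L2_scale_def L2_lift_def by simp
  then show "vector_class (scaleC a v) = L2_scale \<mu> a (vector_class v)"
    using vector_class_nonempty by simp
qed

theorem equivalent_rho: "unitarily_equivalent_L2 (semidirect G \<Gamma> \<alpha>) \<pi> \<mu> (rho G \<alpha> \<mu>)"
  unfolding unitarily_equivalent_L2_def
proof (rule exI[of _ vector_class], intro conjI ballI allI)
  show "unitary_onto_L2 \<mu> vector_class" by (rule unitary_vector_class)
  fix k v assume "k \<in> carrier (semidirect G \<Gamma> \<alpha>)"
  then obtain g s where k: "k = (g, s)" "g \<in> carrier G" "s \<in> carrier \<Gamma>"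
    by (auto simp: semidirect_def)
  have "L2_rel \<mu> `` {\<lambda>\<psi>. \<psi> g * f (char_comp G \<alpha> s \<psi>)} = vector_class (\<pi> k v)"
    if "f \<in> vector_class v" for f
    using that corr_rep[OF _ k(2,3), of v f] vector_class_eq k(1) by (simp add: vector_class_def)
  then have "rho G \<alpha> \<mu> k (vector_class v) = (\<Union>f\<in>vector_class v. vector_class (\<pi> k v))"
    unfolding rho_def k(1) prod.case L2_lift_def by simp
  then show "vector_class (\<pi> k v) = rho G \<alpha> \<mu> k (vector_class v)"
    using vector_class_nonempty by simp
qed

end

text \<open>Stated for any invariant measure, since uniqueness applies it to the competitor
  \<open>\<nu>\<close>. Invariance is what keeps a representative of the class of 1 equal to 1
  almost everywhere after composing with the action.\<close>

lemma (in auto_action) rho_constant_class: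
  assumes \<nu>: "\<nu> \<in> invariant_measures G \<Gamma> \<alpha>" and g: "g \<in> carrier G" and s: "s \<in> carrier \<Gamma>"
  shows "rho G \<alpha> \<nu> (g, s) (L2_rel \<nu> `` {\<lambda>_. 1}) = L2_rel \<nu> `` {\<lambda>\<psi>. \<psi> g}"
    and "(\<lambda>\<psi>. \<psi> g) \<in> L2_fun \<nu>"
proof -
  have reg: "regular_borel_prob (dual_topology G) \<nu>" using \<nu> by (simp add: invariant_measures_def)
  have sets: "sets \<nu> = sets (borel_algebra (dual_topology G))" using reg by (simp add: regular_borel_prob_def)
  have space: "space \<nu> = dual G" using regular_borel_prob_space[OF reg] topspace_dual by simp
  interpret prob_space \<nu> using reg by (simp add: regular_borel_prob_def)
  have one: "(\<lambda>_. 1) \<in> L2_fun \<nu>" by (simp add: L2_fun_def)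
  have ev: "(\<lambda>\<psi>. \<psi> g) \<in> borel_measurable \<nu>"
    by (rule continuous_map_borel_measurable[OF continuous_eval sets])
  show L: "(\<lambda>\<psi>. \<psi> g) \<in> L2_fun \<nu>"
    by (rule L2_fun_bound[OF one ev, where c=1]) (use g in \<open>auto intro!: AE_I2 simp: space dual_in_sphere\<close>)
  have "L2_lift \<nu> (\<lambda>f \<psi>. \<psi> g * f (char_comp G \<alpha> s \<psi>)) (L2_rel \<nu> `` {\<lambda>_. 1}) = L2_rel \<nu> `` {\<lambda>\<psi>. \<psi> g * 1}"
  proof (rule L2_lift_class[OF one])
    fix h assume "((\<lambda>_. 1), h) \<in> L2_rel \<nu>"
    then have h: "h \<in> L2_fun \<nu>" "AE \<psi> in \<nu>. 1 = h \<psi>" by (auto simp: L2_rel_iff)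
    have ae: "AE \<psi> in \<nu>. \<psi> g * 1 = \<psi> g * h (char_comp G \<alpha> s \<psi>)"
      using invariant_AE[OF \<nu> s h(2)] by eventually_elim simp
    have "h \<in> borel_measurable (borel_algebra (dual_topology G))"
      using L2_funD(1)[OF h(1)] measurable_cong_sets[OF sets refl] by blast
    from measurable_compose[OF measurable_char_comp_sets[OF sets s] this]
    have m: "(\<lambda>\<psi>. \<psi> g * h (char_comp G \<alpha> s \<psi>)) \<in> borel_measurable \<nu>"
      by (intro borel_measurable_times ev)
    have "(\<lambda>\<psi>. \<psi> g * h (char_comp G \<alpha> s \<psi>)) \<in> L2_fun \<nu>"
    proof (rule L2_fun_bound[OF L m, where c=1])
      show "AE \<psi> in \<nu>. cmod (\<psi> g * h (char_comp G \<alpha> s \<psi>)) \<le> 1 * cmod (\<psi> g)"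
        using ae by eventually_elim (auto simp: norm_mult)
    qed
    then show "((\<lambda>\<psi>. \<psi> g * 1), (\<lambda>\<psi>. \<psi> g * h (char_comp G \<alpha> s \<psi>))) \<in> L2_rel \<nu>"
      using L ae by (simp add: L2_rel_iff)
  qed
  then show "rho G \<alpha> \<nu> (g, s) (L2_rel \<nu> `` {\<lambda>_. 1}) = L2_rel \<nu> `` {\<lambda>\<psi>. \<psi> g}"
    by (simp add: rho_def)
qed

context spectral
begin

text \<open>The vector corresponding to the constant function \<open>1\<close> is a unit vector in the fixed space, so
  it agrees with \<open>x\<close> up to a phase and the Fourier coefficients of \<open>\<nu>\<close> are those of \<open>\<mu>\<close>.\<close>

theorem spectral_measure_unique:
  assumes \<nu>: "\<nu> \<in> invariant_measures G \<Gamma> \<alpha>"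
    and eqv: "unitarily_equivalent_L2 (semidirect G \<Gamma> \<alpha>) \<pi> \<nu> (rho G \<alpha> \<nu>)"
  shows "\<nu> = \<mu>"
proof -
  have reg: "regular_borel_prob (dual_topology G) \<nu>" using \<nu> by (simp add: invariant_measures_def)
  interpret nu: prob_space \<nu> using reg by (simp add: regular_borel_prob_def)
  obtain U where U: "unitary_onto_L2 \<nu> U"
    and int: "\<And>k v. k \<in> carrier (semidirect G \<Gamma> \<alpha>) \<Longrightarrow> U (\<pi> k v) = rho G \<alpha> \<nu> k (U v)"
    using eqv unfolding unitarily_equivalent_L2_def by blast
  have bij: "bij_betw U UNIV (L2 \<nu>)" and inner: "\<And>v w. cinner v w = L2_inner \<nu> (U v) (U w)"
    using U by (auto simp: unitary_onto_L2_def)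
  have one: "(\<lambda>_. 1) \<in> L2_fun \<nu>" by (simp add: L2_fun_def)
  let ?e = "L2_rel \<nu> `` {\<lambda>_. 1}"
  have "?e \<in> L2 \<nu>" unfolding L2_def by (rule quotientI[OF one])
  then obtain v where v: "U v = ?e" using bij unfolding bij_betw_def by (metis imageE)
  have Uact: "U (\<pi> (g, s) v) = L2_rel \<nu> `` {\<lambda>\<psi>. \<psi> g}" if "g \<in> carrier G" "s \<in> carrier \<Gamma>" for g s
    using int[of "(g, s)" v] rho_constant_class(1)[OF \<nu> that] v that by (simp add: semidirect_def)
  have "T s v = v" if s: "s \<in> carrier \<Gamma>" for s
  proof -
    \<comment> \<open>The class of 1 is sent to the class of evaluation at the identity, which is 1
      at every character; hence \<open>v\<close> is fixed.\<close>
    have "((\<lambda>\<psi>. \<psi> \<one>), (\<lambda>_. 1)) \<in> L2_rel \<nu>"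
      using rho_constant_class(2)[OF \<nu> one_closed s] one regular_borel_prob_space[OF reg]
      by (auto simp: L2_rel_iff topspace_dual dual_one intro!: AE_I2)
    then have "U (T s v) = U v" unfolding v Uact[OF one_closed s] by (rule L2_class_eq)
    then show ?thesis using bij by (meson UNIV_I bij_betw_inv_into_left bij_betw_def inj_onD)
  qed
  then have "v \<in> fixed_space G \<Gamma> \<pi>" by (simp add: fixed_space_def)
  then obtain c where c: "v = scaleC c x" by (rule fixed_multiple)
  have "cinner v v = (\<integral>\<psi>. 1 * cnj 1 \<partial>\<nu>)"
    unfolding inner v by (rule L2_inner_class[OF one one])
  moreover have "cinner v v = c * cnj c"
    unfolding c cinner_scaleC_left cinner_scaleC_right by (simp add: cinner_self x_norm)
  ultimately have cc: "c * cnj c = 1" by (simp add: nu.prob_space)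
  show ?thesis
  proof (rule Fourier_unique[OF reg regular])
    fix g assume g: "g \<in> carrier G"
    have "(\<integral>\<psi>. \<psi> g \<partial>\<nu>) = cinner (P g v) v"
      unfolding inner v Uact[OF g Gam.one_closed]
      using L2_inner_class[OF rho_constant_class(2)[OF \<nu> g Gam.one_closed] one] by simp
    also have "\<dots> = (c * cnj c) * cinner (P g x) x"
      unfolding c rep_scale[OF g Gam.one_closed] by (simp add: cinner_scaleC_left cinner_scaleC_right)
    also have "\<dots> = (\<integral>\<psi>. \<psi> g \<partial>\<mu>)" using cc g by (simp add: Fourier coeff_fun_def)
    finally show "(\<integral>\<psi>. \<psi> g \<partial>\<nu>) = (\<integral>\<psi>. \<psi> g \<partial>\<mu>)" .
  qed
qed

end

lemma hdim_le:
  assumes "finite B" "S \<subseteq> complex_vector.span B"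
  shows "hdim S \<le> enat (card B)"
  using assms complex_vector.dim_le_card[OF assms(2,1)] by (auto simp: hdim_def)

theorem corollary3p12:
  fixes \<Gamma> :: "('s, 'm) monoid_scheme"
    and G :: "('g, 'n) monoid_scheme"
    and \<alpha> :: "'s \<Rightarrow> 'g \<Rightarrow> 'g"
    and \<pi> :: "'g \<times> 's \<Rightarrow> 'h::complex_hilbert_space \<Rightarrow> 'h"
  assumes "group \<Gamma>"
    and "comm_group G"
    and "acts_by_automorphisms \<Gamma> G \<alpha>"
    and "irreducible_unitary_rep (semidirect G \<Gamma> \<alpha>) \<pi>"
  shows "hdim (fixed_space G \<Gamma> \<pi>) \<le> 1 \<and>
    (hdim (fixed_space G \<Gamma> \<pi>) = 1 \<longrightarrow>
      (\<exists>!\<mu>. \<mu> \<in> ergodic_measures G \<Gamma> \<alpha> \<and>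
        unitarily_equivalent_L2 (semidirect G \<Gamma> \<alpha>) \<pi> \<mu> (rho G \<alpha> \<mu>)))"
proof (cases "fixed_space G \<Gamma> \<pi> \<subseteq> {0}")
  case True
  \<comment> \<open>Here the dimension is 0, so the second conjunct holds vacuously.\<close>
  then have "hdim (fixed_space G \<Gamma> \<pi>) \<le> 0"
    using hdim_le[of "{}" "fixed_space G \<Gamma> \<pi>"] by (simp add: zero_enat_def)
  then show ?thesis by simp
next
  case False
  then obtain y where y: "y \<in> fixed_space G \<Gamma> \<pi>" "y \<noteq> 0" by blast
  define x where "x = scaleC (of_real (1 / norm y)) y"
  have "unitary (\<pi> (\<one>\<^bsub>G\<^esub>, s))" if "s \<in> carrier \<Gamma>" for s
    using assms(4) that comm_group.axioms(1)[OF assms(2)]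
    by (auto simp: irreducible_unitary_rep_def unitary_rep_def hom_def semidirect_def unitary_group_def
        intro: monoid.one_closed comm_monoid.axioms)
  then have x: "x \<in> fixed_space G \<Gamma> \<pi>"
    using y(1) unitaryD(2) by (fastforce simp: fixed_space_def x_def)
  have "norm x = 1" using y(2) by (simp add: x_def scaleC_of_real del: of_real_divide)
  interpret auto_action G \<Gamma> \<alpha>
    using assms by (simp add: auto_action_def auto_action_axioms_def)
  interpret invariant_vector G \<Gamma> \<alpha> \<pi> x
    by unfold_locales (use assms x \<open>norm x = 1\<close> in auto)
  obtain \<mu> where \<mu>: "regular_borel_prob (dual_topology G) \<mu>"
    "\<And>g. g \<in> carrier G \<Longrightarrow> (\<integral>\<psi>. \<psi> g \<partial>\<mu>) = coeff_fun x g"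
    using ex_spectral_measure by blast
  interpret spectral G \<Gamma> \<alpha> \<pi> x \<mu>
    by unfold_locales (use \<mu> in auto)
  have "fixed_space G \<Gamma> \<pi> \<subseteq> complex_vector.span {x}"
  proof
    fix z assume "z \<in> fixed_space G \<Gamma> \<pi>"
    then obtain c where "z = scaleC c x" by (rule fixed_multiple)
    then show "z \<in> complex_vector.span {x}"
      by (simp add: complex_vector.span_scale complex_vector.span_base)
  qed
  then have "hdim (fixed_space G \<Gamma> \<pi>) \<le> 1"
    using hdim_le[of "{x}" "fixed_space G \<Gamma> \<pi>"] by (simp add: one_enat_def)
  moreover have "\<exists>!\<mu>. \<mu> \<in> ergodic_measures G \<Gamma> \<alpha> \<and>
      unitarily_equivalent_L2 (semidirect G \<Gamma> \<alpha>) \<pi> \<mu> (rho G \<alpha> \<mu>)"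
  proof (rule ex1I[of _ \<mu>])
    show "\<mu> \<in> ergodic_measures G \<Gamma> \<alpha> \<and> unitarily_equivalent_L2 (semidirect G \<Gamma> \<alpha>) \<pi> \<mu> (rho G \<alpha> \<mu>)"
      using mu_ergodic equivalent_rho by blast
    fix \<nu> assume "\<nu> \<in> ergodic_measures G \<Gamma> \<alpha> \<and> unitarily_equivalent_L2 (semidirect G \<Gamma> \<alpha>) \<pi> \<nu> (rho G \<alpha> \<nu>)"
    then show "\<nu> = \<mu>" using spectral_measure_unique by (simp add: ergodic_measures_def)
  qed
  ultimately show ?thesis by blast
qed

end
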